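(* Let $p$ be a prime. There is a deterministic algorithm which, given integers $a_1,\ldots,a_{2p-1}$, returns $p$ of these input elements (i.e., a set of indices $I\subseteq\{1,\ldots,2p-1\}$ with $|I|=p$) whose sum is divisible by $p$, and runs in $O(p)$ time.
   Context: Computational model: the word RAM, in which arithmetic, division with remainder, and modular inverses on $O(\log p)$-bit words are constant-time operations. *)

theory Defs
  imports
    Complex_Main
    "HOL-Library.Landau_Symbols"
    "HOL-Number_Theory.Number_Theory"
    "HOL-Number_Theory.Modular_Inverse"
begin

text \<open>
  A word RAM with word length \<open>w\<close>. Words are \<open>w\<close>-bit two's complement numbers, represented by
  their integer value; arithmetic wraps around modulo \<open>2 ^ w\<close>. Memory cells are addressed by
  words. A program is a finite list of instructions over statically named registers; it does not
  depend on \<open>w\<close> or on the input. Every instruction takes one unit of time.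
\<close>

definition is_word :: "nat \<Rightarrow> int \<Rightarrow> bool" where
  "is_word w x \<longleftrightarrow> - (2 ^ (w - 1)) \<le> x \<and> x < 2 ^ (w - 1)"

definition to_word :: "nat \<Rightarrow> int \<Rightarrow> int" where
  "to_word w x = signed_take_bit (w - 1) x"

type_synonym reg = nat

datatype binop = Add | Sub | Mul | Quot | Rem | Inv

text \<open>
  \<open>Quot\<close> and \<open>Rem\<close> are division with remainder rounding towards minus infinity, so the remainder
  modulo a positive number is the least nonnegative residue; division by zero gives quotient 0.
  \<open>Inv x m\<close> is the inverse of \<open>x\<close> modulo \<open>m\<close>, and 0 if there is none.
\<close>

fun eval_binop :: "binop \<Rightarrow> int \<Rightarrow> int \<Rightarrow> int" where
  "eval_binop Add x y = x + y"
| "eval_binop Sub x y = x - y"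
| "eval_binop Mul x y = x * y"
| "eval_binop Quot x y = x div y"
| "eval_binop Rem x y = x mod y"
| "eval_binop Inv x m = modular_inverse m x"

datatype instr =
  LoadConst reg int
| Move reg reg
| BinOp binop reg reg reg
| Load reg reg
| Store reg reg
| Jump nat
| JumpEq reg reg nat
| JumpLess reg reg nat

type_synonym program = "instr list"

record state =
  pc :: nat
  regs :: "reg \<Rightarrow> int"
  mem :: "int \<Rightarrow> int"

definition set_reg :: "reg \<Rightarrow> int \<Rightarrow> state \<Rightarrow> state" where
  "set_reg r x s = s\<lparr>pc := Suc (pc s), regs := (regs s)(r := x)\<rparr>"

text \<open>The destination is the first argument, except that \<open>Store r q\<close> writes \<open>q\<close> to the cell
  addressed by \<open>r\<close>.\<close>

fun exec_instr :: "nat \<Rightarrow> instr \<Rightarrow> state \<Rightarrow> state" where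
  "exec_instr w (LoadConst r k) s = set_reg r (to_word w k) s"
| "exec_instr w (Move r q) s = set_reg r (regs s q) s"
| "exec_instr w (BinOp f r q q') s = set_reg r (to_word w (eval_binop f (regs s q) (regs s q'))) s"
| "exec_instr w (Load r q) s = set_reg r (mem s (regs s q)) s"
| "exec_instr w (Store r q) s = s\<lparr>pc := Suc (pc s), mem := (mem s)(regs s r := regs s q)\<rparr>"
| "exec_instr w (Jump l) s = s\<lparr>pc := l\<rparr>"
| "exec_instr w (JumpEq r q l) s = s\<lparr>pc := (if regs s r = regs s q then l else Suc (pc s))\<rparr>"
| "exec_instr w (JumpLess r q l) s = s\<lparr>pc := (if regs s r < regs s q then l else Suc (pc s))\<rparr>"

definition halted :: "program \<Rightarrow> state \<Rightarrow> bool" where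
  "halted P s \<longleftrightarrow> length P \<le> pc s"

definition step :: "nat \<Rightarrow> program \<Rightarrow> state \<Rightarrow> state" where
  "step w P s = (if halted P s then s else exec_instr w (P ! pc s) s)"

text \<open>
  A list is stored in memory with its length in cell 0 and its entries in cells \<open>1, 2, \<dots>\<close>.
  Initially all other cells and all registers contain 0.
\<close>

definition init_state :: "int list \<Rightarrow> state" where
  "init_state xs = \<lparr>pc = 0, regs = (\<lambda>_. 0),
     mem = (\<lambda>j. if j = 0 then int (length xs)
                else if 1 \<le> j \<and> j \<le> int (length xs) then xs ! nat (j - 1) else 0)\<rparr>"

definition output_list :: "state \<Rightarrow> int list" where
  "output_list s = map (mem s) [1..mem s 0]"

definition returns_within :: "nat \<Rightarrow> program \<Rightarrow> int list \<Rightarrow> nat \<Rightarrow> int list \<Rightarrow> bool" where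
  "returns_within w P xs t ys \<longleftrightarrow>
     (\<exists>n\<le>t. let s = (step w P ^^ n) (init_state xs) in halted P s \<and> output_list s = ys)"

end

theory Submission
  imports Defs
begin

text \<open>
  Sort the indices by residue modulo \<open>p\<close>, and let item \<open>i\<close> be the pair of sorted positions \<open>i\<close> and
  \<open>i + p - 1\<close>, for \<open>i = 1, \<dots>, p - 1\<close>. If the two residues of some item agree, then \<open>p\<close> consecutive ones
  agree and we are done. Otherwise choose one index per item and add the last index; by choosing which
  index of an item counts as selected, an item becomes the option to add its folded gap
  \<open>min d (p - d)\<close>. Scale the gaps so that the most frequent size,
  occurring \<open>n\<close> times, becomes 1.

  Suppose that the gadgets built so far realise all sums in \<open>{0..L}\<close>. A remaining item of size at most
  \<open>L + 1\<close> enlarges \<open>L\<close> by its size. If there is none, two items of distinct sizes \<open>u < v\<close> with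
  \<open>v - u \<le> L + 1\<close> form a gadget that enlarges \<open>L\<close> by \<open>v - u\<close>. One of the two always applies while
  \<open>L < p - 1\<close>: otherwise the remaining sizes lie in \<open>{L + 2..p div 2}\<close> and are \<open>L + 2\<close> apart, and since no
  size occurs more than \<open>n \<le> L\<close> times, fewer than \<open>(p - 1) / 2\<close> items remain. But at most
  \<open>2 * L - n\<close> items have been used, so more than \<open>n\<close> remain, at least two sizes occur among them,
  \<open>4 * L < p\<close>, and more than half of the items remain. Scanning the sizes twice suffices to find all pairs, so all of this takes
  linear time. The gadget steps form a complete sequence with sum at least \<open>p - 1\<close>, hence a greedy
  choice from the last gadget to the first hits the required residue.
\<close>

subsection \<open>A structured language compiled to the word RAM\<close>

text \<open>Keeping the reachable sums as an interval \<open>{0..L}\<close> of integers, rather than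
  as a growing set of residues, leaves only the number \<open>L\<close> to maintain. The price is
  that an item larger than \<open>L + 1\<close> cannot be used alone, which forces the pairing. A
  pair may spend two items for a single unit, hence the accounting in \<open>2 * L\<close>.

  The scaling ties \<open>L\<close> to the multiplicities: items of size 1 always fit, so by the
  time a pair is needed they have raised \<open>L\<close> to at least \<open>n\<close>.

  Two scans suffice because the first one abandons a size only at distance at least
  \<open>L + 2\<close>, hence at least \<open>n + 2\<close>, from the next one. Each size left
  behind carries at most \<open>n\<close> items, and counting them yields
  \<open>4 * L \<ge> p + 3\<close>. From then on any two sizes in \<open>{L + 2..p div 2}\<close>
  differ by less than \<open>L + 2\<close>, so the second scan can pair whatever distinct sizes it
  meets.\<close>

datatype cond = CEq nat nat | CLt nat nat

datatype com =
  Skip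
| Const nat int
| Copy nat nat
| Op binop nat nat nat
| Get nat nat nat
| Put nat nat nat
| Seq com com (infixr ";;" 60)
| Cond cond com com
| Until cond com

type_synonym vars = "nat \<Rightarrow> int"
type_synonym arrays = "nat \<Rightarrow> int \<Rightarrow> int"

fun holds :: "cond \<Rightarrow> vars \<Rightarrow> bool" where
  "holds (CEq a b) x \<longleftrightarrow> x a = x b"
| "holds (CLt a b) x \<longleftrightarrow> x a < x b"

text \<open>The clock counts the machine steps of the compiled code; the jump that ends a branch or a loop
  body is charged on entry.\<close>

inductive exec :: "int \<Rightarrow> int \<Rightarrow> com \<Rightarrow> nat \<Rightarrow> vars \<Rightarrow> arrays \<Rightarrow> nat \<Rightarrow> vars \<Rightarrow> arrays \<Rightarrow> bool"
  for N B where
  Skip: "exec N B Skip t x m t x m"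
| Const: "\<bar>k\<bar> \<le> B \<Longrightarrow> exec N B (Const r k) t x m (t + 1) (x(r := k)) m"
| Copy: "exec N B (Copy r q) t x m (t + 1) (x(r := x q)) m"
| Op: "\<bar>eval_binop f (x q) (x q')\<bar> \<le> B \<Longrightarrow>
    exec N B (Op f r q q') t x m (t + 1) (x(r := eval_binop f (x q) (x q'))) m"
| Get: "k < 16 \<Longrightarrow> 0 \<le> x q \<Longrightarrow> x q < N \<Longrightarrow>
    exec N B (Get r k q) t x m (t + 4) (x(r := m k (x q))) m"
| Put: "k < 16 \<Longrightarrow> 0 \<le> x q \<Longrightarrow> x q < N \<Longrightarrow>
    exec N B (Put k q r) t x m (t + 4) x (m(k := (m k)(x q := x r)))"
| Seq: "exec N B c t x m t' x' m' \<Longrightarrow> exec N B d t' x' m' t'' x'' m'' \<Longrightarrow>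
    exec N B (c ;; d) t x m t'' x'' m''"
| CondT: "holds b x \<Longrightarrow> exec N B c (t + 1) x m t' x' m' \<Longrightarrow> exec N B (Cond b c d) t x m t' x' m'"
| CondF: "\<not> holds b x \<Longrightarrow> exec N B d (t + 2) x m t' x' m' \<Longrightarrow> exec N B (Cond b c d) t x m t' x' m'"
| UntilT: "holds b x \<Longrightarrow> exec N B (Until b c) t x m (t + 1) x m"
| UntilF: "\<not> holds b x \<Longrightarrow> exec N B c (t + 2) x m t' x' m' \<Longrightarrow>
    exec N B (Until b c) t' x' m' t'' x'' m'' \<Longrightarrow> exec N B (Until b c) t x m t'' x'' m''"

section \<open>Code generation and simulation on the machine\<close>

fun jump_if :: "cond \<Rightarrow> nat \<Rightarrow> instr" where
  "jump_if (CEq a b) l = JumpEq (a + 2) (b + 2) l"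
| "jump_if (CLt a b) l = JumpLess (a + 2) (b + 2) l"

text \<open>Register 0 is scratch space for addresses and register 1 holds the array length \<open>N\<close>;
  cell \<open>i\<close> of array \<open>k\<close> lives at address \<open>k * N + i\<close>.\<close>

definition addr_code :: "nat \<Rightarrow> nat \<Rightarrow> program" where
  "addr_code k q = [LoadConst 0 (int k), BinOp Mul 0 0 1, BinOp Add 0 0 (q + 2)]"

fun code_size :: "com \<Rightarrow> nat" where
  "code_size Skip = 0"
| "code_size (Const r k) = 1"
| "code_size (Copy r q) = 1"
| "code_size (Op f r q q') = 1"
| "code_size (Get r k q) = 4"
| "code_size (Put k q r) = 4"
| "code_size (c ;; d) = code_size c + code_size d"
| "code_size (Cond b c d) = code_size c + code_size d + 2"
| "code_size (Until b c) = code_size c + 2"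

text \<open>The then-branch is laid out last and falls through, so only the else-branch needs a
  closing \<open>Jump\<close>; hence the charges 1 and 2 in \<open>exec\<close>. The first argument
  is the absolute position of the code, since jump targets are absolute.\<close>

fun compile :: "nat \<Rightarrow> com \<Rightarrow> program" where
  "compile i Skip = []"
| "compile i (Const r k) = [LoadConst (r + 2) k]"
| "compile i (Copy r q) = [Move (r + 2) (q + 2)]"
| "compile i (Op f r q q') = [BinOp f (r + 2) (q + 2) (q' + 2)]"
| "compile i (Get r k q) = addr_code k q @ [Load (r + 2) 0]"
| "compile i (Put k q r) = addr_code k q @ [Store 0 (r + 2)]"
| "compile i (c ;; d) = compile i c @ compile (i + code_size c) d"
| "compile i (Cond b c d) =
    jump_if b (i + code_size d + 2) # compile (i + 1) d @
    Jump (i + code_size c + code_size d + 2) # compile (i + code_size d + 2) c"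
| "compile i (Until b c) =
    jump_if b (i + code_size c + 2) # compile (i + 1) c @ [Jump i]"

lemma length_addr_code [simp]: "length (addr_code k q) = 3"
  by (simp add: addr_code_def)

lemma length_compile [simp]: "length (compile i c) = code_size c"
  by (induction c arbitrary: i) auto

definition code_at :: "program \<Rightarrow> nat \<Rightarrow> program \<Rightarrow> bool" where
  "code_at P i cs \<longleftrightarrow> (\<forall>j<length cs. i + j < length P \<and> P ! (i + j) = cs ! j)"

lemma code_at_Nil [simp]: "code_at P i []"
  by (simp add: code_at_def)

lemma code_at_Cons [simp]:
  "code_at P i (c # cs) \<longleftrightarrow> i < length P \<and> P ! i = c \<and> code_at P (Suc i) cs"
  by (auto simp: code_at_def nth_Cons less_Suc_eq_0_disj split: nat.splits)

lemma code_at_append [simp]: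
  "code_at P i (cs @ ds) \<longleftrightarrow> code_at P i cs \<and> code_at P (i + length cs) ds"
  by (induction cs arbitrary: i) auto

text \<open>Array 0 occupies the addresses \<open>0..N - 1\<close>. With \<open>N = 2 * p\<close> it
  coincides with the list format of input and output, so neither has to be copied.\<close>

definition represents :: "int \<Rightarrow> state \<Rightarrow> vars \<Rightarrow> arrays \<Rightarrow> bool" where
  "represents N S x m \<longleftrightarrow> regs S 1 = N \<and> (\<forall>r. regs S (r + 2) = x r) \<and>
     (\<forall>k i. 0 \<le> i \<and> i < N \<longrightarrow> mem S (int k * N + i) = m k i)"

lemma to_word_eq: "\<bar>x\<bar> < 2 ^ (w - 1) \<Longrightarrow> to_word w x = x"
  unfolding to_word_def by (rule signed_take_bit_int_eq_self) auto

lemma address_eq_iff: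
  fixes N i j :: int
  assumes "0 \<le> i" "i < N" "0 \<le> j" "j < N"
  shows "int k * N + i = int l * N + j \<longleftrightarrow> k = l \<and> i = j"
proof
  assume eq: "int k * N + i = int l * N + j"
  have "(int k * N + i) div N = int k" "(int l * N + j) div N = int l"
    using assms by auto
  with eq show "k = l \<and> i = j" by auto
qed auto

lemma represents_set_reg:
  assumes "represents N S x m"
  shows "represents N (set_reg (r + 2) v S) (x(r := v)) m" "represents N (set_reg 0 v S) x m"
  using assms by (auto simp: represents_def set_reg_def)

lemma represents_pc: "represents N (S\<lparr>pc := l\<rparr>) x m \<longleftrightarrow> represents N S x m"
  by (simp add: represents_def)

lemma step_at: "code_at P i (c # cs) \<Longrightarrow> pc S = i \<Longrightarrow> step w P S = exec_instr w c S"
  by (auto simp: step_def halted_def)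

text \<open>Having at most 16 arrays keeps every address below \<open>16 * N\<close>, so the address
  computation never wraps around.\<close>

lemma addr_code_correct:
  assumes "represents N S x m" "code_at P i (addr_code k q)" "pc S = i"
    and "k < 16" "0 \<le> x q" "x q < N" "16 * N < 2 ^ (w - 1)" "16 < (2::int) ^ (w - 1)"
  shows "\<exists>S'. (step w P ^^ 3) S = S' \<and> represents N S' x m \<and> pc S' = i + 3 \<and>
    regs S' 0 = int k * N + x q"
proof -
  have k: "int k \<le> 15" using assms(4) by simp
  have N: "0 \<le> N" using assms by simp
  have b: "int k * N \<le> 15 * N" using k N by (intro mult_right_mono) auto
  have b0: "0 \<le> int k * N" using N by simp
  have w: "to_word w (int k) = int k" "to_word w (int k * N) = int k * N"
    "to_word w (int k * N + x q) = int k * N + x q"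
    by (rule to_word_eq; use assms b b0 k in linarith)+
  have r1: "regs S 1 = N" and rq: "\<And>r. regs S (r + 2) = x r"
    using assms(1) by (auto simp: represents_def)
  define S1 where "S1 = set_reg 0 (int k) S"
  define S2 where "S2 = set_reg 0 (int k * N) S1"
  define S3 where "S3 = set_reg 0 (int k * N + x q) S2"
  have "step w P S = S1" "step w P S1 = S2" "step w P S2 = S3"
    using assms(2,3) rq[of q]
    by (auto simp: step_def halted_def addr_code_def S1_def S2_def S3_def set_reg_def w r1 r1[simplified])
  then have "(step w P ^^ 3) S = S3"
    by (simp add: numeral_eq_Suc)
  moreover have "represents N S3 x m"
    unfolding S1_def S2_def S3_def by (intro represents_set_reg assms)
  moreover have "pc S3 = i + 3" "regs S3 0 = int k * N + x q"
    using assms(3) by (auto simp: S1_def S2_def S3_def set_reg_def)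
  ultimately show ?thesis by blast
qed

lemma funpow_add_apply: "(f ^^ a) y = z \<Longrightarrow> (f ^^ b) z = u \<Longrightarrow> (f ^^ (a + b)) y = u"
  by (metis add.commute comp_apply funpow_add)

lemma holds_jump_if:
  assumes "represents N S x m"
  shows "exec_instr w (jump_if b l) S = S\<lparr>pc := (if holds b x then l else Suc (pc S))\<rparr>"
  using assms by (cases b) (auto simp: represents_def)

text \<open>Results of \<open>Op\<close> and \<open>Const\<close> are bounded by \<open>B\<close>,
  so \<open>to_word\<close> leaves them unchanged and the run is simulated with its exact clock.
  \<open>Copy\<close> and \<open>Get\<close> only move existing words and need no bound, which
  admits input entries larger than \<open>B\<close>.\<close>

lemma compile_correct:
  assumes "exec N B c t x m t' x' m'"
    and "represents N S x m" "code_at P i (compile i c)" "pc S = i"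
    and "B < 2 ^ (w - 1)" "16 * N < 2 ^ (w - 1)" "16 < (2::int) ^ (w - 1)"
  shows "\<exists>n S'. t' = t + n \<and> (step w P ^^ n) S = S' \<and> represents N S' x' m' \<and>
    pc S' = i + code_size c"
  using assms
proof (induction arbitrary: S i rule: exec.induct)
  case (Skip t x m)
  then show ?case by (intro exI[of _ 0]) auto
next
  case (Const k r t x m)
  have "step w P S = set_reg (r + 2) k S"
    using Const step_at[of P i "LoadConst (r + 2) k" "[]" S w] by (simp add: to_word_eq)
  with Const show ?case
    by (intro exI[of _ 1]) (auto simp: set_reg_def represents_def)
next
  case (Copy r q t x m)
  have "step w P S = set_reg (r + 2) (x q) S"
    using Copy step_at[of P i "Move (r + 2) (q + 2)" "[]" S w] by (simp add: represents_def)
  with Copy show ?case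
    by (intro exI[of _ 1]) (auto simp: set_reg_def represents_def)
next
  case (Op f x q q' r t m)
  have rq: "regs S (r + 2) = x r" for r using Op.prems by (auto simp: represents_def)
  have "step w P S = set_reg (r + 2) (eval_binop f (x q) (x q')) S"
    using Op step_at[of P i "BinOp f (r + 2) (q + 2) (q' + 2)" "[]" S w] rq[of q] rq[of q']
    by (simp add: to_word_eq)
  with Op show ?case
    by (intro exI[of _ 1]) (auto simp: set_reg_def represents_def)
next
  case (Get k x q r t m)
  from Get.prems have ca: "code_at P i (addr_code k q)" and cl: "code_at P (i + 3) [Load (r + 2) 0]"
    by auto
  from addr_code_correct[OF Get.prems(1) ca Get.prems(3) Get.hyps Get.prems(5,6)]
  obtain S1 where S1: "(step w P ^^ 3) S = S1" "represents N S1 x m" "pc S1 = i + 3"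
    "regs S1 0 = int k * N + x q" by blast
  have "step w P S1 = set_reg (r + 2) (m k (x q)) S1"
    using step_at[OF cl S1(3)] S1 Get.hyps by (auto simp: represents_def)
  then have s: "(step w P ^^ 1) S1 = set_reg (r + 2) (m k (x q)) S1" by simp
  have "(step w P ^^ 4) S = set_reg (r + 2) (m k (x q)) S1"
    using funpow_add_apply[OF S1(1) s] by simp
  moreover have "pc (set_reg (r + 2) (m k (x q)) S1) = i + code_size (Get r k q)"
    using S1(3) by (simp add: set_reg_def)
  ultimately show ?case
    using represents_set_reg(1)[OF S1(2)] by blast
next
  case (Put k x q r t m)
  from Put.prems have ca: "code_at P i (addr_code k q)" and cl: "code_at P (i + 3) [Store 0 (r + 2)]"
    by auto
  from addr_code_correct[OF Put.prems(1) ca Put.prems(3) Put.hyps Put.prems(5,6)]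
  obtain S1 where S1: "(step w P ^^ 3) S = S1" "represents N S1 x m" "pc S1 = i + 3"
    "regs S1 0 = int k * N + x q" by blast
  define S2 where "S2 = S1\<lparr>pc := Suc (pc S1), mem := (mem S1)(int k * N + x q := x r)\<rparr>"
  have "step w P S1 = S2"
    using step_at[OF cl S1(3)] S1 by (simp add: represents_def S2_def)
  then have s: "(step w P ^^ 1) S1 = S2" by simp
  have "(step w P ^^ 4) S = S2"
    using funpow_add_apply[OF S1(1) s] by simp
  moreover have "represents N S2 x (m(k := (m k)(x q := x r)))"
    using S1(2) Put.hyps address_eq_iff[of _ N "x q" _ k]
    by (auto simp: represents_def S2_def)
  moreover have "pc S2 = i + code_size (Put k q r)"
    using S1(3) by (simp add: S2_def)
  ultimately show ?case by blast
next
  case (Seq c t x m t' x' m' d t'' x'' m'')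
  from Seq.prems have ca: "code_at P i (compile i c)" "code_at P (i + code_size c) (compile (i + code_size c) d)"
    by auto
  from Seq.IH(1)[OF Seq.prems(1) ca(1) Seq.prems(3-6)] obtain n1 S1 where
    1: "t' = t + n1" "(step w P ^^ n1) S = S1" "represents N S1 x' m'" "pc S1 = i + code_size c"
    by blast
  from Seq.IH(2)[OF 1(3) ca(2) 1(4) Seq.prems(4-6)] obtain n2 S2 where
    2: "t'' = t' + n2" "(step w P ^^ n2) S1 = S2" "represents N S2 x'' m''"
      "pc S2 = i + code_size c + code_size d"
    by blast
  show ?case using 1 2 funpow_add_apply[OF 1(2) 2(2)]
    by (intro exI[of _ "n1 + n2"] exI[of _ S2]) auto
next
  case (CondT b x c t m t' x' m' d)
  from CondT.prems have c1: "code_at P i [jump_if b (i + code_size d + 2)]"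
    and c2: "code_at P (i + code_size d + 2) (compile (i + code_size d + 2) c)"
    by auto
  define S1 where "S1 = S\<lparr>pc := i + code_size d + 2\<rparr>"
  have 1: "(step w P ^^ 1) S = S1"
    using step_at[OF c1 CondT.prems(3)] holds_jump_if[OF CondT.prems(1)] CondT.hyps by (simp add: S1_def)
  have r: "represents N S1 x m" using CondT.prems(1) by (simp add: S1_def represents_pc)
  from CondT.IH[OF r c2 _ CondT.prems(4-6)] obtain n2 S2 where
    2: "t' = t + 1 + n2" "(step w P ^^ n2) S1 = S2" "represents N S2 x' m'"
      "pc S2 = i + code_size d + 2 + code_size c"
    by (auto simp: S1_def)
  show ?case using 2 funpow_add_apply[OF 1 2(2)]
    by (intro exI[of _ "1 + n2"] exI[of _ S2]) auto
next
  case (CondF b x d t m t' x' m' c)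
  from CondF.prems have c1: "code_at P i [jump_if b (i + code_size d + 2)]"
    and c2: "code_at P (i + 1) (compile (i + 1) d)"
    and c3: "code_at P (i + 1 + code_size d) [Jump (i + code_size c + code_size d + 2)]"
    by auto
  define S1 where "S1 = S\<lparr>pc := i + 1\<rparr>"
  have 1: "(step w P ^^ 1) S = S1"
    using step_at[OF c1 CondF.prems(3)] holds_jump_if[OF CondF.prems(1)] CondF.hyps CondF.prems(3)
    by (simp add: S1_def)
  have r: "represents N S1 x m" using CondF.prems(1) by (simp add: S1_def represents_pc)
  from CondF.IH[OF r c2 _ CondF.prems(4-6)] obtain n2 S2 where
    2: "t' = t + 2 + n2" "(step w P ^^ n2) S1 = S2" "represents N S2 x' m'"
      "pc S2 = i + 1 + code_size d"
    by (auto simp: S1_def)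
  define S3 where "S3 = S2\<lparr>pc := i + code_size c + code_size d + 2\<rparr>"
  have 3: "(step w P ^^ 1) S2 = S3"
    using step_at[OF c3 2(4)] by (simp add: S3_def)
  show ?case using 2 funpow_add_apply[OF funpow_add_apply[OF 1 2(2)] 3]
    by (intro exI[of _ "1 + n2 + 1"] exI[of _ S3]) (auto simp: S3_def represents_pc)
next
  case (UntilT b x c t m)
  from UntilT.prems have c1: "code_at P i [jump_if b (i + code_size c + 2)]" by auto
  define S1 where "S1 = S\<lparr>pc := i + code_size c + 2\<rparr>"
  have "(step w P ^^ 1) S = S1"
    using step_at[OF c1 UntilT.prems(3)] holds_jump_if[OF UntilT.prems(1)] UntilT.hyps
    by (simp add: S1_def)
  then show ?case using UntilT.prems
    by (intro exI[of _ 1] exI[of _ S1]) (auto simp: S1_def represents_pc)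
next
  case (UntilF b x c t m t' x' m' t'' x'' m'')
  from UntilF.prems have c1: "code_at P i [jump_if b (i + code_size c + 2)]"
    and c2: "code_at P (i + 1) (compile (i + 1) c)"
    and c3: "code_at P (i + 1 + code_size c) [Jump i]"
    by auto
  define S1 where "S1 = S\<lparr>pc := i + 1\<rparr>"
  have 1: "(step w P ^^ 1) S = S1"
    using step_at[OF c1 UntilF.prems(3)] holds_jump_if[OF UntilF.prems(1)] UntilF.hyps UntilF.prems(3)
    by (simp add: S1_def)
  have r: "represents N S1 x m" using UntilF.prems(1) by (simp add: S1_def represents_pc)
  from UntilF.IH(1)[OF r c2 _ UntilF.prems(4-6)] obtain n2 S2 where
    2: "t' = t + 2 + n2" "(step w P ^^ n2) S1 = S2" "represents N S2 x' m'"
      "pc S2 = i + 1 + code_size c"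
    by (auto simp: S1_def)
  define S3 where "S3 = S2\<lparr>pc := i\<rparr>"
  have 3: "(step w P ^^ 1) S2 = S3"
    using step_at[OF c3 2(4)] by (simp add: S3_def)
  have r3: "represents N S3 x' m'" "pc S3 = i" using 2(3) by (simp_all add: S3_def represents_pc)
  from UntilF.IH(2)[OF r3(1) UntilF.prems(2) r3(2) UntilF.prems(4-6)] obtain n4 S4 where
    4: "t'' = t' + n4" "(step w P ^^ n4) S3 = S4" "represents N S4 x'' m''"
      "pc S4 = i + code_size (Until b c)"
    by blast
  show ?case using 2 4 funpow_add_apply[OF funpow_add_apply[OF funpow_add_apply[OF 1 2(2)] 3] 4(2)]
    by (intro exI[of _ "1 + n2 + 1 + n4"] exI[of _ S4]) auto
qed

text \<open>A total correctness statement, since a finished run must exist. The rules below are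
  equivalences, so \<open>simp\<close> executes straight-line code symbolically and leaves bounds on
  values and indices.\<close>

definition wp :: "int \<Rightarrow> int \<Rightarrow> com \<Rightarrow> (nat \<Rightarrow> vars \<Rightarrow> arrays \<Rightarrow> bool) \<Rightarrow> nat \<Rightarrow> vars \<Rightarrow> arrays \<Rightarrow> bool" where
  "wp N B c Q t x m \<longleftrightarrow> (\<exists>t' x' m'. exec N B c t x m t' x' m' \<and> Q t' x' m')"

lemma wp_Skip [simp]: "wp N B Skip Q t x m \<longleftrightarrow> Q t x m"
  unfolding wp_def by (auto simp: exec.simps[of N B "Skip"])

lemma wp_Const [simp]: "wp N B (Const r k) Q t x m \<longleftrightarrow> \<bar>k\<bar> \<le> B \<and> Q (t + 1) (x(r := k)) m"
  unfolding wp_def by (auto simp: exec.simps[of N B "Const r k"])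

lemma wp_Copy [simp]: "wp N B (Copy r q) Q t x m \<longleftrightarrow> Q (t + 1) (x(r := x q)) m"
  unfolding wp_def by (auto simp: exec.simps[of N B "Copy r q"])

lemma wp_Op [simp]: "wp N B (Op f r q q') Q t x m \<longleftrightarrow>
    \<bar>eval_binop f (x q) (x q')\<bar> \<le> B \<and> Q (t + 1) (x(r := eval_binop f (x q) (x q'))) m"
  unfolding wp_def by (auto simp: exec.simps[of N B "Op f r q q'"])

lemma wp_Get [simp]: "wp N B (Get r k q) Q t x m \<longleftrightarrow>
    k < 16 \<and> 0 \<le> x q \<and> x q < N \<and> Q (t + 4) (x(r := m k (x q))) m"
  unfolding wp_def by (auto simp: exec.simps[of N B "Get r k q"])

lemma wp_Put [simp]: "wp N B (Put k q r) Q t x m \<longleftrightarrow>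
    k < 16 \<and> 0 \<le> x q \<and> x q < N \<and> Q (t + 4) x (m(k := (m k)(x q := x r)))"
  unfolding wp_def by (auto simp: exec.simps[of N B "Put k q r"])

lemma wp_Seq [simp]: "wp N B (c ;; d) Q t x m \<longleftrightarrow> wp N B c (wp N B d Q) t x m"
  unfolding wp_def by (simp add: exec.simps[of N B "c ;; d"]) blast

lemma wp_Cond [simp]:
  "wp N B (Cond b c d) Q t x m \<longleftrightarrow>
    (if holds b x then wp N B c Q (t + 1) x m else wp N B d Q (t + 2) x m)"
  unfolding wp_def by (auto simp: exec.simps[of N B "Cond b c d"])

lemma wp_mono: "wp N B c Q t x m \<Longrightarrow> (\<And>t x m. Q t x m \<Longrightarrow> Q' t x m) \<Longrightarrow> wp N B c Q' t x m"
  unfolding wp_def by blast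

text \<open>The clock increases in every iteration, so an invariant that bounds it also proves
  termination.\<close>

lemma wp_Until:
  assumes "I t x m"
    and body: "\<And>t x m. I t x m \<Longrightarrow> \<not> holds b x \<Longrightarrow> wp N B c I (t + 2) x m"
    and exit: "\<And>t x m. I t x m \<Longrightarrow> holds b x \<Longrightarrow> Q (t + 1) x m"
    and bound: "\<And>t x m. I t x m \<Longrightarrow> int t \<le> T"
  shows "wp N B (Until b c) Q t x m"
  using assms(1)
proof (induction "nat (T - int t)" arbitrary: t x m rule: less_induct)
  case less
  show ?case
  proof (cases "holds b x")
    case True
    with exit[OF less.prems] show ?thesis
      unfolding wp_def by (blast intro: exec.intros)
  next
    case False
    from body[OF less.prems False] obtain t' x' m' where
      1: "exec N B c (t + 2) x m t' x' m'" "I t' x' m'" unfolding wp_def by blast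
    have "t + 2 \<le> t'"
      using 1(1) by (induction rule: exec.induct) auto
    with bound[OF 1(2)] have "nat (T - int t') < nat (T - int t)" by auto
    from less.hyps[OF this 1(2)] 1(1) False show ?thesis
      unfolding wp_def by (blast intro: exec.intros)
  qed
qed

subsection \<open>Scheduling the gadgets\<close>

text \<open>Induction on the maximum: all elements other than the largest \<open>b\<close> are at
  most \<open>b - d\<close>, which serves as their bound \<open>M\<close>.\<close>

lemma spaced_card_bound:
  fixes S :: "int set" and d M :: int
  assumes "finite S" "0 \<le> M" "\<And>y. y \<in> S \<Longrightarrow> d \<le> y \<and> y \<le> M"
    and "\<And>y z. y \<in> S \<Longrightarrow> z \<in> S \<Longrightarrow> y < z \<Longrightarrow> d \<le> z - y"
  shows "int (card S) * d \<le> M"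
  using assms
proof (induction S arbitrary: M rule: finite_linorder_max_induct)
  case empty
  then show ?case by simp
next
  case (insert b A)
  have "int (card A) * d \<le> b - d"
  proof (rule insert.IH)
    show "0 \<le> b - d" using insert.prems(2)[of b] by simp
    show "d \<le> y \<and> y \<le> b - d" if "y \<in> A" for y
      using insert.prems(2)[of y] insert.prems(3)[of y b] insert.hyps(2) that by auto
    show "d \<le> z - y" if "y \<in> A" "z \<in> A" "y < z" for y z
      using insert.prems(3) that by auto
  qed
  moreover have "card (insert b A) = Suc (card A)" using insert.hyps by auto
  ultimately show ?case using insert.prems(2)[of b] by (simp add: algebra_simps)
qed

lemma sum_mult_fun_upd:
  fixes f k :: "'a \<Rightarrow> int"
  assumes "finite A" "u \<in> A"
  shows "(\<Sum>y\<in>A. f y * (k(u := c)) y) = (\<Sum>y\<in>A. f y * k y) + f u * (c - k u)"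
proof -
  have "(\<Sum>y\<in>A - {u}. f y * (k(u := c)) y) = (\<Sum>y\<in>A - {u}. f y * k y)"
    by (rule sum.cong) auto
  then show ?thesis
    using assms by (simp add: sum.remove[OF assms] algebra_simps)
qed

lemma sum_fun_upd:
  fixes k :: "'a \<Rightarrow> int"
  assumes "finite A" "u \<in> A"
  shows "sum (k(u := c)) A = sum k A + c - k u"
  using sum_mult_fun_upd[OF assms, of "\<lambda>_. 1" k c] by simp

text \<open>Here \<open>k c\<close> is the number of unused items of size \<open>c\<close>, the gadgets made so far realise every
  sum in \<open>{0..L}\<close>, \<open>lo\<close> is a lower bound for the sizes still in use, \<open>n\<close> is the initial number of
  items of size 1, and \<open>u < v\<close> are the two scan positions at which items are paired.\<close>

definition sched_inv :: "int \<Rightarrow> int \<Rightarrow> (int \<Rightarrow> int) \<Rightarrow> int \<Rightarrow> int \<Rightarrow> int \<Rightarrow> int \<Rightarrow> bool" where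
  "sched_inv p n k lo u v L \<longleftrightarrow>
     (\<forall>y. 0 \<le> k y \<and> k y \<le> n) \<and> (\<forall>y. 0 < k y \<longrightarrow> lo \<le> y \<and> 2 * y \<le> p) \<and>
     1 \<le> n \<and> 1 \<le> lo \<and> lo \<le> p \<and> 0 \<le> L \<and> n \<le> L + k 1 \<and>
     p - 1 + n \<le> sum k {1..p} + 2 * L + k 1 \<and>
     p - 1 \<le> L + (\<Sum>y\<in>{1..p}. y * k y) \<and> 0 \<le> u \<and> u < v \<and> v \<le> p"

text \<open>Every size left behind by the first scan is isolated, so that few items remain when it ends; the second scan, which starts with \<open>L\<close> above a quarter of \<open>p\<close>, leaves nothing
  behind.\<close>

definition first_scan :: "int \<Rightarrow> (int \<Rightarrow> int) \<Rightarrow> int \<Rightarrow> int \<Rightarrow> bool" where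
  "first_scan n k u v \<longleftrightarrow> (\<forall>y. u < y \<and> y < v \<longrightarrow> k y = 0) \<and>
     (\<forall>y. y < u \<and> 0 < k y \<longrightarrow> n + 2 \<le> u - y) \<and>
     (\<forall>y z. y < z \<and> z < u \<and> 0 < k y \<and> 0 < k z \<longrightarrow> n + 2 \<le> z - y)"

definition second_scan :: "int \<Rightarrow> (int \<Rightarrow> int) \<Rightarrow> int \<Rightarrow> int \<Rightarrow> int \<Rightarrow> bool" where
  "second_scan p k u v L \<longleftrightarrow> p + 3 \<le> 4 * L \<and> (\<forall>y. y < v \<and> 0 < k y \<longrightarrow> y = u)"

text \<open>\<open>\<Phi>\<close> bounds the number of actions still possible: each raises
  \<open>lo\<close>, consumes items, raises \<open>v\<close>, or restarts the scan. The first scan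
  carries \<open>p + 2\<close> extra to pay for resetting \<open>v\<close>.\<close>

definition sched :: "int \<Rightarrow> int \<Rightarrow> (int \<Rightarrow> int) \<Rightarrow> int \<Rightarrow> int \<Rightarrow> int \<Rightarrow> int \<Rightarrow> int \<Rightarrow> bool" where
  "sched p n k lo u v L \<Phi> \<longleftrightarrow> sched_inv p n k lo u v L \<and>
     (first_scan n k u v \<and> p - lo + sum k {1..p} + 2 * p + 2 - v \<le> \<Phi> \<or>
      second_scan p k u v L \<and> p - lo + sum k {1..p} + p - v \<le> \<Phi>)"

lemma sched_bounds:
  assumes "sched p n k lo u v L \<Phi>"
  shows "1 \<le> lo" "lo \<le> p" "0 \<le> L" "0 \<le> u" "u < v" "v \<le> p" "0 \<le> \<Phi>" "0 \<le> sum k {1..p}"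
proof -
  show "1 \<le> lo" "lo \<le> p" "0 \<le> L" "0 \<le> u" "u < v" "v \<le> p"
    using assms by (auto simp: sched_def sched_inv_def)
  show *: "0 \<le> sum k {1..p}"
    using assms by (intro sum_nonneg) (auto simp: sched_def sched_inv_def)
  then show "0 \<le> \<Phi>" using assms by (auto simp: sched_def sched_inv_def)
qed

text \<open>The conjunct of \<open>sched_inv\<close> with the weighted sum keeps enough total size
  in reserve to reach \<open>p - 1\<close>; with no items left it would read
  \<open>p - 1 \<le> L\<close>.\<close>

lemma sched_nonempty:
  assumes "sched_inv p n k lo u v L" "L < p - 1"
  shows "\<exists>y. 0 < k y \<and> lo \<le> y \<and> 2 * y \<le> p"
proof (rule ccontr)
  assume *: "\<not> ?thesis"
  have "k y = 0" for y
    using assms(1) * unfolding sched_inv_def by (metis antisym_conv not_le)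
  then show False using assms by (auto simp: sched_inv_def)
qed

text \<open>Some item remains and its size exceeds \<open>lo\<close>; this keeps
  \<open>lo + 1 \<le> p\<close>.\<close>

lemma sched_advance:
  assumes "sched p n k lo u v L \<Phi>" "L < p - 1" "k lo = 0"
  shows "sched p n k (lo + 1) u v L (\<Phi> - 1)"
proof -
  from assms have inv: "sched_inv p n k lo u v L" by (simp add: sched_def)
  obtain y where y: "0 < k y" "lo \<le> y" "2 * y \<le> p" using sched_nonempty[OF inv assms(2)] by auto
  have ne: "lo + 1 \<le> z" if "0 < k z" for z
  proof -
    have "lo \<le> z" "z \<noteq> lo" using inv assms(3) that by (auto simp: sched_inv_def)
    then show ?thesis by simp
  qed
  have "lo + 1 \<le> p" using ne[OF y(1)] y inv by (auto simp: sched_inv_def)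
  then have "sched_inv p n k (lo + 1) u v L"
    using inv ne by (auto simp: sched_inv_def)
  then show ?thesis using assms(1) unfolding sched_def by (smt (verit))
qed

lemma first_scan_mono:
  "first_scan n k u v \<Longrightarrow> (\<And>y. 0 \<le> k' y \<and> k' y \<le> k y) \<Longrightarrow> first_scan n k' u v"
  unfolding first_scan_def by (metis order_antisym_conv order_less_le_trans)

lemma second_scan_mono:
  "second_scan p k u v L \<Longrightarrow> (\<And>y. 0 \<le> k' y \<and> k' y \<le> k y) \<Longrightarrow> L \<le> L' \<Longrightarrow> second_scan p k' u v L'"
  unfolding second_scan_def by (smt (verit))

text \<open>The weighted reserve is unchanged, because \<open>L\<close> gains what the items lose.
  In the item count, \<open>2 * L\<close> rises by at least 2, which pays for the item and, if
  \<open>lo = 1\<close>, also for the drop of \<open>k 1\<close>.\<close>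

lemma sched_single:
  assumes "sched p n k lo u v L \<Phi>" "0 < k lo" "lo < L + 2"
  shows "sched p n (k(lo := k lo - 1)) lo u v (L + lo) (\<Phi> - 1)"
proof -
  let ?k = "k(lo := k lo - 1)"
  from assms have inv: "sched_inv p n k lo u v L" by (simp add: sched_def)
  have lo: "lo \<in> {1..p}" using inv by (auto simp: sched_inv_def)
  have s: "sum ?k {1..p} = sum k {1..p} - 1"
    using sum_fun_upd[of "{1..p}" lo k "k lo - 1"] lo by simp
  have s2: "(\<Sum>y\<in>{1..p}. y * ?k y) = (\<Sum>y\<in>{1..p}. y * k y) - lo"
    using sum_mult_fun_upd[of "{1..p}" lo "\<lambda>y. y" k "k lo - 1"] lo by simp
  have k: "0 \<le> ?k y \<and> ?k y \<le> k y" for y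
    using inv assms(2) by (auto simp: sched_inv_def)
  have a: "\<forall>y. 0 \<le> ?k y \<and> ?k y \<le> n" using k inv unfolding sched_inv_def by (meson order_trans)
  have b: "\<forall>y. 0 < ?k y \<longrightarrow> lo \<le> y \<and> 2 * y \<le> p"
    using k inv unfolding sched_inv_def by (meson order_less_le_trans)
  have c: "n \<le> L + lo + ?k 1" "p - 1 + n \<le> sum ?k {1..p} + 2 * (L + lo) + ?k 1"
    unfolding s using inv by (auto simp: sched_inv_def)
  have "sched_inv p n ?k lo u v (L + lo)"
    unfolding sched_inv_def s2 using a b c inv[unfolded sched_inv_def] by auto
  then show ?thesis
    using assms(1) first_scan_mono[of n k u v ?k, OF _ k] second_scan_mono[of p k u v L ?k "L + lo", OF _ k] lo
    unfolding sched_def s by auto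
qed

text \<open>Blocked means that no remaining item fits alone, so size 1 is exhausted. Two conjuncts
  of \<open>sched_inv\<close> then say that \<open>L\<close> has reached \<open>n\<close> and that
  at most \<open>2 * L - n\<close> of the \<open>p - 1\<close> items are used.\<close>

lemma sched_blocked:
  assumes "sched_inv p n k lo u v L" "L + 2 \<le> lo"
  shows "k 1 = 0" "n \<le> L" "p - 1 + n \<le> sum k {1..p} + 2 * L"
proof -
  show 1: "k 1 = 0"
  proof (rule ccontr)
    assume "k 1 \<noteq> 0"
    then have "0 < k 1" using assms(1) unfolding sched_inv_def by (metis order_le_less)
    then show False using assms by (auto simp: sched_inv_def)
  qed
  then show "n \<le> L" "p - 1 + n \<le> sum k {1..p} + 2 * L"
    using assms by (auto simp: sched_inv_def)
qed

text \<open>Here \<open>v = p\<close>, so a scan has ended. The end of the first scan opens the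
  second, and the end of the second is contradictory, so only one restart ever happens.\<close>

lemma sched_restart:
  assumes "sched p n k lo u p L \<Phi>" "0 < k lo" "L + 2 \<le> lo"
  shows "sched p n k lo lo (lo + 1) L (\<Phi> - 1)"
proof -
  from assms have inv: "sched_inv p n k lo u p L" by (simp add: sched_def)
  note bl = sched_blocked[OF inv assms(3)]
  have n1: "1 \<le> n" and k: "\<And>y. 0 \<le> k y \<and> k y \<le> n" and sup: "\<And>y. 0 < k y \<Longrightarrow> lo \<le> y \<and> 2 * y \<le> p"
    and lo: "1 \<le> lo" "0 \<le> L" "lo \<le> p"
    using inv by (auto simp: sched_inv_def)
  have lo2: "2 * lo \<le> p" using sup[OF assms(2)] by simp
  have inv': "sched_inv p n k lo lo (lo + 1) L"
    using inv lo lo2 by (auto simp: sched_inv_def)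
  define V where "V = {y. 0 < k y}"
  have V: "V \<subseteq> {1..p}" using sup lo by (force simp: V_def)
  then have fV: "finite V" by (rule finite_subset) simp
  have "sum k {1..p} = sum k V"
    using V k by (intro sum.mono_neutral_right) (auto simp: V_def order_le_less)
  also have "\<dots> \<le> (\<Sum>y\<in>V. n)" using k by (intro sum_mono) auto
  finally have R: "sum k {1..p} \<le> int (card V) * n" by simp
  have loV: "lo \<in> V" using assms(2) by (simp add: V_def)
  have cV: "1 \<le> card V" using loV fV by (metis One_nat_def Suc_leI card_gt_0_iff empty_iff)
  from assms(1) consider "first_scan n k u p" "p - lo + sum k {1..p} + 2 * p + 2 - p \<le> \<Phi>" | "second_scan p k u p L"
    by (auto simp: sched_def)
  then show ?thesis
  proof cases
    case 1
    have le: "y \<le> u" if "y \<in> V" for y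
    proof (rule ccontr)
      assume "\<not> y \<le> u"
      moreover have "y < p" using sup[of y] that lo by (simp add: V_def)
      ultimately have "k y = 0" using 1(1) by (auto simp: first_scan_def)
      then show False using that by (simp add: V_def)
    qed
    \<comment> \<open>The sizes are at least \<open>lo\<close>, hence at least \<open>L + 2\<close>
      and \<open>n + 2\<close>, and the first scan has left them \<open>n + 2\<close> apart.\<close>
    have "int (card V) * (n + 2) \<le> p div 2"
    proof (rule spaced_card_bound[OF fV])
      show "0 \<le> p div 2" using lo by simp
      show "n + 2 \<le> y \<and> y \<le> p div 2" if "y \<in> V" for y
        using sup[of y] that bl assms(3) by (auto simp: V_def)
      show "n + 2 \<le> z - y" if "y \<in> V" "z \<in> V" "y < z" for y z
        using 1(1) that le[of z] unfolding first_scan_def V_def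
        by (cases "z = u") auto
    qed
    then have "2 * (int (card V) * n) + 4 * int (card V) \<le> p" by (simp add: algebra_simps)
    \<comment> \<open>By \<open>R\<close>, twice the number of remaining items is at most
      \<open>p - 4 * card V\<close>. Doubling \<open>bl(3)\<close> then gives
      \<open>4 * L \<ge> p - 2 + 2 * n + 4 * card V\<close>.\<close>
    then have "p + 3 \<le> 4 * L" using R bl n1 cV by linarith
    moreover have "\<forall>y. y < lo + 1 \<and> 0 < k y \<longrightarrow> y = lo" using sup by force
    ultimately show ?thesis using inv' 1(2) lo by (auto simp: sched_def second_scan_def)
  next
    case 2
    \<comment> \<open>A single remaining size means at most \<open>n\<close> items, so
      \<open>bl(3)\<close> yields \<open>p - 1 \<le> 2 * L\<close>, against
      \<open>L + 2 \<le> lo\<close> and \<open>2 * lo \<le> p\<close>.\<close>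
    have "V \<subseteq> {u}"
      using 2 sup lo unfolding second_scan_def V_def by (force)
    then have "card V \<le> 1" by (metis card_mono card.empty card_insert_disjoint empty_iff finite.emptyI finite_insert One_nat_def)
    with cV have "card V = 1" by simp
    then have "sum k {1..p} \<le> n" using R by simp
    then have False using bl lo2 assms(3) by linarith
    then show ?thesis ..
  qed
qed

lemma sched_skip_v:
  assumes "sched p n k lo u v L \<Phi>" "v \<noteq> p" "k v = 0"
  shows "sched p n k lo u (v + 1) L (\<Phi> - 1)"
proof -
  have "sched_inv p n k lo u (v + 1) L" using assms by (auto simp: sched_def sched_inv_def)
  moreover have "first_scan n k u v \<Longrightarrow> first_scan n k u (v + 1)"
    using assms(3) unfolding first_scan_def by (smt (verit))
  moreover have "second_scan p k u v L \<Longrightarrow> second_scan p k u (v + 1) L"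
    using assms(3) unfolding second_scan_def by (smt (verit))
  ultimately show ?thesis using assms(1) unfolding sched_def by (smt (verit))
qed

lemma sched_skip_u:
  assumes "sched p n k lo u v L \<Phi>" "v \<noteq> p" "k u = 0"
  shows "sched p n k lo v (v + 1) L (\<Phi> - 1)"
proof -
  have "sched_inv p n k lo v (v + 1) L" using assms by (auto simp: sched_def sched_inv_def)
  moreover have uv: "u < v" using sched_bounds(5)[OF assms(1)] .
  moreover have "first_scan n k v (v + 1)" if f: "first_scan n k u v"
  proof -
    have le: "y < u" if "y < v" "0 < k y" for y
      using f that assms(3) unfolding first_scan_def by (smt (verit))
    show ?thesis using f uv le unfolding first_scan_def by (smt (verit))
  qed
  moreover have "second_scan p k u v L \<Longrightarrow> second_scan p k v (v + 1) L"
    using assms(3) unfolding second_scan_def by (smt (verit))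
  ultimately show ?thesis using assms(1) unfolding sched_def by (smt (verit))
qed

text \<open>In the first scan \<open>L + 2 \<ge> n + 2\<close> supplies the isolation of
  \<open>u\<close>. The second scan cannot get here: \<open>u\<close> and \<open>v - u\<close> are
  both at least \<open>L + 2\<close>, so \<open>p \<ge> 2 * v \<ge> 4 * L + 8\<close>.\<close>

lemma sched_abandon:
  assumes "sched p n k lo u v L \<Phi>" "v \<noteq> p" "0 < k u" "0 < k v" "L + 2 \<le> lo" "L + 2 \<le> v - u"
  shows "sched p n k lo v (v + 1) L (\<Phi> - 1)"
proof -
  from assms have inv: "sched_inv p n k lo u v L" by (simp add: sched_def)
  note bl = sched_blocked[OF inv assms(5)]
  have "sched_inv p n k lo v (v + 1) L" using assms by (auto simp: sched_def sched_inv_def)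
  moreover have uv: "u < v" using sched_bounds(5)[OF assms(1)] .
  moreover have "first_scan n k v (v + 1)" if f: "first_scan n k u v"
  proof -
    have le: "y \<le> u" if "y < v" "0 < k y" for y
      using f that unfolding first_scan_def by (smt (verit))
    show ?thesis using f uv le bl assms(6) unfolding first_scan_def by (smt (verit))
  qed
  moreover have "\<not> second_scan p k u v L"
  proof
    assume "second_scan p k u v L"
    moreover have "lo \<le> u" "2 * v \<le> p" using inv assms(3,4) by (auto simp: sched_inv_def)
    ultimately show False using assms(5,6) by (auto simp: second_scan_def)
  qed
  ultimately show ?thesis using assms(1) unfolding sched_def by (smt (verit))
qed

text \<open>The weighted reserve is the delicate part: the items lose \<open>u + v\<close> while
  \<open>L\<close> gains only \<open>v - u\<close>. It is re-established from the number of
  remaining items, each of size at least \<open>L + 2\<close>.\<close>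

lemma sched_pair:
  assumes "sched p n k lo u v L \<Phi>" "0 < k u" "0 < k v" "L + 2 \<le> lo" "v - u < L + 2"
  shows "sched p n (k(u := k u - 1, v := k v - 1)) lo u v (L + (v - u)) (\<Phi> - 1)"
proof -
  let ?k = "k(u := k u - 1, v := k v - 1)"
  from assms have inv: "sched_inv p n k lo u v L" by (simp add: sched_def)
  note bl = sched_blocked[OF inv assms(4)]
  have uv: "u < v" using sched_bounds(5)[OF assms(1)] .
  have lo: "1 \<le> lo" "0 \<le> L" "lo \<le> p" "1 \<le> n" "lo \<le> u" "2 * v \<le> p"
    using inv assms(2,3) by (auto simp: sched_inv_def)
  then have m: "u \<in> {1..p}" "v \<in> {1..p}" using uv by auto
  have s: "sum ?k {1..p} = sum k {1..p} - 2"
    using sum_fun_upd[of "{1..p}" u k "k u - 1"]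
      sum_fun_upd[of "{1..p}" v "k(u := k u - 1)" "k v - 1"] m uv by simp
  have k: "0 \<le> ?k y \<and> ?k y \<le> k y" for y
    using inv assms(2,3) by (auto simp: sched_inv_def)
  have a: "\<forall>y. 0 \<le> ?k y \<and> ?k y \<le> n" using k inv unfolding sched_inv_def by (meson order_trans)
  have b: "\<forall>y. 0 < ?k y \<longrightarrow> lo \<le> y \<and> 2 * y \<le> p"
    using k inv unfolding sched_inv_def by (meson order_less_le_trans)
  have k1: "?k 1 = 0" using k[of 1] bl(1) by simp
  have c: "n \<le> L + (v - u) + ?k 1" "p - 1 + n \<le> sum ?k {1..p} + 2 * (L + (v - u)) + ?k 1"
    unfolding s k1 using bl uv by auto
  have "(\<Sum>y\<in>{1..p}. (L + 2) * ?k y) \<le> (\<Sum>y\<in>{1..p}. y * ?k y)"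
  proof (intro sum_mono)
    fix y
    show "(L + 2) * ?k y \<le> y * ?k y"
    proof (cases "0 < ?k y")
      case True
      then have "L + 2 \<le> y" using b assms(4) by fastforce
      then show ?thesis using k[of y] by (intro mult_right_mono) auto
    next
      case False
      then have "?k y = 0" using k[of y] by linarith
      then show ?thesis by simp
    qed
  qed
  then have d1: "(L + 2) * (sum k {1..p} - 2) \<le> (\<Sum>y\<in>{1..p}. y * ?k y)"
    unfolding s[symmetric] by (simp only: sum_distrib_left)
  \<comment> \<open>A lower bound for the number of items left after this pair. It is at least 4
    because \<open>v > u \<ge> L + 2\<close> and \<open>2 * v \<le> p\<close>, whence
    \<open>(L + 2) * z \<ge> 4 * L + 2 * z = 2 * p - 4\<close>.\<close>
  define z where "z = p - 2 - 2 * L"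
  have z4: "4 \<le> z" using assms(4) lo uv by (simp add: z_def)
  have "z \<le> sum k {1..p} - 2" using bl lo by (simp add: z_def)
  then have "(L + 2) * z \<le> (L + 2) * (sum k {1..p} - 2)" using lo by (intro mult_left_mono) auto
  moreover have "L * 4 \<le> L * z" using z4 lo by (intro mult_left_mono) auto
  ultimately have "L * 4 + 2 * z \<le> (\<Sum>y\<in>{1..p}. y * ?k y)" using d1 by (simp add: algebra_simps)
  moreover have "p - 1 \<le> L + (v - u) + (L * 4 + 2 * z)"
    using uv lo unfolding z_def by presburger
  ultimately have d: "p - 1 \<le> L + (v - u) + (\<Sum>y\<in>{1..p}. y * ?k y)"
    by (meson add_left_mono order_trans)
  have "sched_inv p n ?k lo u v (L + (v - u))"
    unfolding sched_inv_def using a b c d inv[unfolded sched_inv_def] by auto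
  then show ?thesis
    using assms(1) first_scan_mono[of n k u v ?k, OF _ k]
      second_scan_mono[of p k u v L ?k "L + (v - u)", OF _ k] uv
    unfolding sched_def s by (smt (verit))
qed

subsection \<open>Sorting and items\<close>

text \<open>A singly linked list with link array \<open>nx\<close> and null pointer 0, so
  zero-initialised arrays are tables of empty lists.\<close>

fun chain :: "(int \<Rightarrow> int) \<Rightarrow> int \<Rightarrow> int list \<Rightarrow> bool" where
  "chain nx h [] \<longleftrightarrow> h = 0"
| "chain nx h (y # ys) \<longleftrightarrow> h = y \<and> y \<noteq> 0 \<and> chain nx (nx y) ys"

lemma chain_fun_upd: "i \<notin> set ys \<Longrightarrow> chain (nx(i := z)) h ys \<longleftrightarrow> chain nx h ys"
  by (induction ys arbitrary: h) auto

text \<open>Decreasing order, because indices are visited in increasing order and pushed at the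
  head.\<close>

definition bucket :: "(int \<Rightarrow> int) \<Rightarrow> int \<Rightarrow> int \<Rightarrow> int list" where
  "bucket f i c = rev (filter (\<lambda>j. f j = c) [1..i - 1])"

lemma set_bucket: "set (bucket f i c) = {j. 1 \<le> j \<and> j < i \<and> f j = c}"
  by (auto simp: bucket_def)

lemma distinct_bucket: "distinct (bucket f i c)"
  by (simp add: bucket_def)

lemma bucket_1 [simp]: "bucket f 1 c = []"
  by (simp add: bucket_def)

lemma bucket_Suc: "1 \<le> i \<Longrightarrow> bucket f (i + 1) c = (if f i = c then i # bucket f i c else bucket f i c)"
  by (simp add: bucket_def upto_rec2)

lemma chain_push:
  assumes "1 \<le> i" "chain nx (hb c) (bucket f i c)"
  shows "chain (nx(i := hb (f i))) ((hb(f i := i)) c) (bucket f (i + 1) c)"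
proof -
  have "i \<notin> set (bucket f i c)" by (simp add: set_bucket)
  with assms show ?thesis by (auto simp: bucket_Suc chain_fun_upd)
qed

text \<open>
  Variables 0 to 3 hold \<open>p\<close>, \<open>2 * p\<close>, 0 and 1. The arrays are: 0 input and output; 1, 2 heads and links
  of the buckets of equal residue; 3 the indices sorted by residue; 4 residues; 5, 6 selected and
  alternative index of each item; 7 gaps; 8 number of items of each folded gap; 9, 10 heads and links
  of the buckets of equal item size; 11, 12, 13 first item, second item and step of each gadget.
  Variable 7 is nonzero if \<open>p\<close> equal residues were found, 10 and 12 hold the scale and its inverse.
\<close>

definition setup_code :: com where
  "setup_code = Const 2 0 ;; Const 3 1 ;; Get 0 0 2 ;; Op Add 1 0 3 ;; Const 4 2 ;; Op Quot 0 1 4"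

definition bucket_code :: com where
  "bucket_code = Const 4 1 ;;
     Until (CEq 4 1) (
       Get 5 0 4 ;; Op Rem 5 5 0 ;; Put 4 4 5 ;;
       Get 6 1 5 ;; Put 2 4 6 ;; Put 1 5 4 ;; Op Add 4 4 3)"

definition sort_code :: com where
  "sort_code = Const 5 1 ;; Const 6 0 ;;
     Until (CEq 6 0) (
       Get 4 1 6 ;;
       Until (CEq 4 2) (Put 3 5 4 ;; Op Add 5 5 3 ;; Get 4 2 4) ;;
       Op Add 6 6 3)"

definition item_code :: com where
  "item_code = Op Sub 16 0 3 ;; Const 4 1 ;; Const 7 0 ;;
     Until (CEq 4 0) (
       Get 5 3 4 ;; Op Add 6 4 16 ;; Get 6 3 6 ;; Put 5 4 5 ;; Put 6 4 6 ;;
       Get 8 4 5 ;; Get 9 4 6 ;; Op Sub 8 9 8 ;;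
       Cond (CEq 8 2) (Copy 7 4) Skip ;;
       Put 7 4 8 ;; Op Sub 9 0 8 ;;
       Cond (CLt 9 8) (Copy 8 9) Skip ;;
       Get 9 8 8 ;; Op Add 9 9 3 ;; Put 8 8 9 ;;
       Op Add 4 4 3)"

definition constant_code :: com where
  "constant_code = Const 4 0 ;;
     Until (CEq 4 0) (
       Op Add 5 7 4 ;; Get 6 3 5 ;; Op Add 5 4 3 ;; Put 0 5 6 ;; Op Add 4 4 3) ;;
     Put 0 2 0"

definition base_vars :: "int \<Rightarrow> vars \<Rightarrow> bool" where
  "base_vars p x \<longleftrightarrow> x 0 = p \<and> x 1 = 2 * p \<and> x 2 = 0 \<and> x 3 = 1"

lemma base_vars_fun_upd [simp]: "3 < r \<Longrightarrow> base_vars p (x(r := y)) \<longleftrightarrow> base_vars p x"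
  by (simp add: base_vars_def)

lemma base_varsD: "base_vars p x \<Longrightarrow> x 0 = p" "base_vars p x \<Longrightarrow> x 1 = 2 * p" "base_vars p x \<Longrightarrow> x (Suc 0) = 2 * p"
   "base_vars p x \<Longrightarrow> x 2 = 0" "base_vars p x \<Longrightarrow> x 3 = 1"
  by (simp_all add: base_vars_def)

text \<open>This is \<open>min d (p - d)\<close>, phrased with the strict comparison that the
  compiled code tests.\<close>

definition fold_residue :: "int \<Rightarrow> int \<Rightarrow> int" where
  "fold_residue p d = (if p - d < d then p - d else d)"

text \<open>\<open>Bd\<close> has to cover products of two residues and an unreduced sum of
  \<open>p\<close> residues, both of order \<open>p * p\<close>, as well as indices and literals,
  which are linear in \<open>p\<close>.\<close>

locale egz =
  fixes p :: int and a :: "int \<Rightarrow> int" and Bd :: int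
  assumes prime: "prime p" and a0: "a 0 = 2 * p - 1"
    and Bd: "4 * p * p \<le> Bd" "64 * p \<le> Bd"
begin

abbreviation WP where "WP \<equiv> wp (2 * p) Bd"

text \<open>The value 0 outside the index range matches the untouched cells of array 4, so that
  \<open>m 4 = r\<close> can be stated as an equality of functions.\<close>

definition r :: "int \<Rightarrow> int" where "r j = (if 1 \<le> j \<and> j < 2 * p then a j mod p else 0)"

lemma p2: "2 \<le> p"
  using prime prime_ge_2_int by blast

lemma small: "- (64 * p) \<le> y \<Longrightarrow> y \<le> 64 * p \<Longrightarrow> \<bar>y\<bar> \<le> Bd"
  using Bd by linarith

lemma r_bounds: "0 \<le> r j" "r j < p"
  using p2 by (auto simp: r_def)

lemma setup_correct:
  assumes "m 0 = a"
  shows "WP setup_code (\<lambda>t' x' m'. t' = t + 9 \<and> base_vars p x' \<and> m' = m) t x m"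
proof -
  have "(2 * p) div 2 = p" by simp
  then show ?thesis
  unfolding setup_code_def using assms a0 p2 Bd(2) by (simp add: base_vars_def)
qed

lemma bucket_correct:
  assumes "base_vars p x" "m 0 = a" "\<And>k. 1 \<le> k \<Longrightarrow> m k = (\<lambda>_. 0)"
  shows "WP bucket_code (\<lambda>t' x' m'. int t' \<le> int t + 50 * p \<and> base_vars p x' \<and>
    (\<forall>c. 0 \<le> c \<and> c < p \<longrightarrow> chain (m' 2) (m' 1 c) (bucket r (2 * p) c)) \<and>
    m' 0 = a \<and> m' 4 = r \<and> (\<forall>k. 5 \<le> k \<longrightarrow> m' k = (\<lambda>_. 0))) t x m"
proof -
  define I where "I = (\<lambda>(t'::nat) (x'::vars) (m'::arrays). base_vars p x' \<and> 1 \<le> x' 4 \<and> x' 4 \<le> 2 * p \<and> m' 0 = a \<and>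
    (\<forall>j. m' 4 j = (if j < x' 4 then r j else 0)) \<and>
    (\<forall>c. 0 \<le> c \<and> c < p \<longrightarrow> chain (m' 2) (m' 1 c) (bucket r (x' 4) c)) \<and>
    (\<forall>k. 5 \<le> k \<longrightarrow> m' k = (\<lambda>_. 0)) \<and> int t' + 48 * p - 24 * x' 4 \<le> int t + 1 + 48 * p)"
  have step: "WP (Get 5 0 4 ;; Op Rem 5 5 0 ;; Put 4 4 5 ;;
       Get 6 1 5 ;; Put 2 4 6 ;; Put 1 5 4 ;; Op Add 4 4 3) I (t' + 2) x' m'"
    if I: "I t' x' m'" and nh: "\<not> holds (CEq 4 1) x'" for t' x' m'
  proof -
    have c: "base_vars p x'" and b: "1 \<le> x' 4" "x' 4 < 2 * p"
      and ch: "\<And>c. 0 \<le> c \<Longrightarrow> c < p \<Longrightarrow> chain (m' 2) (m' 1 c) (bucket r (x' 4) c)"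
      using I nh by (auto simp: I_def base_varsD)
    have r: "a (x' 4) mod p = r (x' 4)" using b by (simp add: r_def)
    have rb: "0 \<le> r (x' 4)" "r (x' 4) < p" "r (x' 4) < 2 * p"
      using r_bounds[of "x' 4"] p2 by auto
    have ch': "chain ((m' 2)(x' 4 := m' 1 (r (x' 4)))) (((m' 1)(r (x' 4) := x' 4)) c) (bucket r (x' 4 + 1) c)"
      if "0 \<le> c" "c < p" for c
      using chain_push[of "x' 4" "m' 2" "m' 1" c r, OF b(1) ch[OF that]] .
    show ?thesis
      using I b rb p2 ch' base_varsD[OF c] Bd(2) unfolding I_def
      by (auto simp: r)
  qed
  show ?thesis
    unfolding bucket_code_def wp_Seq wp_Const
  proof (intro conjI)
    show "\<bar>1\<bar> \<le> Bd" using small[of 1] p2 by simp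
    show "WP (Until (CEq 4 1) (Get 5 0 4 ;; Op Rem 5 5 0 ;; Put 4 4 5 ;;
       Get 6 1 5 ;; Put 2 4 6 ;; Put 1 5 4 ;; Op Add 4 4 3))
      (\<lambda>t' x' m'. int t' \<le> int t + 50 * p \<and> base_vars p x' \<and>
        (\<forall>c. 0 \<le> c \<and> c < p \<longrightarrow> chain (m' 2) (m' 1 c) (bucket r (2 * p) c)) \<and>
        m' 0 = a \<and> m' 4 = r \<and> (\<forall>k. 5 \<le> k \<longrightarrow> m' k = (\<lambda>_. 0))) (t + 1) (x(4 := 1)) m"
    proof (rule wp_Until[where I = I and T = "int t + 1 + 48 * p"])
      show "I (t + 1) (x(4 := 1)) m"
        using assms p2 by (auto simp: I_def r_def)
    next
      fix t' x' m' assume "I t' x' m'" "holds (CEq 4 1) x'"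
      moreover from this have "x' 4 = 2 * p" by (auto simp: I_def base_varsD)
      moreover from calculation have "m' 4 = r" by (intro ext) (simp add: I_def r_def)
      ultimately show "int (t' + 1) \<le> int t + 50 * p \<and> base_vars p x' \<and>
        (\<forall>c. 0 \<le> c \<and> c < p \<longrightarrow> chain (m' 2) (m' 1 c) (bucket r (2 * p) c)) \<and>
        m' 0 = a \<and> m' 4 = r \<and> (\<forall>k. 5 \<le> k \<longrightarrow> m' k = (\<lambda>_. 0))"
        using p2 by (auto simp: I_def base_varsD)
    next
      fix t' x' m' assume "I t' x' m'"
      then show "int t' \<le> int t + 1 + 48 * p" unfolding I_def by linarith
    qed (fact step)
  qed
qed

section \<open>Sorting the indices by residue in linear time\<close>

definition sorted_upto :: "int \<Rightarrow> int list" where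
  "sorted_upto c = concat (map (bucket r (2 * p)) [0..c - 1])"

lemma sorted_upto_Suc: "0 \<le> c \<Longrightarrow> sorted_upto (c + 1) = sorted_upto c @ bucket r (2 * p) c"
  by (simp add: sorted_upto_def upto_rec2)

lemma sorted_upto_aux:
  assumes "0 \<le> c"
  shows "distinct (sorted_upto c) \<and> set (sorted_upto c) = {j. 1 \<le> j \<and> j < 2 * p \<and> r j < c} \<and>
    sorted (map r (sorted_upto c))"
  using assms
proof (induction c rule: int_ge_induct)
  case base
  then show ?case using r_bounds(1) by (auto simp: sorted_upto_def not_less)
next
  case (step c)
  have "sorted (map r (bucket r (2 * p) c))"
  proof -
    have "map r (bucket r (2 * p) c) = map (\<lambda>_. c) (bucket r (2 * p) c)" by (auto simp: set_bucket)
    then show ?thesis by (simp add: map_replicate_const)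
  qed
  moreover have "{j. 1 \<le> j \<and> j < 2 * p \<and> r j < c + 1} =
      {j. 1 \<le> j \<and> j < 2 * p \<and> r j < c} \<union> set (bucket r (2 * p) c)"
    unfolding set_bucket by force
  moreover have "\<forall>y\<in>set (bucket r (2 * p) c). r y = c" by (simp add: set_bucket)
  ultimately show ?case
    using step distinct_bucket[of r "2 * p" c]
    by (simp add: sorted_upto_Suc sorted_append) (fastforce simp: less_imp_le)
qed

lemma sorted_upto:
  assumes "0 \<le> c"
  shows "distinct (sorted_upto c)" "set (sorted_upto c) = {j. 1 \<le> j \<and> j < 2 * p \<and> r j < c}"
    "sorted (map r (sorted_upto c))"
  using sorted_upto_aux[OF assms] by blast+

lemma set_sorted_upto_p: "set (sorted_upto p) = {1..2 * p - 1}"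
proof -
  have "0 \<le> p" using p2 by simp
  from sorted_upto(2)[OF this] show ?thesis using r_bounds(2) by auto
qed

lemma length_sorted_upto:
  assumes "0 \<le> c"
  shows "int (length (sorted_upto c)) \<le> 2 * p - 1" "int (length (sorted_upto p)) = 2 * p - 1"
proof -
  have "length (sorted_upto c) = card (set (sorted_upto c))"
    by (rule distinct_card[symmetric, OF sorted_upto(1)[OF assms]])
  also have "\<dots> \<le> card {1..2 * p - 1}"
    by (rule card_mono) (auto simp: sorted_upto(2)[OF assms])
  finally show "int (length (sorted_upto c)) \<le> 2 * p - 1" using p2 by simp
  have p0: "0 \<le> p" using p2 by simp
  have "length (sorted_upto p) = card (set (sorted_upto p))"
    by (rule distinct_card[symmetric, OF sorted_upto(1)[OF p0]])
  also have "set (sorted_upto p) = {1..2 * p - 1}"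
    by (rule set_sorted_upto_p)
  finally show "int (length (sorted_upto p)) = 2 * p - 1" using p2 by simp
qed

definition stored :: "(int \<Rightarrow> int) \<Rightarrow> int list \<Rightarrow> bool" where
  "stored A ys \<longleftrightarrow> (\<forall>j<length ys. A (1 + int j) = ys ! j)"

lemma stored_snoc: "stored A ys \<Longrightarrow> stored (A(1 + int (length ys) := y)) (ys @ [y])"
  by (auto simp: stored_def nth_append less_Suc_eq)

definition sorts :: "(int \<Rightarrow> int) \<Rightarrow> bool" where
  "sorts os \<longleftrightarrow> bij_betw os {1..2 * p - 1} {1..2 * p - 1} \<and>
     (\<forall>i j. 1 \<le> i \<and> i \<le> j \<and> j < 2 * p \<longrightarrow> r (os i) \<le> r (os j))"

text \<open>Distinct entries make the map injective; surjectivity follows because it maps a finite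
  set into itself.\<close>

lemma stored_sorts:
  assumes "stored A (sorted_upto p)"
  shows "sorts A"
proof -
  let ?ys = "sorted_upto p"
  have p0: "0 \<le> p" using p2 by simp
  note ys = sorted_upto(1)[OF p0] length_sorted_upto(2)[OF p0]
  have A: "A i = ?ys ! nat (i - 1)" "nat (i - 1) < length ?ys" if "1 \<le> i" "i < 2 * p" for i
  proof -
    show "nat (i - 1) < length ?ys" using that ys(2) by linarith
    then show "A i = ?ys ! nat (i - 1)"
      using assms that unfolding stored_def by (metis add.commute diff_add_cancel diff_ge_0_iff_ge int_nat_eq)
  qed
  have inj: "inj_on A {1..2 * p - 1}"
  proof (rule inj_onI)
    fix i j assume ij: "i \<in> {1..2 * p - 1}" "j \<in> {1..2 * p - 1}" "A i = A j"
    then have "nat (i - 1) = nat (j - 1)"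
      using A[of i] A[of j] ys(1) nth_eq_iff_index_eq by auto
    with ij show "i = j" by auto
  qed
  have "A ` {1..2 * p - 1} \<subseteq> {1..2 * p - 1}"
  proof
    fix y assume "y \<in> A ` {1..2 * p - 1}"
    then obtain i where "1 \<le> i" "i < 2 * p" "y = A i" by auto
    then show "y \<in> {1..2 * p - 1}" using A[of i] nth_mem[of "nat (i - 1)" ?ys] set_sorted_upto_p by auto
  qed
  then have "bij_betw A {1..2 * p - 1} {1..2 * p - 1}"
    using inj endo_inj_surj[of "{1..2 * p - 1}" A] by (auto simp: bij_betw_def)
  moreover have "r (A i) \<le> r (A j)" if "1 \<le> i" "i \<le> j" "j < 2 * p" for i j
    using A[of i] A[of j] that sorted_upto(3)[OF p0] sorted_nth_mono[of "map r ?ys" "nat (i - 1)" "nat (j - 1)"] by auto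
  ultimately show ?thesis by (simp add: sorts_def)
qed

lemma sort_correct:
  assumes "base_vars p x"
    and ch: "\<And>c. 0 \<le> c \<Longrightarrow> c < p \<Longrightarrow> chain (m 2) (m 1 c) (bucket r (2 * p) c)"
  shows "WP sort_code (\<lambda>t' x' m'. int t' \<le> int t + 40 * p \<and> base_vars p x' \<and> sorts (m' 3) \<and>
    (\<forall>k. k \<noteq> 3 \<longrightarrow> m' k = m k)) t x m" (is "WP _ ?Q _ _ _")
proof -
  \<comment> \<open>The clock is amortised over both loops: a round of the outer loop costs 8 and
    each moved index costs 11. Only \<open>2 * p - 1\<close> indices are moved in total, however
    they are distributed over the buckets.\<close>
  define I where "I = (\<lambda>(t'::nat) (x'::vars) (m'::arrays). base_vars p x' \<and> 0 \<le> x' 6 \<and> x' 6 \<le> p \<and>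
    x' 5 = 1 + int (length (sorted_upto (x' 6))) \<and> stored (m' 3) (sorted_upto (x' 6)) \<and>
    (\<forall>k. k \<noteq> 3 \<longrightarrow> m' k = m k) \<and>
    int t' + 8 * p - 8 * x' 6 + 22 * p - 11 - 11 * int (length (sorted_upto (x' 6))) \<le> int t + 2 + 30 * p)"
  have step: "WP (Get 4 1 6 ;; Until (CEq 4 2) (Put 3 5 4 ;; Op Add 5 5 3 ;; Get 4 2 4) ;; Op Add 6 6 3)
      I (t' + 2) x' m'" if I: "I t' x' m'" and nh: "\<not> holds (CEq 6 0) x'" for t' x' m'
  proof -
    define c where "c = x' 6"
    have b: "base_vars p x'" and c: "0 \<le> c" "c < p" using I nh by (auto simp: I_def base_varsD c_def)
    have c1: "0 \<le> c + 1" using c by simp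
    \<comment> \<open>\<open>ds\<close> is the part of the bucket already written out, and
      \<open>ts\<close> is the rest, still linked from variable 4.\<close>
    define J where "J = (\<lambda>(s::nat) (y::vars) (M::arrays). \<exists>ds ts. base_vars p y \<and> y 6 = c \<and>
      ds @ ts = bucket r (2 * p) c \<and> chain (m 2) (y 4) ts \<and>
      y 5 = 1 + int (length (sorted_upto c @ ds)) \<and> stored (M 3) (sorted_upto c @ ds) \<and>
      (\<forall>k. k \<noteq> 3 \<longrightarrow> M k = m k) \<and>
      int s + 8 * p - 8 * c + 22 * p - 11 - 11 * int (length (sorted_upto c @ ds)) \<le> int t + 8 + 30 * p)"
    have init: "J (t' + 2 + 4) (x'(4 := m' 1 (x' 6))) m'"
      unfolding J_def using I c ch[OF c] by (intro exI[of _ "[]"] exI[of _ "bucket r (2 * p) c"]) (auto simp: I_def c_def)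
    have step: "WP (Put 3 5 4 ;; Op Add 5 5 3 ;; Get 4 2 4) J (s + 2) y M"
      if Js: "J s y M" and nh: "\<not> holds (CEq 4 2) y" for s y M
    proof -
      from Js obtain ds ts where J: "base_vars p y" "y 6 = c" "ds @ ts = bucket r (2 * p) c"
        "chain (m 2) (y 4) ts" "y 5 = 1 + int (length (sorted_upto c @ ds))"
        "stored (M 3) (sorted_upto c @ ds)" "\<forall>k. k \<noteq> 3 \<longrightarrow> M k = m k"
        "int s + 8 * p - 8 * c + 22 * p - 11 - 11 * int (length (sorted_upto c @ ds)) \<le> int t + 8 + 30 * p"
        unfolding J_def by blast
      from nh J(1) have "y 4 \<noteq> 0" by (simp add: base_varsD)
      then obtain ts' where ts: "ts = y 4 # ts'" "chain (m 2) (m 2 (y 4)) ts'"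
        using J(4) by (cases ts) auto
      have "y 4 \<in> set (bucket r (2 * p) c)" unfolding J(3)[symmetric] ts(1) by simp
      then have y4: "1 \<le> y 4" "y 4 < 2 * p" by (auto simp: set_bucket)
      have "sorted_upto (c + 1) = (sorted_upto c @ ds) @ ts"
        using sorted_upto_Suc[OF c(1)] J(3) by simp
      then have len: "int (length (sorted_upto c @ ds)) + 1 \<le> 2 * p - 1"
        using length_sorted_upto(1)[OF c1] ts by simp
      have y5: "0 \<le> y 5" "y 5 < 2 * p" using len J(5) by auto
      have st: "stored ((M 3)(y 5 := y 4)) (sorted_upto c @ (ds @ [y 4]))"
        using stored_snoc[OF J(6)] J(5) by simp
      have "J (s + 2 + 4 + 1 + 4) (y(5 := y 5 + 1, 4 := m 2 (y 4))) (M(3 := (M 3)(y 5 := y 4)))"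
        unfolding J_def using J ts st
        by (intro exI[of _ "ds @ [y 4]"] exI[of _ ts']) auto
      then show ?thesis using y4 y5 J(1,7) Bd(2) p2 len by (auto simp: base_varsD)
    qed
    have exit: "WP (Op Add 6 6 3) I (s + 1) y M" if Js: "J s y M" and h: "holds (CEq 4 2) y" for s y M
    proof -
      from Js obtain ds ts where J: "base_vars p y" "y 6 = c" "ds @ ts = bucket r (2 * p) c"
        "chain (m 2) (y 4) ts" "y 5 = 1 + int (length (sorted_upto c @ ds))"
        "stored (M 3) (sorted_upto c @ ds)" "\<forall>k. k \<noteq> 3 \<longrightarrow> M k = m k"
        "int s + 8 * p - 8 * c + 22 * p - 11 - 11 * int (length (sorted_upto c @ ds)) \<le> int t + 8 + 30 * p"
        unfolding J_def by blast
      from h J(1) have "y 4 = 0" by (simp add: base_varsD)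
      with J(4) have "ts = []" by (cases ts) auto
      with J(3) have "sorted_upto (c + 1) = sorted_upto c @ ds"
        using sorted_upto_Suc[OF c(1)] by simp
      then show ?thesis using J c Bd(2) by (auto simp: I_def base_varsD)
    qed
    have bound: "int s \<le> int t + (8 + 30 * p)" if "J s y M" for s y M
    proof -
      from that obtain ds ts where J: "ds @ ts = bucket r (2 * p) c"
        "int s + 8 * p - 8 * c + 22 * p - 11 - 11 * int (length (sorted_upto c @ ds)) \<le> int t + 8 + 30 * p"
        unfolding J_def by blast
      have "sorted_upto (c + 1) = (sorted_upto c @ ds) @ ts"
        using sorted_upto_Suc[OF c(1)] J by simp
      then have "int (length (sorted_upto c @ ds)) \<le> 2 * p - 1"
        using length_sorted_upto(1)[OF c1] by simp
      then show ?thesis using J(2) c by linarith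
    qed
    show ?thesis
      unfolding wp_Seq wp_Get
      by ((fact init step exit bound | rule conjI wp_Until[where I = J and T = "int t + (8 + 30 * p)"] |
        use c p2 in \<open>simp add: c_def; fail\<close>)+)
  qed
  have init: "I (t + 1 + 1) (x(5 := 1, 6 := 0)) m"
    using assms p2 by (auto simp: I_def sorted_upto_def stored_def)
  have exit: "?Q (t' + 1) x' m'" if I: "I t' x' m'" and h: "holds (CEq 6 0) x'" for t' x' m'
  proof -
    have "x' 6 = p" using I h by (auto simp: I_def base_varsD)
    then show ?thesis using I stored_sorts length_sorted_upto(2)[of 0] p2 by (auto simp: I_def)
  qed
  have bound: "int t' \<le> int t + (2 + 30 * p)" if I: "I t' x' m'" for t' x' m'
  proof -
    have "0 \<le> x' 6" using I by (simp add: I_def)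
    from length_sorted_upto(1)[OF this] show ?thesis using I unfolding I_def by linarith
  qed
  show ?thesis
    unfolding sort_code_def wp_Seq wp_Const
    by ((fact init step exit bound | rule conjI wp_Until[where I = I and T = "int t + (2 + 30 * p)"] |
        use p2 Bd(2) in \<open>simp; fail\<close>)+)
qed

section \<open>The items and the case of \<open>p\<close> equal residues\<close>

definition gap :: "(int \<Rightarrow> int) \<Rightarrow> int \<Rightarrow> int" where
  "gap os j = r (os (j + p - 1)) - r (os j)"

definition good :: "(int \<Rightarrow> int) \<Rightarrow> bool" where
  "good A \<longleftrightarrow> A 0 = p \<and> inj_on A {1..p} \<and> A ` {1..p} \<subseteq> {1..2 * p - 1} \<and> p dvd (\<Sum>j\<in>{1..p}. a (A j))"

lemma sorts_bounds: "sorts os \<Longrightarrow> 1 \<le> j \<Longrightarrow> j < 2 * p \<Longrightarrow> 1 \<le> os j \<and> os j < 2 * p"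
  unfolding sorts_def bij_betw_def by force

lemma sorts_inj: "sorts os \<Longrightarrow> inj_on os {1..2 * p - 1}"
  by (simp add: sorts_def bij_betw_def)

lemma gap_bounds:
  assumes "sorts os" "1 \<le> j" "j < p"
  shows "0 \<le> gap os j" "gap os j < p"
proof -
  have "r (os j) \<le> r (os (j + p - 1))" using assms by (auto simp: sorts_def)
  then show "0 \<le> gap os j" "gap os j < p"
    using r_bounds[of "os j"] r_bounds[of "os (j + p - 1)"] by (auto simp: gap_def)
qed

lemma item_correct:
  assumes b: "base_vars p x" and so: "sorts (m 3)" and r: "m 4 = r"
    and z: "\<And>k. k \<in> {5..8} \<Longrightarrow> m k = (\<lambda>_. 0)"
  shows "WP item_code (\<lambda>t' x' m'. int t' \<le> int t + 50 * p \<and> base_vars p x' \<and> x' 16 = p - 1 \<and>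
    (x' 7 = 0 \<and> (\<forall>j. 1 \<le> j \<and> j < p \<longrightarrow> gap (m 3) j \<noteq> 0) \<or>
     1 \<le> x' 7 \<and> x' 7 < p \<and> gap (m 3) (x' 7) = 0) \<and>
    (\<forall>j. m' 5 j = (if 1 \<le> j \<and> j < p then m 3 j else 0)) \<and>
    (\<forall>j. m' 6 j = (if 1 \<le> j \<and> j < p then m 3 (j + p - 1) else 0)) \<and>
    (\<forall>j. 1 \<le> j \<and> j < p \<longrightarrow> m' 7 j = gap (m 3) j) \<and>
    (\<forall>e. m' 8 e = int (length (bucket (\<lambda>j. fold_residue p (gap (m 3) j)) p e))) \<and>
    (\<forall>k. k \<notin> {5..8} \<longrightarrow> m' k = m k)) t x m" (is "WP _ ?Q _ _ _")
proof -
  define os where "os = m 3"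
  define I where "I = (\<lambda>(t'::nat) (x'::vars) (m'::arrays). base_vars p x' \<and> x' 16 = p - 1 \<and>
    1 \<le> x' 4 \<and> x' 4 \<le> p \<and>
    (x' 7 = 0 \<and> (\<forall>j. 1 \<le> j \<and> j < x' 4 \<longrightarrow> gap os j \<noteq> 0) \<or>
     1 \<le> x' 7 \<and> x' 7 < p \<and> gap os (x' 7) = 0) \<and>
    (\<forall>j. m' 5 j = (if 1 \<le> j \<and> j < x' 4 then os j else 0)) \<and>
    (\<forall>j. m' 6 j = (if 1 \<le> j \<and> j < x' 4 then os (j + p - 1) else 0)) \<and>
    (\<forall>j. 1 \<le> j \<and> j < x' 4 \<longrightarrow> m' 7 j = gap os j) \<and>
    (\<forall>e. m' 8 e = int (length (bucket (\<lambda>j. fold_residue p (gap os j)) (x' 4) e))) \<and>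
    (\<forall>k. k \<notin> {5..8} \<longrightarrow> m' k = m k) \<and> int t' + 47 * p - 47 * x' 4 \<le> int t + 47 * p)"
  have init: "I (t + 1 + 1 + 1) (x(16 := eval_binop Sub (x 0) (x 3), 4 := 1, 7 := 0)) m"
    using b p2 z by (auto simp: I_def base_varsD)
  have step: "WP (Get 5 3 4 ;; Op Add 6 4 16 ;; Get 6 3 6 ;; Put 5 4 5 ;; Put 6 4 6 ;;
       Get 8 4 5 ;; Get 9 4 6 ;; Op Sub 8 9 8 ;;
       Cond (CEq 8 2) (Copy 7 4) Skip ;;
       Put 7 4 8 ;; Op Sub 9 0 8 ;;
       Cond (CLt 9 8) (Copy 8 9) Skip ;;
       Get 9 8 8 ;; Op Add 9 9 3 ;; Put 8 8 9 ;;
       Op Add 4 4 3) I (t' + 2) x' m'" if I: "I t' x' m'" and nh: "\<not> holds (CEq 4 0) x'" for t' x' m'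
  proof -
    define i where "i = x' 4"
    have bx: "base_vars p x'" and i: "1 \<le> i" "i < p" and x16: "x' 16 = p - 1" and x4: "x' 4 = i"
      using I nh by (auto simp: I_def base_varsD i_def)
    have m: "m' 3 = os" "m' 4 = r" using I r by (auto simp: I_def os_def)
    have o: "1 \<le> os i" "os i < 2 * p" "1 \<le> os (i + (p - 1))" "os (i + (p - 1)) < 2 * p"
      using sorts_bounds[of os i] sorts_bounds[of os "i + (p - 1)"] so i p2 by (auto simp: os_def)
    have ipp: "i + p - 1 = i + (p - 1)" by simp
    have g: "gap os i = r (os (i + (p - 1))) - r (os i)" by (simp add: gap_def ipp)
    have gb: "0 \<le> gap os i" "gap os i < p" using gap_bounds so i by (auto simp: os_def)
    \<comment> \<open>A bound for the counter in array 8, so that its increment stays within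
      \<open>Bd\<close>.\<close>
    have "length (bucket (\<lambda>j. fold_residue p (gap os j)) i (fold_residue p (gap os i))) \<le> nat p"
    proof -
      have "bucket (\<lambda>j. fold_residue p (gap os j)) i (fold_residue p (gap os i)) =
        rev (filter (\<lambda>j. fold_residue p (gap os j) = fold_residue p (gap os i)) [1..i - 1])"
        by (simp add: bucket_def)
      moreover have "length (filter P [1..i - 1]) \<le> nat p" for P
        using i by (intro order_trans[OF length_filter_le]) auto
      ultimately show ?thesis by simp
    qed
    then have lb: "int (length (bucket (\<lambda>j. fold_residue p (gap os j)) i (fold_residue p (gap os i)))) \<le> p"
      using p2 by linarith
    define e where "e = fold_residue p (gap os i)"
    have e: "0 \<le> e" "e < 2 * p" using gb by (auto simp: e_def fold_residue_def)
    have m8: "m' 8 e = int (length (bucket (\<lambda>j. fold_residue p (gap os j)) i e))"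
      using I by (simp add: I_def x4)
    have mb: "0 \<le> m' 8 e" "m' 8 e \<le> p" using lb m8 by (auto simp: e_def)
    \<comment> \<open>Packages the effect of one round, so that the branches of the symbolic
      execution only need to match it; 47 is the cost of a round including the loop test.\<close>
    have nxt: "I s y M" if "base_vars p y" "y 16 = p - 1" "y 4 = i + 1"
      "y 7 = (if gap os i = 0 then i else x' 7)" "M 5 = (m' 5)(i := os i)" "M 6 = (m' 6)(i := os (i + (p - 1)))"
      "M 7 = (m' 7)(i := gap os i)" "M 8 = (m' 8)(e := m' 8 e + 1)" "\<forall>k. k \<notin> {5..8} \<longrightarrow> M k = m' k"
      "s \<le> t' + 47" for s y M
    proof -
      have "M 8 c = int (length (bucket (\<lambda>j. fold_residue p (gap os j)) (i + 1) c))" for c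
        using I i(1) that(8) by (auto simp: I_def x4 bucket_Suc e_def)
      moreover have "y 7 = 0 \<and> (\<forall>j. 1 \<le> j \<and> j < i + 1 \<longrightarrow> gap os j \<noteq> 0) \<or>
         1 \<le> y 7 \<and> y 7 < p \<and> gap os (y 7) = 0"
      proof -
        have "x' 7 = 0 \<and> (\<forall>j. 1 \<le> j \<and> j < i \<longrightarrow> gap os j \<noteq> 0) \<or>
          1 \<le> x' 7 \<and> x' 7 < p \<and> gap os (x' 7) = 0" using I by (simp add: I_def x4)
        moreover have "j = i \<or> j < i" if "j < i + 1" for j using that by auto
        ultimately show ?thesis using i that(4) by (auto split: if_splits)
      qed
      ultimately show ?thesis
        using I i that(1-3,5-7,9-10) unfolding I_def x4 that(3) by (auto simp: ipp)
    qed
    show ?thesis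
    proof (cases "p - gap os i < gap os i")
      case True
      then have gn: "gap os i \<noteq> 0" and "p - gap os i = e" using p2 by (auto simp: e_def fold_residue_def)
      then show ?thesis
        using i o gb p2 Bd(2) e mb True bx
        by (simp add: x16 x4 m g[symmetric] base_varsD[OF bx]) (intro nxt; simp add: x16 gn)
    next
      case False
      then have "e = gap os i" by (auto simp: e_def fold_residue_def)
      then show ?thesis
        using i o gb p2 Bd(2) e mb False bx
        by (cases "gap os i = 0"; simp add: x16 x4 m g[symmetric] base_varsD[OF bx]; (intro conjI nxt; simp add: x16)?)
    qed
  qed
  have exit: "?Q (t' + 1) x' m'" if "I t' x' m'" "holds (CEq 4 0) x'" for t' x' m'
  proof -
    have "x' 4 = p" using that by (auto simp: I_def base_varsD)
    then show ?thesis using that p2 by (simp add: I_def os_def)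
  qed
  have bound: "int t' \<le> int t + 47 * p" if "I t' x' m'" for t' x' m'
    using that unfolding I_def by linarith
  show ?thesis
    unfolding item_code_def wp_Seq wp_Const wp_Op
    by ((fact init step[unfolded wp_Seq wp_Op] step exit bound | rule conjI wp_Until[where I = I and T = "int t + 47 * p"] |
        use b p2 Bd(2) in \<open>simp add: base_varsD; fail\<close>)+)
qed

text \<open>Sortedness squeezes the residues at positions \<open>f\<close> to
  \<open>f + p - 1\<close> between two equal values, so the sum is \<open>p\<close> times one
  residue.\<close>

lemma good_constant:
  assumes so: "sorts os" and f: "1 \<le> f" "f < p" and g: "gap os f = 0"
    and A: "A 0 = p" "\<And>j. 1 \<le> j \<Longrightarrow> j \<le> p \<Longrightarrow> A j = os (f + j - 1)"
  shows "good A"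
proof -
  have "inj_on A {1..p}"
  proof (rule inj_onI)
    fix i j assume ij: "i \<in> {1..p}" "j \<in> {1..p}" "A i = A j"
    then have "os (f + i - 1) = os (f + j - 1)" using A by auto
    then have "f + i - 1 = f + j - 1"
      using inj_onD[OF sorts_inj[OF so]] ij f by auto
    then show "i = j" by simp
  qed
  moreover have "A ` {1..p} \<subseteq> {1..2 * p - 1}"
  proof
    fix y assume "y \<in> A ` {1..p}"
    then obtain j where "1 \<le> j" "j \<le> p" "y = A j" by auto
    then show "y \<in> {1..2 * p - 1}"
      using sorts_bounds[OF so, of "f + j - 1"] A(2) f by auto
  qed
  moreover have "a (A j) mod p = r (os f)" if "j \<in> {1..p}" for j
  proof -
    have j: "1 \<le> j" "j \<le> p" using that by auto
    have "r (os f) \<le> r (os (f + j - 1))" "r (os (f + j - 1)) \<le> r (os (f + p - 1))"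
      using so j f by (auto simp: sorts_def)
    moreover have "a (os (f + j - 1)) mod p = r (os (f + j - 1))"
      using sorts_bounds[OF so, of "f + j - 1"] j f by (auto simp: r_def)
    ultimately show ?thesis using g A(2)[OF j] by (simp add: gap_def)
  qed
  then have "(\<Sum>j\<in>{1..p}. a (A j)) mod p = (\<Sum>j\<in>{1..p}. r (os f)) mod p"
    by (subst mod_sum_eq[symmetric]) simp
  then have "p dvd (\<Sum>j\<in>{1..p}. a (A j))" using p2 by (simp add: mod_eq_0_iff_dvd)
  ultimately show ?thesis using A(1) by (simp add: good_def)
qed

lemma constant_correct:
  assumes b: "base_vars p x" and so: "sorts (m 3)" and f: "1 \<le> x 7" "x 7 < p" and g: "gap (m 3) (x 7) = 0"
  shows "WP constant_code (\<lambda>t' x' m'. int t' \<le> int t + 20 * p \<and> good (m' 0)) t x m" (is "WP _ ?Q _ _ _")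
proof -
  define I where "I = (\<lambda>(t'::nat) (x'::vars) (m'::arrays). base_vars p x' \<and> x' 7 = x 7 \<and> 0 \<le> x' 4 \<and> x' 4 \<le> p \<and>
    (\<forall>j. 1 \<le> j \<and> j \<le> x' 4 \<longrightarrow> m' 0 j = m 3 (x 7 + j - 1)) \<and> m' 3 = m 3 \<and>
    int t' + 13 * p - 13 * x' 4 \<le> int t + 1 + 13 * p)"
  have init: "I (t + 1) (x(4 := 0)) m"
    using b p2 by (auto simp: I_def)
  have step: "WP (Op Add 5 7 4 ;; Get 6 3 5 ;; Op Add 5 4 3 ;; Put 0 5 6 ;; Op Add 4 4 3) I (t' + 2) x' m'"
    if I: "I t' x' m'" and nh: "\<not> holds (CEq 4 0) x'" for t' x' m'
  proof -
    have bx: "base_vars p x'" and i: "0 \<le> x' 4" "x' 4 < p"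
      using I nh by (auto simp: I_def base_varsD)
    show ?thesis
      using I i f p2 base_varsD[OF bx] Bd(2) unfolding I_def by (auto simp: algebra_simps)
  qed
  have exit: "WP (Put 0 2 0) ?Q (t' + 1) x' m'" if I: "I t' x' m'" and h: "holds (CEq 4 0) x'" for t' x' m'
  proof -
    have "x' 4 = p" and bx: "base_vars p x'" using I h by (auto simp: I_def base_varsD)
    then have "good ((m' 0)(0 := p))"
      using I by (intro good_constant[OF so f g]) (auto simp: I_def)
    then show ?thesis using I p2 base_varsD[OF bx] \<open>x' 4 = p\<close> by (simp add: I_def)
  qed
  have bound: "int t' \<le> int t + 1 + 13 * p" if "I t' x' m'" for t' x' m'
    using that unfolding I_def by linarith
  show ?thesis
    unfolding constant_code_def wp_Seq wp_Const
    by ((fact init step[unfolded wp_Seq] step exit bound | rule conjI wp_Until[where I = I and T = "int t + 1 + 13 * p"] |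
        use b p2 Bd(2) in \<open>simp add: base_varsD; fail\<close>)+)
qed

end

subsection \<open>Scaling the items\<close>

definition argmax_code :: com where
  "argmax_code = Const 4 1 ;; Copy 10 3 ;; Get 11 8 10 ;;
     Until (CEq 4 0) (
       Get 5 8 4 ;; Cond (CLt 11 5) (Copy 10 4 ;; Copy 11 5) Skip ;; Op Add 4 4 3) ;;
     Op Inv 12 10 0"

definition flip_code :: "nat \<Rightarrow> com" where [simp]:
  "flip_code q = Get 13 5 q ;; Get 14 6 q ;; Put 5 q 14 ;; Put 6 q 13"

definition scale_code :: com where
  "scale_code = Const 4 1 ;;
     Until (CEq 4 0) (
       Get 5 7 4 ;; Op Mul 5 5 12 ;; Op Rem 5 5 0 ;; Op Sub 6 0 5 ;;
       Cond (CLt 6 5) (Copy 5 6 ;; flip_code 4) Skip ;;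
       Get 6 9 5 ;; Put 10 4 6 ;; Put 9 5 4 ;; Op Add 4 4 3)"

lemma fold_residue_bounds:
  assumes "0 \<le> d" "d < p"
  shows "0 \<le> fold_residue p d" "2 * fold_residue p d \<le> p" "d \<noteq> 0 \<Longrightarrow> 1 \<le> fold_residue p d"
  using assms by (auto simp: fold_residue_def)

lemma fold_residue_eq_iff:
  assumes "0 \<le> d" "d < p" "0 \<le> e" "e < p"
  shows "fold_residue p d = fold_residue p e \<longleftrightarrow> d = e \<or> d + e = p"
  using assms by (auto simp: fold_residue_def)

text \<open>Folding identifies a residue exactly with its negative, so folded values stand for
  residues up to sign. This turns questions about sizes into divisibility.\<close>

lemma fold_residue_mod_eq_iff:
  fixes p :: int
  assumes "0 < p"
  shows "fold_residue p (y mod p) = fold_residue p (z mod p) \<longleftrightarrow> p dvd y - z \<or> p dvd y + z"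
proof -
  have 1: "p dvd y - z \<longleftrightarrow> y mod p = z mod p" by (simp add: mod_eq_dvd_iff)
  have "p dvd y + z \<longleftrightarrow> p dvd y mod p + z mod p"
    by (metis dvd_eq_mod_eq_0 mod_add_eq)
  also have "\<dots> \<longleftrightarrow> y mod p + z mod p = 0 \<or> y mod p + z mod p = p"
  proof
    assume "p dvd y mod p + z mod p"
    then obtain k where k: "y mod p + z mod p = p * k" by auto
    have "0 \<le> y mod p" "y mod p < p" "0 \<le> z mod p" "z mod p < p" using assms by auto
    then have "0 \<le> p * k" "p * k < p * 2" using k by linarith+
    then have "0 \<le> k" "k < 2" using assms by (auto simp: zero_le_mult_iff)
    then have "k = 0 \<or> k = 1" by auto
    then show "y mod p + z mod p = 0 \<or> y mod p + z mod p = p" using k by auto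
  qed auto
  finally have 2: "p dvd y + z \<longleftrightarrow> y mod p + z mod p = 0 \<or> y mod p + z mod p = p" .
  have b: "0 \<le> y mod p" "y mod p < p" "0 \<le> z mod p" "z mod p < p" using assms by auto
  show ?thesis unfolding 1 2 fold_residue_eq_iff[OF b] using b by (smt (verit))
qed

lemma bucket_cong:
  "(\<And>j. 1 \<le> j \<Longrightarrow> j < i \<Longrightarrow> f j = c \<longleftrightarrow> f' j = c') \<Longrightarrow> bucket f i c = bucket f' i c'"
  unfolding bucket_def by (intro arg_cong[where f = rev] filter_cong) auto

lemma sum_length_bucket:
  assumes "1 \<le> i" "\<And>j. 1 \<le> j \<Longrightarrow> j < i \<Longrightarrow> f j \<in> C" "finite C"
  shows "(\<Sum>c\<in>C. int (length (bucket f i c))) = i - 1"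
proof -
  have "int (length (bucket f i c)) = (\<Sum>j\<in>{j \<in> {1..i - 1}. f j = c}. 1)" for c
  proof -
    have "length (bucket f i c) = card (set (bucket f i c))"
      by (simp add: distinct_card distinct_bucket)
    also have "set (bucket f i c) = {j \<in> {1..i - 1}. f j = c}" by (auto simp: set_bucket)
    finally show ?thesis by simp
  qed
  then have "(\<Sum>c\<in>C. int (length (bucket f i c))) = (\<Sum>c\<in>C. \<Sum>j\<in>{j \<in> {1..i - 1}. f j = c}. 1)"
    by simp
  also have "\<dots> = (\<Sum>j\<in>{1..i - 1}. 1)"
    by (rule sum.group) (use assms in auto)
  finally show ?thesis using assms(1) by simp
qed

context egz
begin

lemma argmax_correct:
  assumes b: "base_vars p x"
  shows "WP argmax_code (\<lambda>t' x' m'. int t' \<le> int t + 20 * p \<and> base_vars p x' \<and> x' 16 = x 16 \<and> x' 7 = x 7 \<and>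
    1 \<le> x' 10 \<and> x' 10 < p \<and> (\<forall>e. 1 \<le> e \<and> e < p \<longrightarrow> m 8 e \<le> m 8 (x' 10)) \<and>
    0 \<le> x' 12 \<and> x' 12 < p \<and> [x' 10 * x' 12 = 1] (mod p) \<and> m' = m) t x m" (is "WP _ ?Q _ _ _")
proof -
  define I where "I = (\<lambda>(t'::nat) (x'::vars) (m'::arrays). base_vars p x' \<and> x' 16 = x 16 \<and> x' 7 = x 7 \<and>
    1 \<le> x' 4 \<and> x' 4 \<le> p \<and>
    1 \<le> x' 10 \<and> x' 10 < p \<and> x' 11 = m 8 (x' 10) \<and> (\<forall>e. 1 \<le> e \<and> e < x' 4 \<longrightarrow> m 8 e \<le> m 8 (x' 10)) \<and>
    m' = m \<and> int t' + 10 * p - 10 * x' 4 \<le> int t + 6 + 10 * p)"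
  have init: "I (t + 1 + 1 + 4) (x(4 := 1, 10 := (x(4 := 1)) 3, 11 := m 8 ((x(4 := 1, 10 := (x(4 := 1)) 3)) 10))) m"
    using b p2 by (auto simp: I_def base_varsD)
  have step: "WP (Get 5 8 4 ;; Cond (CLt 11 5) (Copy 10 4 ;; Copy 11 5) Skip ;; Op Add 4 4 3) I (t' + 2) x' m'"
    if I: "I t' x' m'" and nh: "\<not> holds (CEq 4 0) x'" for t' x' m'
  proof -
    have bx: "base_vars p x'" and i: "1 \<le> x' 4" "x' 4 < p"
      using I nh by (auto simp: I_def base_varsD)
    have le: "e = x' 4 \<or> e < x' 4" if "e \<le> x' 4" for e using that by auto
    show ?thesis
      using I i p2 base_varsD[OF bx] Bd(2) unfolding I_def
      by simp (smt (verit) le)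
  qed
  have exit: "WP (Op Inv 12 10 0) ?Q (t' + 1) x' m'" if I: "I t' x' m'" and h: "holds (CEq 4 0) x'" for t' x' m'
  proof -
    have x4: "x' 4 = p" and bx: "base_vars p x'" using I h by (auto simp: I_def base_varsD)
    have p0: "0 < p" using p2 by simp
    have x10: "1 \<le> x' 10" "x' 10 < p" using I by (auto simp: I_def)
    have "coprime (x' 10) p"
      using prime_imp_coprime[OF prime, of "x' 10"] x10 zdvd_not_zless by (auto simp: coprime_commute)
    from cong_modular_inverse1[OF this] show ?thesis
      using I x4 base_varsD[OF bx] bx Bd(2) modular_inverse_int_nonneg[OF p0, of "x' 10"]
        modular_inverse_int_less[OF p0, of "x' 10"] unfolding I_def by simp
  qed
  have bound: "int t' \<le> int t + 6 + 10 * p" if "I t' x' m'" for t' x' m'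
    using that unfolding I_def by linarith
  show ?thesis
    unfolding argmax_code_def wp_Seq wp_Const wp_Copy wp_Get
    by ((fact init step[unfolded wp_Seq wp_Get] step exit bound | rule conjI wp_Until[where I = I and T = "int t + 6 + 10 * p"] |
        use b p2 Bd(2) in \<open>simp add: base_varsD; fail\<close>)+)
qed

definition item_size :: "(int \<Rightarrow> int) \<Rightarrow> int \<Rightarrow> int \<Rightarrow> int" where
  "item_size os h j = fold_residue p ((gap os j * h) mod p)"

text \<open>The zeros outside the real items make item 0 a dummy whose flip has no effect, so the
  code can treat a single item as a pair with item 0.\<close>

definition paired :: "(int \<Rightarrow> int) \<Rightarrow> (int \<Rightarrow> int) \<Rightarrow> (int \<Rightarrow> int) \<Rightarrow> bool" where
  "paired os s l \<longleftrightarrow> (\<forall>j. if 1 \<le> j \<and> j < p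
     then s j = os j \<and> l j = os (j + p - 1) \<or> s j = os (j + p - 1) \<and> l j = os j
     else s j = 0 \<and> l j = 0)"

text \<open>The amount by which the sum of the selected residues grows when item \<open>j\<close> is
  flipped.\<close>

definition change :: "(int \<Rightarrow> int) \<Rightarrow> (int \<Rightarrow> int) \<Rightarrow> int \<Rightarrow> int" where
  "change s l j = r (l j) - r (s j)"

lemma paired_flip: "paired os s l \<Longrightarrow> paired os (s(j := l j)) (l(j := s j))"
  unfolding paired_def by (smt (verit) fun_upd_apply)

lemma item_size_bounds:
  shows "0 \<le> item_size os h j" "2 * item_size os h j \<le> p"
  unfolding item_size_def by (rule fold_residue_bounds; use p2 in simp)+

lemma scale_correct:
  assumes b: "base_vars p x" and so: "sorts (m 3)" and h: "0 \<le> x 12" "x 12 < p"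
    and g: "[g * x 12 = 1] (mod p)"
    and m5: "\<And>j. m 5 j = (if 1 \<le> j \<and> j < p then m 3 j else 0)"
    and m6: "\<And>j. m 6 j = (if 1 \<le> j \<and> j < p then m 3 (j + p - 1) else 0)"
    and m7: "\<And>j. 1 \<le> j \<Longrightarrow> j < p \<Longrightarrow> m 7 j = gap (m 3) j"
    and m9: "m 9 = (\<lambda>_. 0)"
  shows "WP scale_code (\<lambda>t' x' m'. int t' \<le> int t + 50 * p \<and> base_vars p x' \<and> x' 16 = x 16 \<and> x' 12 = x 12 \<and>
    paired (m 3) (m' 5) (m' 6) \<and>
    (\<forall>j. 1 \<le> j \<and> j < p \<longrightarrow> [change (m' 5) (m' 6) j = g * item_size (m 3) (x 12) j] (mod p)) \<and>
    (\<forall>c. chain (m' 10) (m' 9 c) (bucket (item_size (m 3) (x 12)) p c)) \<and>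
    (\<forall>k. k \<notin> {5, 6, 9, 10} \<longrightarrow> m' k = m k)) t x m" (is "WP _ ?Q _ _ _")
proof -
  define os where "os = m 3"
  define z where "z = (\<lambda>j. (gap os j * x 12) mod p)"
  \<comment> \<open>\<open>s i\<close> and \<open>l i\<close> are the contents of arrays 5 and 6
    once the items below \<open>i\<close> are processed: an item is flipped exactly if folding
    replaces \<open>z j\<close> by \<open>p - z j\<close>.\<close>
  define s where "s = (\<lambda>i j. if 1 \<le> j \<and> j < p then if j < i \<and> p - z j < z j then os (j + p - 1) else os j else 0)"
  define l where "l = (\<lambda>i j. if 1 \<le> j \<and> j < p then if j < i \<and> p - z j < z j then os j else os (j + p - 1) else 0)"
  define sz where "sz = item_size os (x 12)"
  have zb: "0 \<le> z j" "z j < p" for j using p2 by (auto simp: z_def)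
  have sz: "sz j = (if p - z j < z j then p - z j else z j)" for j
    by (simp add: sz_def item_size_def z_def fold_residue_def)
  define I where "I = (\<lambda>(t'::nat) (x'::vars) (m'::arrays). base_vars p x' \<and> x' 16 = x 16 \<and> x' 12 = x 12 \<and>
    1 \<le> x' 4 \<and> x' 4 \<le> p \<and> m' 5 = s (x' 4) \<and> m' 6 = l (x' 4) \<and>
    (\<forall>c. chain (m' 10) (m' 9 c) (bucket sz (x' 4) c)) \<and>
    (\<forall>k. k \<notin> {5, 6, 9, 10} \<longrightarrow> m' k = m k) \<and> int t' + 42 * p - 42 * x' 4 \<le> int t + 1 + 42 * p)"
  have init: "I (t + 1) (x(4 := 1)) m"
    using b p2 m5 m6 m9 by (auto simp: I_def s_def l_def os_def)
  have step: "WP (Get 5 7 4 ;; Op Mul 5 5 12 ;; Op Rem 5 5 0 ;; Op Sub 6 0 5 ;;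
       Cond (CLt 6 5) (Copy 5 6 ;; flip_code 4) Skip ;;
       Get 6 9 5 ;; Put 10 4 6 ;; Put 9 5 4 ;; Op Add 4 4 3) I (t' + 2) x' m'"
    if I: "I t' x' m'" and nh: "\<not> holds (CEq 4 0) x'" for t' x' m'
  proof -
    define i where "i = x' 4"
    have bx: "base_vars p x'" and i: "1 \<le> i" "i < p" and x4: "x' 4 = i" and x12: "x' 12 = x 12"
      and m': "m' 7 = m 7" "m' 5 = s i" "m' 6 = l i" and x16: "x' 16 = x 16"
      using I nh by (auto simp: I_def base_varsD i_def)
    have m7': "m 7 i = gap os i" using m7[OF i] by (simp add: os_def)
    have gb: "0 \<le> gap os i" "gap os i < p" using gap_bounds so i by (auto simp: os_def)
    have "gap os i * x 12 \<le> p * p" using gb h by (intro mult_mono) auto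
    moreover have "0 \<le> gap os i * x 12" using gb h by simp
    ultimately have prod: "\<bar>gap os i * x 12\<bar> \<le> Bd" using Bd p2 by linarith
    have szb: "0 \<le> sz i" "sz i < 2 * p" using zb[of i] by (auto simp: sz)
    have si: "s i i = os i" "l i i = os (i + p - 1)" using i by (auto simp: s_def l_def)
    have nxt: "I u y M" if "base_vars p y" "y 16 = x 16" "y 12 = x 12" "y 4 = i + 1"
      "M 5 = (if p - z i < z i then (s i)(i := os (i + p - 1)) else s i)"
      "M 6 = (if p - z i < z i then (l i)(i := os i) else l i)"
      "M 10 = (m' 10)(i := m' 9 (sz i))" "M 9 = (m' 9)(sz i := i)"
      "\<forall>k. k \<notin> {5, 6, 9, 10} \<longrightarrow> M k = m' k" "u \<le> t' + 42" for u y M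
    proof -
      have "M 5 = s (i + 1)" "M 6 = l (i + 1)"
        unfolding that(5,6) using i by (auto simp: s_def l_def fun_eq_iff)
      moreover have "chain (M 10) (M 9 c) (bucket sz (i + 1) c)" for c
        unfolding that(7,8) using I x4
        by (intro chain_push[OF i(1)]) (auto simp: I_def)
      ultimately show ?thesis
        using I i that(1-4,9,10) unfolding I_def x4 by auto
    qed
    show ?thesis
    proof (cases "p - z i < z i")
      case True
      then have "p - z i = sz i" by (simp add: sz)
      then show ?thesis
        using i p2 Bd(2) True szb zb[of i] prod bx
        by (simp add: x16 x4 x12 m' m7' si base_varsD[OF bx] z_def[THEN fun_cong, symmetric])
          (intro nxt; simp add: x16 x12 m' True)
    next
      case False
      then have "z i = sz i" by (simp add: sz)
      then show ?thesis
        using i p2 Bd(2) False szb zb[of i] prod bx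
        by (simp add: x16 x4 x12 m' m7' si base_varsD[OF bx] z_def[THEN fun_cong, symmetric])
          (intro nxt; simp add: x16 x12 m' False)
    qed
  qed
  have exit: "?Q (t' + 1) x' m'" if I: "I t' x' m'" and hd: "holds (CEq 4 0) x'" for t' x' m'
  proof -
    have x4: "x' 4 = p" using I hd by (auto simp: I_def base_varsD)
    have m': "m' 5 = s p" "m' 6 = l p" using I x4 by (auto simp: I_def)
    have "paired os (m' 5) (m' 6)"
      unfolding m' by (auto simp: paired_def s_def l_def)
    moreover have "[change (m' 5) (m' 6) j = g * sz j] (mod p)" if j: "1 \<le> j" "j < p" for j
    proof -
      have "[g * z j = g * (gap os j * x 12)] (mod p)"
        by (intro cong_mult cong_refl) (simp add: z_def cong_def)
      also have "g * (gap os j * x 12) = gap os j * (g * x 12)" by (simp add: algebra_simps)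
      also have "[gap os j * (g * x 12) = gap os j * 1] (mod p)" by (intro cong_mult cong_refl g)
      finally have 1: "[g * z j = gap os j] (mod p)" by simp
      show ?thesis
      proof (cases "p - z j < z j")
        case True
        \<comment> \<open>Here the item has been flipped, so its change is the negated gap, and
          folding has negated the scaled gap as well.\<close>
        have "[g * (p - z j) = - gap os j] (mod p)"
        proof -
          have "[g * p - g * z j = 0 - gap os j] (mod p)"
            by (intro cong_diff 1) (simp add: cong_0_iff)
          then show ?thesis by (simp add: algebra_simps)
        qed
        then show ?thesis using True j unfolding m' by (simp add: change_def s_def l_def sz gap_def cong_sym_eq)
      next
        case False
        then show ?thesis using 1 j unfolding m' by (simp add: change_def s_def l_def sz gap_def cong_sym_eq)
      qed
    qed
    ultimately show ?thesis using I x4 p2 by (simp add: I_def os_def sz_def)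
  qed
  have bound: "int t' \<le> int t + 1 + 42 * p" if "I t' x' m'" for t' x' m'
    using that unfolding I_def by linarith
  show ?thesis
    unfolding scale_code_def wp_Seq wp_Const
    by ((fact init step[unfolded wp_Seq] step exit bound | rule conjI wp_Until[where I = I and T = "int t + 1 + 42 * p"] |
        use b p2 Bd(2) in \<open>simp add: base_varsD; fail\<close>)+)
qed

text \<open>Multiplication by the unit \<open>h\<close> permutes the residues up to sign, so scaling
  keeps the classes of equal folded gaps and their multiplicities.\<close>

lemma item_size_eq_iff:
  assumes "[g * h = 1] (mod p)" "sorts os" "1 \<le> i" "i < p" "1 \<le> j" "j < p"
  shows "item_size os h i = item_size os h j \<longleftrightarrow> fold_residue p (gap os i) = fold_residue p (gap os j)"
proof -
  have p0: "0 < p" using p2 by simp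
  have nd: "\<not> p dvd h"
  proof
    assume "p dvd h"
    then have "[g * h = 0] (mod p)" by (simp add: cong_0_iff)
    with assms(1) have "[1 = 0] (mod p)" by (metis cong_sym cong_trans)
    then show False using p2 by (simp add: cong_def)
  qed
  have c: "p dvd y * h \<longleftrightarrow> p dvd y" for y
    using nd prime by (simp add: prime_dvd_mult_iff)
  have m: "gap os i mod p = gap os i" "gap os j mod p = gap os j"
    using gap_bounds[OF assms(2)] assms(3-6) by auto
  have "item_size os h i = item_size os h j \<longleftrightarrow> p dvd (gap os i - gap os j) * h \<or> p dvd (gap os i + gap os j) * h"
    unfolding item_size_def fold_residue_mod_eq_iff[OF p0] by (simp add: algebra_simps)
  also have "\<dots> \<longleftrightarrow> fold_residue p (gap os i mod p) = fold_residue p (gap os j mod p)"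
    unfolding c fold_residue_mod_eq_iff[OF p0] ..
  finally show ?thesis unfolding m .
qed

text \<open>The class of folded gap \<open>g\<close> becomes the class of size 1, so size 1 is the
  most frequent. All \<open>p - 1\<close> sizes are positive, which gives the weighted reserve, and
  the potential equals \<open>4 * p - 1\<close>.\<close>

lemma initial_sched:
  assumes gh: "[g * h = 1] (mod p)" and so: "sorts os" and g: "1 \<le> g" "g < p"
    and nz: "\<And>j. 1 \<le> j \<Longrightarrow> j < p \<Longrightarrow> gap os j \<noteq> 0"
    and mx: "\<And>e. 1 \<le> e \<Longrightarrow> e < p \<Longrightarrow>
      length (bucket (\<lambda>j. fold_residue p (gap os j)) p e) \<le> length (bucket (\<lambda>j. fold_residue p (gap os j)) p g)"
  shows "sched p (int (length (bucket (item_size os h) p 1))) (\<lambda>c. int (length (bucket (item_size os h) p c))) 1 0 1 0 (4 * p)"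
proof -
  let ?F = "\<lambda>j. fold_residue p (gap os j)"
  have p0: "0 < p" using p2 by simp
  have Fb: "1 \<le> ?F j" "?F j < p" "2 * ?F j \<le> p" if "1 \<le> j" "j < p" for j
    using fold_residue_bounds[OF gap_bounds[OF so that]] nz[OF that] p2 by auto
  have ne: "length (bucket f p c) > 0 \<longleftrightarrow> (\<exists>j. 1 \<le> j \<and> j < p \<and> f j = c)" for f c
    using set_bucket[of f p c] by (auto simp flip: set_empty)
  \<comment> \<open>Item 1 witnesses a nonempty class, so the largest class, that of
    \<open>g\<close>, is nonempty and some item has size 1.\<close>
  have "length (bucket ?F p (?F 1)) > 0" unfolding ne using p2 by (intro exI[of _ 1]) auto
  moreover have "length (bucket ?F p (?F 1)) \<le> length (bucket ?F p g)"
    using Fb[of 1] p2 by (intro mx) auto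
  ultimately have "length (bucket ?F p g) > 0" by (rule order_less_le_trans)
  then obtain j0 where j0: "1 \<le> j0" "j0 < p" "?F j0 = g" unfolding ne by blast
  have s1: "item_size os h j0 = 1"
  proof -
    have "gap os j0 = g \<or> gap os j0 = p - g" using j0(3) by (auto simp: fold_residue_def split: if_splits)
    moreover have d: "p dvd g * h - 1" using gh by (simp add: cong_iff_dvd_diff)
    moreover have "p dvd (p - g) * h + 1"
    proof -
      have eq: "(p - g) * h + 1 = p * h - (g * h - 1)" by (simp add: algebra_simps)
      show ?thesis unfolding eq by (rule dvd_diff[OF _ d]) simp
    qed
    ultimately have "p dvd gap os j0 * h - 1 \<or> p dvd gap os j0 * h + 1" by auto
    then have "item_size os h j0 = fold_residue p (1 mod p)"
      unfolding item_size_def fold_residue_mod_eq_iff[OF p0] .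
    then show ?thesis using p2 by (simp add: fold_residue_def)
  qed
  have b: "bucket (item_size os h) p (item_size os h j) = bucket ?F p (?F j)" if "1 \<le> j" "j < p" for j
    using item_size_eq_iff[OF gh so _ _ that] by (intro bucket_cong) auto
  have b1: "bucket (item_size os h) p 1 = bucket ?F p g" using b[OF j0(1,2)] s1 j0(3) by simp
  have le: "length (bucket (item_size os h) p c) \<le> length (bucket (item_size os h) p 1)" for c
  proof (cases "length (bucket (item_size os h) p c) > 0")
    case True
    then obtain j where j: "1 \<le> j" "j < p" "item_size os h j = c" unfolding ne by blast
    then show ?thesis using b[OF j(1,2)] b1 mx[of "?F j"] Fb[OF j(1,2)] by simp
  qed simp
  have sb: "1 \<le> item_size os h j" if j: "1 \<le> j" "j < p" for j
  proof -
    have "item_size os h j \<noteq> 0"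
    proof
      assume "item_size os h j = 0"
      then have "fold_residue p ((gap os j * h) mod p) = fold_residue p (0 mod p)"
        using p0 by (simp add: item_size_def fold_residue_def)
      then have "p dvd gap os j * h" unfolding fold_residue_mod_eq_iff[OF p0] by auto
      then have "p dvd g * (gap os j * h)" by simp
      moreover have "g * (gap os j * h) = gap os j * (g * h)" by simp
      ultimately have "[gap os j * (g * h) = 0] (mod p)" by (simp add: cong_0_iff)
      moreover have "[gap os j * (g * h) = gap os j * 1] (mod p)" by (intro cong_mult cong_refl gh)
      ultimately have "[gap os j = 0] (mod p)" by (metis cong_sym cong_trans mult.right_neutral)
      then have "p dvd gap os j" by (simp add: cong_0_iff)
      then show False using gap_bounds[OF so j] nz[OF j] zdvd_not_zless by force
    qed
    then show ?thesis using item_size_bounds(1)[of os h j] by simp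
  qed
  have sumk: "(\<Sum>c\<in>{1..p}. int (length (bucket (item_size os h) p c))) = p - 1"
  proof (rule sum_length_bucket)
    fix j assume "1 \<le> j" "j < p"
    then show "item_size os h j \<in> {1..p}" using sb item_size_bounds[of os h j] p2 by auto
  qed (use p2 in auto)
  have "(\<Sum>c\<in>{1..p}. int (length (bucket (item_size os h) p c))) \<le> (\<Sum>c\<in>{1..p}. c * int (length (bucket (item_size os h) p c)))"
    by (intro sum_mono) (simp add: mult_le_cancel_right1)
  then have sumc: "p - 1 \<le> (\<Sum>c\<in>{1..p}. c * int (length (bucket (item_size os h) p c)))" using sumk by simp
  have sup: "1 \<le> c \<and> 2 * c \<le> p" if "0 < int (length (bucket (item_size os h) p c))" for c
  proof -
    have "length (bucket (item_size os h) p c) > 0" using that by simp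
    then obtain j where "1 \<le> j" "j < p" "item_size os h j = c" unfolding ne by blast
    then show ?thesis using sb[of j] item_size_bounds(2)[of os h j] by auto
  qed
  have n1: "1 \<le> int (length (bucket (item_size os h) p 1))"
  proof -
    have "length (bucket (item_size os h) p 1) > 0" unfolding ne using j0 s1 by blast
    then show ?thesis by linarith
  qed
  have "sched_inv p (int (length (bucket (item_size os h) p 1))) (\<lambda>c. int (length (bucket (item_size os h) p c))) 1 0 1 0"
    unfolding sched_inv_def sumk using le sup n1 sumc p2 by auto
  moreover have "first_scan (int (length (bucket (item_size os h) p 1))) (\<lambda>c. int (length (bucket (item_size os h) p c))) 0 1"
    unfolding first_scan_def using sup by (auto; force)
  ultimately show ?thesis unfolding sched_def sumk by auto
qed

end

subsection \<open>Building the gadgets\<close>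

text \<open>One branch per scheduler action, so that each round lowers the potential. Variables 15,
  17, 18, 19 hold \<open>lo\<close>, \<open>u\<close>, \<open>v\<close>, \<open>L\<close>; 20 counts
  the gadgets; 5 holds \<open>L + 2\<close>; and 21 holds \<open>p - 2\<close>, so the loop ends
  once \<open>L \<ge> p - 1\<close>.\<close>

definition gadget_step :: com where
  "gadget_step =
     Get 4 9 15 ;;
     Cond (CEq 4 2) (Op Add 15 15 3) (
       Const 5 2 ;; Op Add 5 5 19 ;;
       Cond (CLt 15 5)
         (Get 6 10 4 ;; Put 9 15 6 ;; Op Add 20 20 3 ;; Put 11 20 4 ;; Put 12 20 2 ;; Put 13 20 15 ;;
          Op Add 19 19 15)
         (Cond (CEq 18 0) (Copy 17 15 ;; Op Add 18 15 3) (
            Get 7 9 18 ;; Cond (CEq 7 2) (Op Add 18 18 3) (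
              Get 6 9 17 ;; Cond (CEq 6 2) (Copy 17 18 ;; Op Add 18 18 3) (
                Op Sub 8 18 17 ;;
                Cond (CLt 8 5)
                  (Get 9 10 6 ;; Put 9 17 9 ;; Get 9 10 7 ;; Put 9 18 9 ;; Op Add 20 20 3 ;;
                   Put 11 20 6 ;; Put 12 20 7 ;; Put 13 20 8 ;; Op Add 19 19 8 ;; flip_code 6)
                  (Copy 17 18 ;; Op Add 18 18 3))))))"

definition gadget_code :: com where
  "gadget_code = Const 15 1 ;; Const 17 0 ;; Const 18 1 ;; Const 19 0 ;; Const 20 0 ;; Op Sub 21 16 3 ;;
     Until (CLt 21 19) gadget_step"

lemma chain_zero: "chain nx h ys \<Longrightarrow> h = 0 \<Longrightarrow> ys = []"
  by (cases ys) auto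

lemma chain_nonzero: "chain nx h ys \<Longrightarrow> h \<noteq> 0 \<Longrightarrow> \<exists>ts. ys = h # ts \<and> chain nx (nx h) ts"
  by (cases ys) auto

lemma sum_upto_Suc:
  fixes f :: "int \<Rightarrow> int"
  assumes "0 \<le> k"
  shows "sum f {1..k + 1} = sum f {1..k} + f (k + 1)"
proof -
  have "{1..k + 1} = insert (k + 1) {1..k}" using assms by auto
  then show ?thesis by simp
qed

context egz
begin

text \<open>Gadget \<open>k\<close> consists of the items \<open>G1 k\<close> and \<open>G2 k\<close>, where item 0 is a dummy; flipping both
  adds \<open>g * S k\<close> to the sum of the selected residues.\<close>

definition gadgets :: "int \<Rightarrow> (int \<Rightarrow> int) \<Rightarrow> (int \<Rightarrow> int) \<Rightarrow> (int \<Rightarrow> int) \<Rightarrow> (int \<Rightarrow> int) \<Rightarrow> (int \<Rightarrow> int) \<Rightarrow> int \<Rightarrow> bool" where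
  "gadgets g s l G1 G2 S M \<longleftrightarrow>
     (\<forall>k. 1 \<le> k \<and> k \<le> M \<longrightarrow> 1 \<le> G1 k \<and> G1 k < p \<and> 0 \<le> G2 k \<and> G2 k < p \<and> G1 k \<noteq> G2 k \<and>
        1 \<le> S k \<and> S k \<le> 1 + sum S {1..k - 1} \<and>
        [change s l (G1 k) + change s l (G2 k) = g * S k] (mod p)) \<and>
     (\<forall>k k'. 1 \<le> k \<and> k < k' \<and> k' \<le> M \<longrightarrow> G1 k \<noteq> G1 k' \<and> G1 k \<noteq> G2 k' \<and>
        (G2 k \<noteq> 0 \<longrightarrow> G2 k \<noteq> G1 k' \<and> G2 k \<noteq> G2 k'))"

lemma paired_0: "paired os s l \<Longrightarrow> s 0 = 0 \<and> l 0 = 0"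
  unfolding paired_def by (drule spec[of _ 0]) simp

lemma change_0: "paired os s l \<Longrightarrow> change s l 0 = 0"
  by (simp add: change_def paired_0)

text \<open>Only the fresh item \<open>i\<close> may have been flipped, so the changes of earlier
  gadgets persist. The bound on \<open>d\<close> continues the completeness of the steps.\<close>

lemma gadgets_add:
  assumes G: "gadgets g s l G1 G2 S M" and M: "0 \<le> M" and i: "1 \<le> i" "i < p" and j: "0 \<le> j" "j < p" "i \<noteq> j"
    and d: "1 \<le> d" "d \<le> 1 + sum S {1..M}" "[change s' l' i + change s' l' j = g * d] (mod p)"
    and fresh: "\<And>k. 1 \<le> k \<Longrightarrow> k \<le> M \<Longrightarrow> i \<noteq> G1 k \<and> i \<noteq> G2 k \<and> (j \<noteq> 0 \<longrightarrow> j \<noteq> G1 k \<and> j \<noteq> G2 k)"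
    and same: "\<And>q. q \<noteq> i \<Longrightarrow> s' q = s q \<and> l' q = l q"
  shows "gadgets g s' l' (G1(M + 1 := i)) (G2(M + 1 := j)) (S(M + 1 := d)) (M + 1)"
proof -
  let ?S = "S(M + 1 := d)"
  have sm: "sum ?S {1..k - 1} = sum S {1..k - 1}" if "k \<le> M + 1" for k
    using that by (intro sum.cong) auto
  have ch: "change s' l' q = change s l q" if "q \<noteq> i" for q using same[OF that] by (simp add: change_def)
  have G1: "1 \<le> G1 k \<and> G1 k < p \<and> 0 \<le> G2 k \<and> G2 k < p \<and> G1 k \<noteq> G2 k \<and>
        1 \<le> S k \<and> S k \<le> 1 + sum S {1..k - 1} \<and>
        [change s' l' (G1 k) + change s' l' (G2 k) = g * S k] (mod p)" if "1 \<le> k" "k \<le> M" for k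
    using G that fresh[OF that] ch[of "G1 k"] ch[of "G2 k"] unfolding gadgets_def by auto
  have "1 \<le> (G1(M + 1 := i)) k \<and> (G1(M + 1 := i)) k < p \<and> 0 \<le> (G2(M + 1 := j)) k \<and> (G2(M + 1 := j)) k < p \<and>
        (G1(M + 1 := i)) k \<noteq> (G2(M + 1 := j)) k \<and> 1 \<le> ?S k \<and> ?S k \<le> 1 + sum ?S {1..k - 1} \<and>
        [change s' l' ((G1(M + 1 := i)) k) + change s' l' ((G2(M + 1 := j)) k) = g * ?S k] (mod p)"
    if "1 \<le> k" "k \<le> M + 1" for k
    unfolding sm[OF that(2)] using G1[of k] that i j d by (cases "k = M + 1") auto
  moreover have "(G1(M + 1 := i)) k \<noteq> (G1(M + 1 := i)) k' \<and> (G1(M + 1 := i)) k \<noteq> (G2(M + 1 := j)) k' \<and>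
        ((G2(M + 1 := j)) k \<noteq> 0 \<longrightarrow> (G2(M + 1 := j)) k \<noteq> (G1(M + 1 := i)) k' \<and> (G2(M + 1 := j)) k \<noteq> (G2(M + 1 := j)) k')"
    if "1 \<le> k" "k < k'" "k' \<le> M + 1" for k k'
  proof (cases "k' = M + 1")
    case True
    then show ?thesis using that fresh[of k] G1[of k] by (cases "j = 0") auto
  next
    case False
    then show ?thesis using that G unfolding gadgets_def by auto
  qed
  ultimately show ?thesis unfolding gadgets_def by blast
qed

definition sched_state :: "int \<Rightarrow> int \<Rightarrow> int \<Rightarrow> (int \<Rightarrow> int) \<Rightarrow> vars \<Rightarrow> arrays \<Rightarrow> (int \<Rightarrow> int list) \<Rightarrow> int \<Rightarrow> bool" where
  "sched_state n g h os x m ls \<Phi> \<longleftrightarrow> base_vars p x \<and> x 12 = h \<and> x 21 = p - 2 \<and>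
     sched p n (\<lambda>c. int (length (ls c))) (x 15) (x 17) (x 18) (x 19) \<Phi> \<and>
     (\<forall>c. chain (m 10) (m 9 c) (ls c)) \<and> (\<forall>c. distinct (ls c)) \<and>
     (\<forall>c. \<forall>j\<in>set (ls c). 1 \<le> j \<and> j < p \<and> item_size os h j = c \<and>
        [change (m 5) (m 6) j = g * c] (mod p) \<and> (\<forall>k. 1 \<le> k \<and> k \<le> x 20 \<longrightarrow> j \<noteq> m 11 k \<and> j \<noteq> m 12 k)) \<and>
     paired os (m 5) (m 6) \<and> gadgets g (m 5) (m 6) (m 11) (m 12) (m 13) (x 20) \<and> 0 \<le> x 20 \<and>
     x 20 + (\<Sum>c\<in>{1..p}. int (length (ls c))) \<le> p - 1 \<and> x 19 = sum (m 13) {1..x 20} \<and> x 19 \<le> 2 * p \<and>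
     m 3 = os \<and> m 4 = r"

lemma sched_state_move:
  assumes "sched_state n g h os x m ls \<Phi>"
    and "sched p n (\<lambda>c. int (length (ls c))) (y 15) (y 17) (y 18) (x 19) \<Phi>'"
    and "base_vars p y" "y 12 = x 12" "y 21 = x 21" "y 19 = x 19" "y 20 = x 20"
  shows "sched_state n g h os y m ls \<Phi>'"
  using assms unfolding sched_state_def by auto

lemma sched_state_single:
  assumes st: "sched_state n g h os x m ls \<Phi>" and ne: "ls (x 15) = j # ts" and lt: "x 15 < x 19 + 2" "x 19 < p - 1"
    and y: "base_vars p y" "y 12 = x 12" "y 21 = x 21" "y 15 = x 15" "y 17 = x 17" "y 18 = x 18"
      "y 19 = x 19 + x 15" "y 20 = x 20 + 1"
    and M: "M 9 = (m 9)(x 15 := m 10 j)" "M 11 = (m 11)(x 20 + 1 := j)" "M 12 = (m 12)(x 20 + 1 := 0)"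
      "M 13 = (m 13)(x 20 + 1 := x 15)" "\<forall>k. k \<notin> {9, 11, 12, 13} \<longrightarrow> M k = m k"
  shows "sched_state n g h os y M (ls(x 15 := ts)) (\<Phi> - 1)"
proof -
  let ?ls = "ls(x 15 := ts)"
  let ?k = "\<lambda>c. int (length (ls c))"
  have bx: "base_vars p x" "x 12 = h" "x 21 = p - 2" and sch: "sched p n ?k (x 15) (x 17) (x 18) (x 19) \<Phi>"
    and ch: "\<And>c. chain (m 10) (m 9 c) (ls c)" and di: "\<And>c. distinct (ls c)"
    and it: "\<And>c q. q \<in> set (ls c) \<Longrightarrow> 1 \<le> q \<and> q < p \<and> item_size os h q = c \<and>
        [change (m 5) (m 6) q = g * c] (mod p) \<and> (\<forall>k. 1 \<le> k \<and> k \<le> x 20 \<longrightarrow> q \<noteq> m 11 k \<and> q \<noteq> m 12 k)"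
    and pa: "paired os (m 5) (m 6)" and ga: "gadgets g (m 5) (m 6) (m 11) (m 12) (m 13) (x 20)" and x20: "0 \<le> x 20"
    and R: "x 20 + sum ?k {1..p} \<le> p - 1" and L: "x 19 = sum (m 13) {1..x 20}" and m34: "m 3 = os" "m 4 = r"
    using st unfolding sched_state_def by auto
  have keq: "(\<lambda>c. int (length (?ls c))) = ?k(x 15 := ?k (x 15) - 1)"
    using ne by (auto simp: fun_eq_iff)
  have lo: "1 \<le> x 15" "x 15 \<le> p" using sched_bounds[OF sch] by auto
  have jj: "j \<in> set (ls (x 15))" using ne by simp
  note ij = it[OF jj]
  have sch': "sched p n (\<lambda>c. int (length (?ls c))) (x 15) (x 17) (x 18) (x 19 + x 15) (\<Phi> - 1)"
    unfolding keq using sched_single[OF sch _ lt(1)] ne by simp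
  have R': "sum (\<lambda>c. int (length (?ls c))) {1..p} = sum ?k {1..p} - 1"
    unfolding keq using sum_fun_upd[of "{1..p}" "x 15" ?k "?k (x 15) - 1"] lo by simp
  have ga': "gadgets g (m 5) (m 6) ((m 11)(x 20 + 1 := j)) ((m 12)(x 20 + 1 := 0)) ((m 13)(x 20 + 1 := x 15)) (x 20 + 1)"
    using ij lo lt p2 change_0[OF pa] L by (intro gadgets_add[OF ga x20]) auto
  have L': "x 19 + x 15 = sum ((m 13)(x 20 + 1 := x 15)) {1..x 20 + 1}"
  proof -
    have "sum ((m 13)(x 20 + 1 := x 15)) {1..x 20} = sum (m 13) {1..x 20}" by (rule sum.cong) auto
    then show ?thesis unfolding sum_upto_Suc[OF x20] L by simp
  qed
  have ch': "chain (m 10) (((m 9)(x 15 := m 10 j)) c) (?ls c)" for c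
    using ch[of c] ch[of "x 15"] ne by auto
  have it': "1 \<le> q \<and> q < p \<and> item_size os h q = c \<and> [change (m 5) (m 6) q = g * c] (mod p) \<and>
      (\<forall>k. 1 \<le> k \<and> k \<le> x 20 + 1 \<longrightarrow> q \<noteq> ((m 11)(x 20 + 1 := j)) k \<and> q \<noteq> ((m 12)(x 20 + 1 := 0)) k)"
    if q: "q \<in> set (?ls c)" for c q
  proof -
    have qc: "q \<in> set (ls c)" using q ne by (auto split: if_splits)
    have "q \<noteq> j"
    proof
      assume "q = j"
      then have "c = x 15" using it[OF qc] ij by simp
      then show False using q \<open>q = j\<close> di[of "x 15"] ne by simp
    qed
    then show ?thesis using it[OF qc] by auto
  qed
  have di': "distinct (?ls c)" for c using di[of c] di[of "x 15"] ne by auto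
  have M': "M 5 = m 5" "M 6 = m 6" "M 10 = m 10" "M 3 = m 3" "M 4 = m 4" using M(5) by auto
  have "x 19 + x 15 \<le> 2 * p" using lt lo by auto
  then show ?thesis
    unfolding sched_state_def y M' M(1-4) using bx y(1) sch' ch' di' it' pa ga' x20 R R' L' m34 by auto
qed

text \<open>Item \<open>i\<close> is flipped in advance: flipping it back subtracts \<open>g\<close>
  times the smaller size, flipping \<open>j\<close> adds \<open>g\<close> times the larger one. The
  altered selection is harmless, because the target is computed only after all gadgets are
  built.\<close>

lemma sched_state_pair:
  assumes st: "sched_state n g h os x m ls \<Phi>" and ne: "ls (x 17) = i # is" "ls (x 18) = j # js"
    and lt: "x 19 + 2 \<le> x 15" "x 18 - x 17 < x 19 + 2" "x 19 < p - 1"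
    and y: "base_vars p y" "y 12 = x 12" "y 21 = x 21" "y 15 = x 15" "y 17 = x 17" "y 18 = x 18"
      "y 19 = x 19 + (x 18 - x 17)" "y 20 = x 20 + 1"
    and M: "M 9 = (m 9)(x 17 := m 10 i, x 18 := m 10 j)" "M 11 = (m 11)(x 20 + 1 := i)" "M 12 = (m 12)(x 20 + 1 := j)"
      "M 13 = (m 13)(x 20 + 1 := x 18 - x 17)" "M 5 = (m 5)(i := m 6 i)" "M 6 = (m 6)(i := m 5 i)"
      "\<forall>k. k \<notin> {5, 6, 9, 11, 12, 13} \<longrightarrow> M k = m k"
  shows "sched_state n g h os y M (ls(x 17 := is, x 18 := js)) (\<Phi> - 1)"
proof -
  let ?ls = "ls(x 17 := is, x 18 := js)"
  let ?k = "\<lambda>c. int (length (ls c))"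
  let ?s = "(m 5)(i := m 6 i)"
  let ?l = "(m 6)(i := m 5 i)"
  have bx: "base_vars p x" "x 12 = h" "x 21 = p - 2" and sch: "sched p n ?k (x 15) (x 17) (x 18) (x 19) \<Phi>"
    and ch: "\<And>c. chain (m 10) (m 9 c) (ls c)" and di: "\<And>c. distinct (ls c)"
    and it: "\<And>c q. q \<in> set (ls c) \<Longrightarrow> 1 \<le> q \<and> q < p \<and> item_size os h q = c \<and>
        [change (m 5) (m 6) q = g * c] (mod p) \<and> (\<forall>k. 1 \<le> k \<and> k \<le> x 20 \<longrightarrow> q \<noteq> m 11 k \<and> q \<noteq> m 12 k)"
    and pa: "paired os (m 5) (m 6)" and ga: "gadgets g (m 5) (m 6) (m 11) (m 12) (m 13) (x 20)" and x20: "0 \<le> x 20"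
    and R: "x 20 + sum ?k {1..p} \<le> p - 1" and L: "x 19 = sum (m 13) {1..x 20}" and m34: "m 3 = os" "m 4 = r"
    using st unfolding sched_state_def by auto
  have uv: "x 17 < x 18" "0 \<le> x 17" "x 18 \<le> p" using sched_bounds[OF sch] by auto
  have keq: "(\<lambda>c. int (length (?ls c))) = ?k(x 17 := ?k (x 17) - 1, x 18 := ?k (x 18) - 1)"
    using ne uv by (auto simp: fun_eq_iff)
  have ii: "i \<in> set (ls (x 17))" and jj: "j \<in> set (ls (x 18))" using ne by auto
  note iti = it[OF ii] and itj = it[OF jj]
  have ij: "i \<noteq> j" using iti itj uv by auto
  have sch': "sched p n (\<lambda>c. int (length (?ls c))) (x 15) (x 17) (x 18) (x 19 + (x 18 - x 17)) (\<Phi> - 1)"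
    unfolding keq using sched_pair[OF sch _ _ lt(1,2)] ne by simp
  \<comment> \<open>Two items disappear but only one gadget appears, so a decrease by one
    suffices.\<close>
  have R': "sum (\<lambda>c. int (length (?ls c))) {1..p} \<le> sum ?k {1..p} - 1"
  proof -
    have "x 18 \<in> {1..p}" using uv by auto
    then have "sum (?k(x 18 := ?k (x 18) - 1)) {1..p} = sum ?k {1..p} - 1"
      using sum_fun_upd[of "{1..p}" "x 18" ?k "?k (x 18) - 1"] by simp
    moreover have "sum (\<lambda>c. int (length (?ls c))) {1..p} \<le> sum (?k(x 18 := ?k (x 18) - 1)) {1..p}"
      using ne by (intro sum_mono) auto
    ultimately show ?thesis by simp
  qed
  have chq: "change ?s ?l q = change (m 5) (m 6) q" if "q \<noteq> i" for q using that by (simp add: change_def)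
  have chi: "change ?s ?l i = - change (m 5) (m 6) i" by (simp add: change_def)
  have cong: "[change ?s ?l i + change ?s ?l j = g * (x 18 - x 17)] (mod p)"
  proof -
    have "[change (m 5) (m 6) j - change (m 5) (m 6) i = g * x 18 - g * x 17] (mod p)"
      using iti itj by (intro cong_diff) auto
    then show ?thesis using chq[of j] chi ij by (simp add: algebra_simps)
  qed
  have ga': "gadgets g ?s ?l ((m 11)(x 20 + 1 := i)) ((m 12)(x 20 + 1 := j)) ((m 13)(x 20 + 1 := x 18 - x 17)) (x 20 + 1)"
    using iti itj uv lt p2 L ij by (intro gadgets_add[OF ga x20 _ _ _ _ _ _ _ cong]) auto
  have L': "x 19 + (x 18 - x 17) = sum ((m 13)(x 20 + 1 := x 18 - x 17)) {1..x 20 + 1}"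
  proof -
    have "sum ((m 13)(x 20 + 1 := x 18 - x 17)) {1..x 20} = sum (m 13) {1..x 20}" by (rule sum.cong) auto
    then show ?thesis unfolding sum_upto_Suc[OF x20] L by simp
  qed
  have ch': "chain (m 10) (((m 9)(x 17 := m 10 i, x 18 := m 10 j)) c) (?ls c)" for c
    using ch[of c] ch[of "x 17"] ch[of "x 18"] ne by auto
  have it': "1 \<le> q \<and> q < p \<and> item_size os h q = c \<and> [change ?s ?l q = g * c] (mod p) \<and>
      (\<forall>k. 1 \<le> k \<and> k \<le> x 20 + 1 \<longrightarrow> q \<noteq> ((m 11)(x 20 + 1 := i)) k \<and> q \<noteq> ((m 12)(x 20 + 1 := j)) k)"
    if q: "q \<in> set (?ls c)" for c q
  proof -
    have qc: "q \<in> set (ls c)" using q ne by (auto split: if_splits)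
    have "q \<noteq> i"
    proof
      assume "q = i"
      then have "c = x 17" using it[OF qc] iti by simp
      then show False using q \<open>q = i\<close> di[of "x 17"] ne uv by simp
    qed
    moreover have "q \<noteq> j"
    proof
      assume "q = j"
      then have "c = x 18" using it[OF qc] itj by simp
      then show False using q \<open>q = j\<close> di[of "x 18"] ne by simp
    qed
    ultimately show ?thesis using it[OF qc] chq[of q] by auto
  qed
  have di': "distinct (?ls c)" for c using di[of c] di[of "x 17"] di[of "x 18"] ne by auto
  have M': "M 10 = m 10" "M 3 = m 3" "M 4 = m 4" using M(7) by auto
  have "x 19 + (x 18 - x 17) \<le> 2 * p" using lt uv by auto
  then show ?thesis
    unfolding sched_state_def y M' M(1-6) using bx y(1) sch' ch' di' it' paired_flip[OF pa] ga' x20 R R' L' m34 by auto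
qed

end

section \<open>Computing the missing residue and realising it by gadgets\<close>

definition target_code :: com where
  "target_code = Op Sub 6 1 3 ;; Get 22 3 6 ;; Get 5 4 22 ;; Const 4 1 ;;
     Until (CEq 4 0) (Get 6 5 4 ;; Get 6 4 6 ;; Op Add 5 5 6 ;; Op Add 4 4 3) ;;
     Op Sub 5 2 5 ;; Op Rem 5 5 0 ;; Op Mul 5 5 12 ;; Op Rem 5 5 0"

definition solve_code :: com where
  "solve_code = Until (CEq 20 2) (
     Get 6 13 20 ;;
     Cond (CLt 5 6) Skip
       (Op Sub 5 5 6 ;; Get 6 11 20 ;; flip_code 6 ;; Get 6 12 20 ;; flip_code 6) ;;
     Op Sub 20 20 3)"

definition output_code :: com where
  "output_code = Const 4 1 ;;
     Until (CEq 4 0) (Get 5 5 4 ;; Put 0 4 5 ;; Op Add 4 4 3) ;;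
     Put 0 0 22 ;; Put 0 2 0"

context egz
begin

lemma gadget_step_correct:
  assumes st: "sched_state n g h os x m ls \<Phi>" and L: "x 19 < p - 1"
  shows "WP gadget_step (\<lambda>t' x' m'. int t' \<le> int t + 80 \<and> (\<exists>ls'. sched_state n g h os x' m' ls' (\<Phi> - 1))) t x m"
proof -
  let ?k = "\<lambda>c. int (length (ls c))"
  have bx: "base_vars p x" and sch: "sched p n ?k (x 15) (x 17) (x 18) (x 19) \<Phi>"
    and ch: "\<And>c. chain (m 10) (m 9 c) (ls c)"
    and it: "\<And>c q. q \<in> set (ls c) \<Longrightarrow> 1 \<le> q \<and> q < p"
    and x20: "0 \<le> x 20" and R: "x 20 + sum ?k {1..p} \<le> p - 1"
    using st unfolding sched_state_def by auto
  note bd = sched_bounds[OF sch]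
  note bv = base_varsD[OF bx]
  have x20': "x 20 \<le> p - 1" using R bd by simp
  have nz: "1 \<le> m 9 c \<and> m 9 c < p" if "m 9 c \<noteq> 0" for c
    using chain_nonzero[OF ch that] it[of "m 9 c" c] by auto
  have kz: "?k c = 0" if "m 9 c = 0" for c using chain_zero[OF ch that] by simp
  have kp: "0 < ?k c" if "m 9 c \<noteq> 0" for c using chain_nonzero[OF ch that] by auto
  \<comment> \<open>Actions that only move \<open>lo\<close>, \<open>u\<close> or \<open>v\<close>
    leave memory alone and keep the ghost lists as witness.\<close>
  note move = exI[of "\<lambda>ls'. sched_state n g h os _ _ ls' (\<Phi> - 1)" ls, OF sched_state_move[OF st]]
  show ?thesis
  proof (cases "m 9 (x 15) = 0")
    case True
    show ?thesis unfolding gadget_step_def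
      using True bd p2 Bd(2) bx sched_advance[OF sch L kz[OF True]]
      by (simp add: bv) (intro move; simp)
  next
    case A: False
    show ?thesis
    proof (cases "x 15 < x 19 + 2")
      case True
      obtain ts where ts: "ls (x 15) = m 9 (x 15) # ts" using chain_nonzero[OF ch A] by auto
      note single = exI[of "\<lambda>ls'. sched_state n g h os _ _ ls' (\<Phi> - 1)" "ls(x 15 := ts)", OF sched_state_single[OF st ts True L]]
      show ?thesis unfolding gadget_step_def
        using A True bd p2 Bd(2) bx nz[OF A] x20 x20' L
        by (simp add: bv) (intro single; simp)
    next
      case B: False
      then have blk: "x 19 + 2 \<le> x 15" by simp
      show ?thesis
      proof (cases "x 18 = p")
        case True
        show ?thesis unfolding gadget_step_def
          using A B True bd p2 Bd(2) bx L sched_restart[OF sch[unfolded True] kp[OF A] blk]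
          by (simp add: bv) (intro move; simp)
      next
        case C: False
        show ?thesis
        proof (cases "m 9 (x 18) = 0")
          case True
          show ?thesis unfolding gadget_step_def
            using A B C True bd p2 Bd(2) bx L sched_skip_v[OF sch C kz[OF True]]
            by (simp add: bv) (intro move; simp)
        next
          case D: False
          show ?thesis
          proof (cases "m 9 (x 17) = 0")
            case True
            show ?thesis unfolding gadget_step_def
              using A B C D True bd p2 Bd(2) bx L sched_skip_u[OF sch C kz[OF True]]
              by (simp add: bv) (intro move; simp)
          next
            case E: False
            show ?thesis
            proof (cases "x 18 - x 17 < x 19 + 2")
              case True
              obtain "is" where "is": "ls (x 17) = m 9 (x 17) # is" using chain_nonzero[OF ch E] by auto
              obtain js where js: "ls (x 18) = m 9 (x 18) # js" using chain_nonzero[OF ch D] by auto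
              note pair = exI[of "\<lambda>ls'. sched_state n g h os _ _ ls' (\<Phi> - 1)" "ls(x 17 := is, x 18 := js)",
                  OF sched_state_pair[OF st "is" js blk True L]]
              show ?thesis unfolding gadget_step_def
                using A B C D E True bd p2 Bd(2) bx L nz[OF A] nz[OF D] nz[OF E] x20 x20'
                by (simp add: bv) (intro pair; simp)
            next
              case False
              then have far: "x 19 + 2 \<le> x 18 - x 17" by simp
              show ?thesis unfolding gadget_step_def
                using A B C D E False bd p2 Bd(2) bx L sched_abandon[OF sch C kp[OF E] kp[OF D] blk far]
                by (simp add: bv) (intro move; simp)
            qed
          qed
        qed
      qed
    qed
  qed
qed

lemma gadget_correct:
  assumes b: "base_vars p x" and x16: "x 16 = p - 1"
    and m34: "m 3 = os" "m 4 = r" and pa: "paired os (m 5) (m 6)"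
    and ch: "\<And>j. 1 \<le> j \<Longrightarrow> j < p \<Longrightarrow> [change (m 5) (m 6) j = g * item_size os (x 12) j] (mod p)"
    and chn: "\<And>c. chain (m 10) (m 9 c) (bucket (item_size os (x 12)) p c)"
    and sch: "sched p n (\<lambda>c. int (length (bucket (item_size os (x 12)) p c))) 1 0 1 0 (4 * p)"
    and sumk: "(\<Sum>c\<in>{1..p}. int (length (bucket (item_size os (x 12)) p c))) \<le> p - 1"
  shows "WP gadget_code (\<lambda>t' x' m'. int t' \<le> int t + 400 * p \<and> base_vars p x' \<and> x' 12 = x 12 \<and>
    paired os (m' 5) (m' 6) \<and> gadgets g (m' 5) (m' 6) (m' 11) (m' 12) (m' 13) (x' 20) \<and>
    0 \<le> x' 20 \<and> x' 20 < p \<and> p - 1 \<le> sum (m' 13) {1..x' 20} \<and> m' 3 = os \<and> m' 4 = r) t x m" (is "WP _ ?Q _ _ _")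
proof -
  let ?y = "x(15 := 1, 17 := 0, 18 := 1, 19 := 0, 20 := 0, 21 := p - 2)"
  define h where "h = x 12"
  \<comment> \<open>A round costs at most 80 plus 2 for the loop and lowers \<open>\<Phi>\<close> by
    1; \<open>328 * p\<close> is 82 times the initial \<open>4 * p\<close>.\<close>
  define I where "I = (\<lambda>(t'::nat) (x'::vars) (m'::arrays).
    \<exists>ls \<Phi>. sched_state n g h os x' m' ls \<Phi> \<and> int t' + 82 * \<Phi> \<le> int t + 6 + 328 * p)"
  have init: "I (t + 1 + 1 + 1 + 1 + 1 + 1) ?y m"
  proof -
    have "sched_state n g h os ?y m (bucket (item_size os h) p) (4 * p)"
      unfolding sched_state_def using b m34 pa ch chn sch sumk p2
      by (auto simp: h_def set_bucket distinct_bucket gadgets_def)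
    then show ?thesis unfolding I_def by force
  qed
  have step: "WP gadget_step I (t' + 2) x' m'" if I: "I t' x' m'" and nh: "\<not> holds (CLt 21 19) x'" for t' x' m'
  proof -
    from I obtain ls \<Phi> where st: "sched_state n g h os x' m' ls \<Phi>" and tm: "int t' + 82 * \<Phi> \<le> int t + 6 + 328 * p"
      unfolding I_def by blast
    have "x' 19 < p - 1" using nh st by (auto simp: sched_state_def)
    from gadget_step_correct[OF st this, of "t' + 2"] show ?thesis
      by (rule wp_mono) (use tm in \<open>force simp: I_def\<close>)
  qed
  have exit: "?Q (t' + 1) x' m'" if I: "I t' x' m'" and h: "holds (CLt 21 19) x'" for t' x' m'
  proof -
    from I obtain ls \<Phi> where st: "sched_state n g h os x' m' ls \<Phi>" and tm: "int t' + 82 * \<Phi> \<le> int t + 6 + 328 * p"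
      unfolding I_def by blast
    have sc: "sched p n (\<lambda>c. int (length (ls c))) (x' 15) (x' 17) (x' 18) (x' 19) \<Phi>"
      using st unfolding sched_state_def by blast
    have "p - 1 \<le> x' 19" using h st by (auto simp: sched_state_def)
    then show ?thesis using st tm sched_bounds(7,8)[OF sc] p2 unfolding sched_state_def by (auto simp: h_def)
  qed
  have bound: "int t' \<le> int t + 6 + 328 * p" if I: "I t' x' m'" for t' x' m'
  proof -
    from I obtain ls \<Phi> where st: "sched_state n g h os x' m' ls \<Phi>" and tm: "int t' + 82 * \<Phi> \<le> int t + 6 + 328 * p"
      unfolding I_def by blast
    have sc: "sched p n (\<lambda>c. int (length (ls c))) (x' 15) (x' 17) (x' 18) (x' 19) \<Phi>"
      using st unfolding sched_state_def by blast
    show ?thesis using tm sched_bounds(7)[OF sc] by linarith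
  qed
  have loop: "WP (Until (CLt 21 19) gadget_step) ?Q (t + 1 + 1 + 1 + 1 + 1 + 1) ?y m"
    by (rule wp_Until[where I = I and T = "int t + 6 + 328 * p"]) (fact init step exit bound)+
  then show ?thesis
    unfolding gadget_code_def using b x16 Bd(2) p2 by (simp add: base_varsD)
qed

definition residue_sum :: "(int \<Rightarrow> int) \<Rightarrow> int \<Rightarrow> int" where
  "residue_sum s j = r j + (\<Sum>i\<in>{1..p - 1}. r (s i))"

lemma paired_bounds:
  assumes "sorts os" "paired os s l" "1 \<le> j" "j < p"
  shows "1 \<le> s j" "s j < 2 * p"
  using assms(2-4) sorts_bounds[OF assms(1), of j] sorts_bounds[OF assms(1), of "j + p - 1"]
  unfolding paired_def by (auto dest!: spec[of _ j])

lemma target_correct: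
  assumes b: "base_vars p x" and so: "sorts (m 3)" and m4: "m 4 = r" and pa: "paired (m 3) (m 5) (m 6)"
    and h: "0 \<le> x 12" "x 12 < p" "[g * x 12 = 1] (mod p)"
  shows "WP target_code (\<lambda>t' x' m'. int t' \<le> int t + 25 * p \<and> base_vars p x' \<and> m' = m \<and> x' 20 = x 20 \<and>
    x' 22 = m 3 (2 * p - 1) \<and> 0 \<le> x' 5 \<and> x' 5 < p \<and>
    [residue_sum (m 5) (x' 22) + g * x' 5 = 0] (mod p)) t x m" (is "WP _ ?Q _ _ _")
proof -
  define e where "e = m 3 (2 * p - 1)"
  have e: "1 \<le> e" "e < 2 * p" using sorts_bounds[OF so, of "2 * p - 1"] p2 by (auto simp: e_def)
  let ?y = "x(6 := 2 * p - 1, 22 := e, 5 := r e, 4 := 1)"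
  \<comment> \<open>The residues are added without reduction, so the invariant bounds variable 5 by
    \<open>p\<close> times the loop counter to keep it within \<open>Bd\<close>.\<close>
  define I where "I = (\<lambda>(t'::nat) (x'::vars) (m'::arrays). base_vars p x' \<and> m' = m \<and> x' 20 = x 20 \<and>
    x' 22 = e \<and> x' 12 = x 12 \<and> 1 \<le> x' 4 \<and> x' 4 \<le> p \<and> x' 5 = r e + (\<Sum>i\<in>{1..x' 4 - 1}. r (m 5 i)) \<and>
    0 \<le> x' 5 \<and> x' 5 \<le> p * x' 4 \<and> int t' + 12 * p - 12 * x' 4 \<le> int t + 10 + 12 * p)"
  have init: "I (t + 1 + 4 + 4 + 1) ?y m"
    using b p2 r_bounds[of e] by (auto simp: I_def)
  have step: "WP (Get 6 5 4 ;; Get 6 4 6 ;; Op Add 5 5 6 ;; Op Add 4 4 3) I (t' + 2) x' m'"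
    if I: "I t' x' m'" and nh: "\<not> holds (CEq 4 0) x'" for t' x' m'
  proof -
    define i where "i = x' 4"
    have bx: "base_vars p x'" and i: "1 \<le> i" "i < p" and x4: "x' 4 = i" and m': "m' = m"
      and x5: "0 \<le> x' 5" "x' 5 \<le> p * i" "x' 5 = r e + (\<Sum>i\<in>{1..i - 1}. r (m 5 i))"
      using I nh by (auto simp: I_def base_varsD i_def)
    note pb = paired_bounds[OF so pa i]
    have s: "(\<Sum>q\<in>{1..i}. r (m 5 q)) = (\<Sum>q\<in>{1..i - 1}. r (m 5 q)) + r (m 5 i)"
      using sum_upto_Suc[of "i - 1" "\<lambda>q. r (m 5 q)"] i by simp
    have pi: "p * (i + 1) = p * i + p" by (simp add: algebra_simps)
    have "p * i \<le> p * p" using i p2 by (intro mult_left_mono) auto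
    then have g: "\<bar>x' 5 + r (m 5 i)\<bar> \<le> Bd"
      using x5(1,2) r_bounds[of "m 5 i"] Bd p2 by linarith
    show ?thesis
      using I i pb p2 base_varsD[OF bx] Bd(2) bx g r_bounds[of "m 5 i"] x5 pi
      unfolding I_def m' x4 by (simp add: x4 m4 s)
  qed
  have exit: "WP (Op Sub 5 2 5 ;; Op Rem 5 5 0 ;; Op Mul 5 5 12 ;; Op Rem 5 5 0) ?Q (t' + 1) x' m'"
    if I: "I t' x' m'" and hd: "holds (CEq 4 0) x'" for t' x' m'
  proof -
    have x4: "x' 4 = p" and bx: "base_vars p x'" using I hd by (auto simp: I_def base_varsD)
    define z where "z = x' 5"
    have z: "z = residue_sum (m 5) e" "0 \<le> z" "z \<le> p * p" using I x4 by (auto simp: I_def residue_sum_def z_def)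
    define u where "u = (- z) mod p"
    have u: "0 \<le> u" "u < p" using p2 by (auto simp: u_def)
    have "u * x 12 \<le> p * p" "0 \<le> u * x 12" using u h by (auto intro: mult_mono)
    then have g1: "\<bar>u * x 12\<bar> \<le> Bd" using Bd p2 by linarith
    have g2: "z \<le> Bd" "0 \<le> Bd" using z Bd p2 by linarith+
    have "u * x 12 mod p < p" using p2 by simp
    then have g3: "u * x 12 mod p \<le> Bd" using Bd p2 by linarith
    \<comment> \<open>Multiplying the missing residue \<open>u\<close> by the inverse of
      \<open>g\<close> expresses it as a multiple of \<open>g\<close>, the unit in which gadget
      steps are measured.\<close>
    have "[g * ((u * x 12) mod p) = g * (u * x 12)] (mod p)" by (intro cong_mult cong_refl) (simp add: cong_def)
    also have "g * (u * x 12) = u * (g * x 12)" by (simp add: algebra_simps)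
    also have "[u * (g * x 12) = u * 1] (mod p)" by (intro cong_mult cong_refl h)
    also have "[u * 1 = - z] (mod p)" by (simp add: u_def cong_def)
    finally have "[z + g * ((u * x 12) mod p) = z + - z] (mod p)" by (intro cong_add cong_refl)
    then have c: "[residue_sum (m 5) e + g * ((u * x 12) mod p) = 0] (mod p)" using z by simp
    have t': "int t' \<le> int t + 10 + 12 * p" "x' 12 = x 12" "x' 20 = x 20" "x' 22 = e" "m' = m"
      using I x4 by (auto simp: I_def)
    show ?thesis using bx base_varsD[OF bx] z(2) g1 g2 g3 Bd(2) p2 u c t'
      by (simp add: e_def[symmetric] z_def[symmetric] u_def[symmetric])
  qed
  have bound: "int t' \<le> int t + 10 + 12 * p" if "I t' x' m'" for t' x' m'
    using that unfolding I_def by linarith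
  have "WP (Until (CEq 4 0) (Get 6 5 4 ;; Get 6 4 6 ;; Op Add 5 5 6 ;; Op Add 4 4 3))
    (WP (Op Sub 5 2 5 ;; Op Rem 5 5 0 ;; Op Mul 5 5 12 ;; Op Rem 5 5 0) ?Q) (t + 1 + 4 + 4 + 1) ?y m"
    by (rule wp_Until[where I = I and T = "int t + 10 + 12 * p"]) (fact init step exit bound)+
  then show ?thesis
    unfolding target_code_def using b p2 Bd(2) e m4
    by (simp add: base_varsD e_def[symmetric])
qed

lemma residue_sum_flip:
  assumes "paired os s l" "0 \<le> j" "j < p"
  shows "residue_sum (s(j := l j)) q = residue_sum s q + change s l j"
proof (cases "j = 0")
  case True
  have "(\<Sum>i\<in>{1..p - 1}. r ((s(j := l j)) i)) = (\<Sum>i\<in>{1..p - 1}. r (s i))"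
    using True by (intro sum.cong) auto
  then show ?thesis using True change_0[OF assms(1)] by (simp add: residue_sum_def)
next
  case False
  then have j: "j \<in> {1..p - 1}" using assms by auto
  have "(\<Sum>i\<in>{1..p - 1} - {j}. r ((s(j := l j)) i)) = (\<Sum>i\<in>{1..p - 1} - {j}. r (s i))"
    by (intro sum.cong) auto
  then show ?thesis
    by (simp add: residue_sum_def change_def sum.remove[OF _ j])
qed

text \<open>Gadgets share no real item, and the dummy item 0 has change 0 both before and after the
  flips.\<close>

lemma gadgets_drop:
  assumes G: "gadgets g s l G1 G2 S k" and pa: "paired os s l" "paired os s' l'"
    and same: "\<And>q. q \<noteq> G1 k \<Longrightarrow> q \<noteq> G2 k \<Longrightarrow> s' q = s q \<and> l' q = l q" and k: "1 \<le> k"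
  shows "gadgets g s' l' G1 G2 S (k - 1)"
proof -
  have "change s' l' (G1 i) = change s l (G1 i)" "change s' l' (G2 i) = change s l (G2 i)"
    if i: "1 \<le> i" "i \<le> k - 1" for i
  proof -
    have "G1 i \<noteq> G1 k" "G1 i \<noteq> G2 k" "G2 i \<noteq> 0 \<Longrightarrow> G2 i \<noteq> G1 k \<and> G2 i \<noteq> G2 k"
      using G i unfolding gadgets_def by auto
    then show "change s' l' (G1 i) = change s l (G1 i)" "change s' l' (G2 i) = change s l (G2 i)"
      using same change_0[OF pa(1)] change_0[OF pa(2)]
      by (simp add: change_def, cases "G2 i = 0") (auto simp: change_def)
  qed
  then show ?thesis using G unfolding gadgets_def by auto
qed

text \<open>The remaining target stays at most the sum of the steps below \<open>k\<close>: if it is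
  less than step \<open>k\<close>, by completeness of the steps, and otherwise after subtracting
  that step. With no gadgets left it must be 0.\<close>

lemma solve_correct:
  assumes b: "base_vars p x" and so: "sorts os" and pa: "paired os (m 5) (m 6)"
    and ga: "gadgets g (m 5) (m 6) (m 11) (m 12) (m 13) (x 20)"
    and x20: "0 \<le> x 20" "x 20 < p" and x5: "0 \<le> x 5" "x 5 < p" "x 5 \<le> sum (m 13) {1..x 20}"
    and cg: "[residue_sum (m 5) (x 22) + g * x 5 = 0] (mod p)"
  shows "WP solve_code (\<lambda>t' x' m'. int t' \<le> int t + 60 * p \<and> base_vars p x' \<and> x' 22 = x 22 \<and>
    paired os (m' 5) (m' 6) \<and> p dvd residue_sum (m' 5) (x 22)) t x m" (is "WP _ ?Q _ _ _")
proof -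
  define I where "I = (\<lambda>(t'::nat) (x'::vars) (m'::arrays). base_vars p x' \<and> x' 22 = x 22 \<and>
    (\<forall>k. k \<notin> {5, 6} \<longrightarrow> m' k = m k) \<and> paired os (m' 5) (m' 6) \<and>
    gadgets g (m' 5) (m' 6) (m 11) (m 12) (m 13) (x' 20) \<and> 0 \<le> x' 20 \<and> x' 20 < p \<and>
    0 \<le> x' 5 \<and> x' 5 < p \<and> x' 5 \<le> sum (m 13) {1..x' 20} \<and>
    [residue_sum (m' 5) (x 22) + g * x' 5 = 0] (mod p) \<and> int t' + 55 * x' 20 \<le> int t + 55 * p)"
  have init: "I t x m" using assms by (auto simp: I_def)
  have step: "WP (Get 6 13 20 ;; Cond (CLt 5 6) Skip
       (Op Sub 5 5 6 ;; Get 6 11 20 ;; flip_code 6 ;; Get 6 12 20 ;; flip_code 6) ;; Op Sub 20 20 3) I (t' + 2) x' m'"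
    if I: "I t' x' m'" and nh: "\<not> holds (CEq 20 2) x'" for t' x' m'
  proof -
    define k where "k = x' 20"
    have bx: "base_vars p x'" and k: "1 \<le> k" "k < p" and x20: "x' 20 = k" 
      and m': "m' 11 = m 11" "m' 12 = m 12" "m' 13 = m 13" "\<forall>k. k \<notin> {5, 6} \<longrightarrow> m' k = m k"
      and pa: "paired os (m' 5) (m' 6)" and ga: "gadgets g (m' 5) (m' 6) (m 11) (m 12) (m 13) k"
      and x5: "0 \<le> x' 5" "x' 5 < p" "x' 5 \<le> sum (m 13) {1..k}"
      and cg: "[residue_sum (m' 5) (x 22) + g * x' 5 = 0] (mod p)" and x22: "x' 22 = x 22"
      and tm: "int t' + 55 * k \<le> int t + 55 * p"
      using I nh by (auto simp: I_def base_varsD k_def)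
    note bv = base_varsD[OF bx]
    define a1 a2 d where "a1 = m 11 k" and "a2 = m 12 k" and "d = m 13 k"
    have gk: "1 \<le> a1" "a1 < p" "0 \<le> a2" "a2 < p" "a1 \<noteq> a2" "1 \<le> d" "d \<le> 1 + sum (m 13) {1..k - 1}"
      "[change (m' 5) (m' 6) a1 + change (m' 5) (m' 6) a2 = g * d] (mod p)"
      using ga k unfolding gadgets_def a1_def a2_def d_def by auto
    have sm: "sum (m 13) {1..k} = sum (m 13) {1..k - 1} + d"
      using sum_upto_Suc[of "k - 1" "m 13"] k by (simp add: d_def)
    show ?thesis
    proof (cases "x' 5 < d")
      case True
      have "gadgets g (m' 5) (m' 6) (m 11) (m 12) (m 13) (k - 1)"
        using k by (intro gadgets_drop[OF ga pa pa]) auto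
      then show ?thesis
        using True k x5 gk sm p2 Bd(2) bx pa cg x22 m' tm
        by (simp add: bv x20 I_def d_def[symmetric])
    next
      case False
      define s1 l1 where "s1 = (m' 5)(a1 := m' 6 a1)" and "l1 = (m' 6)(a1 := m' 5 a1)"
      define s2 l2 where "s2 = s1(a2 := l1 a2)" and "l2 = l1(a2 := s1 a2)"
      have p1: "paired os s1 l1" unfolding s1_def l1_def by (rule paired_flip[OF pa])
      have p2': "paired os s2 l2" unfolding s2_def l2_def by (rule paired_flip[OF p1])
      have ga2: "gadgets g s2 l2 (m 11) (m 12) (m 13) (k - 1)"
        using k by (intro gadgets_drop[OF ga pa p2']) (auto simp: s1_def l1_def s2_def l2_def a1_def a2_def)
      have "residue_sum s2 (x 22) = residue_sum (m' 5) (x 22) + (change (m' 5) (m' 6) a1 + change (m' 5) (m' 6) a2)"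
        using residue_sum_flip[OF pa, of a1 "x 22"] residue_sum_flip[OF p1, of a2 "x 22"] gk
        by (simp add: s2_def s1_def l1_def change_def)
      then have "[residue_sum s2 (x 22) + g * (x' 5 - d) = residue_sum (m' 5) (x 22) + g * d + g * (x' 5 - d)] (mod p)"
        using gk(8) by (auto intro!: cong_add)
      also have "residue_sum (m' 5) (x 22) + g * d + g * (x' 5 - d) = residue_sum (m' 5) (x 22) + g * x' 5"
        by (simp add: algebra_simps)
      also note cg
      finally have cg2: "[residue_sum s2 (x 22) + g * (x' 5 - d) = 0] (mod p)" .
      have nxt: "I u y M" if "base_vars p y" "y 22 = x 22" "M 5 = s2" "M 6 = l2" "\<forall>k. k \<notin> {5, 6} \<longrightarrow> M k = m' k"
        "y 20 = k - 1" "y 5 = x' 5 - d" "u \<le> t' + 55" for u y M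
        using that p2' ga2 k x5 gk False sm cg2 tm m'(4) unfolding I_def by simp
      show ?thesis
        using False k x5 gk p2 Bd(2) bx
        by (simp add: bv x20 m' d_def[symmetric] a1_def[symmetric] a2_def[symmetric])
          (intro nxt; simp add: x22 s1_def l1_def s2_def l2_def)
    qed
  qed
  have exit: "?Q (t' + 1) x' m'" if I: "I t' x' m'" and h: "holds (CEq 20 2) x'" for t' x' m'
  proof -
    have "x' 20 = 0" using I h by (auto simp: I_def base_varsD)
    then have "x' 5 = 0" using I by (auto simp: I_def)
    then show ?thesis using I \<open>x' 20 = 0\<close> p2 by (auto simp: I_def cong_0_iff)
  qed
  have bound: "int t' \<le> int t + 55 * p" if "I t' x' m'" for t' x' m'
    using that unfolding I_def by linarith
  show ?thesis
    unfolding solve_code_def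
    by (rule wp_Until[where I = I and T = "int t + 55 * p"]) (fact init step exit bound)+
qed

lemma good_selection:
  assumes so: "sorts os" and pa: "paired os s l" and d: "p dvd residue_sum s (os (2 * p - 1))"
    and A: "A 0 = p" "A p = os (2 * p - 1)" "\<And>j. 1 \<le> j \<Longrightarrow> j < p \<Longrightarrow> A j = s j"
  shows "good A"
proof -
  \<comment> \<open>The sorted position of the \<open>j\<close>-th output. It lies in
    \<open>{1..p - 1}\<close>, in \<open>{p..2 * p - 2}\<close> or at \<open>2 * p - 1\<close>, and
    determines \<open>j\<close>, so injectivity reduces to that of \<open>os\<close>.\<close>
  define \<sigma> where "\<sigma> j = (if j = p then 2 * p - 1 else if s j = os j then j else j + p - 1)" for j
  have \<sigma>: "A j = os (\<sigma> j)" if "1 \<le> j" "j \<le> p" for j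
    using pa A(2) A(3)[of j] that unfolding paired_def \<sigma>_def by (cases "j = p") (auto dest!: spec[of _ j])
  have \<sigma>_bounds: "\<sigma> j \<in> {1..2 * p - 1}" if "1 \<le> j" "j \<le> p" for j
    using that by (auto simp: \<sigma>_def)
  have "inj_on A {1..p}"
  proof (rule inj_onI)
    fix i j assume ij: "i \<in> {1..p}" "j \<in> {1..p}" "A i = A j"
    then have "os (\<sigma> i) = os (\<sigma> j)" using \<sigma> by auto
    then have "\<sigma> i = \<sigma> j" using inj_onD[OF sorts_inj[OF so]] \<sigma>_bounds ij by auto
    then show "i = j" using ij by (auto simp: \<sigma>_def split: if_splits)
  qed
  moreover have im: "A j \<in> {1..2 * p - 1}" if "j \<in> {1..p}" for j
    using \<sigma>[of j] \<sigma>_bounds[of j] sorts_bounds[OF so, of "\<sigma> j"] that by auto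
  moreover have "p dvd (\<Sum>j\<in>{1..p}. a (A j))"
  proof -
    have "(\<Sum>j\<in>{1..p}. a (A j)) mod p = (\<Sum>j\<in>{1..p}. a (A j) mod p) mod p"
      by (simp add: mod_sum_eq)
    also have "(\<Sum>j\<in>{1..p}. a (A j) mod p) = (\<Sum>j\<in>{1..p}. r (A j))"
      using im by (intro sum.cong) (auto simp: r_def)
    also have "\<dots> = (\<Sum>j\<in>{1..p - 1}. r (A j)) + r (A p)"
      using sum_upto_Suc[of "p - 1" "\<lambda>j. r (A j)"] p2 by simp
    also have "(\<Sum>j\<in>{1..p - 1}. r (A j)) = (\<Sum>j\<in>{1..p - 1}. r (s j))"
      using A(3) by (intro sum.cong) auto
    also have "\<dots> + r (A p) = residue_sum s (os (2 * p - 1))"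
      by (simp add: residue_sum_def A(2))
    finally show ?thesis using d by (simp add: dvd_eq_mod_eq_0)
  qed
  ultimately show ?thesis using A(1) by (auto simp: good_def)
qed

lemma output_correct:
  assumes b: "base_vars p x" and so: "sorts os" and pa: "paired os (m 5) (m 6)"
    and x22: "x 22 = os (2 * p - 1)" and d: "p dvd residue_sum (m 5) (x 22)"
  shows "WP output_code (\<lambda>t' x' m'. int t' \<le> int t + 20 * p \<and> good (m' 0)) t x m" (is "WP _ ?Q _ _ _")
proof -
  define I where "I = (\<lambda>(t'::nat) (x'::vars) (m'::arrays). base_vars p x' \<and> x' 22 = x 22 \<and> m' 5 = m 5 \<and>
    1 \<le> x' 4 \<and> x' 4 \<le> p \<and> (\<forall>j. 1 \<le> j \<and> j < x' 4 \<longrightarrow> m' 0 j = m 5 j) \<and>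
    int t' + 11 * p - 11 * x' 4 \<le> int t + 1 + 11 * p)"
  have init: "I (t + 1) (x(4 := 1)) m" using b p2 by (auto simp: I_def)
  have step: "WP (Get 5 5 4 ;; Put 0 4 5 ;; Op Add 4 4 3) I (t' + 2) x' m'"
    if I: "I t' x' m'" and nh: "\<not> holds (CEq 4 0) x'" for t' x' m'
  proof -
    have bx: "base_vars p x'" and i: "1 \<le> x' 4" "x' 4 < p"
      using I nh by (auto simp: I_def base_varsD)
    show ?thesis
      using I i p2 base_varsD[OF bx] Bd(2) unfolding I_def by auto
  qed
  have exit: "WP (Put 0 0 22 ;; Put 0 2 0) ?Q (t' + 1) x' m'" if I: "I t' x' m'" and h: "holds (CEq 4 0) x'" for t' x' m'
  proof -
    have x4: "x' 4 = p" and bx: "base_vars p x'" using I h by (auto simp: I_def base_varsD)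
    have "good ((m' 0)(p := x 22, 0 := p))"
      using I x4 p2 x22 by (intro good_selection[OF so pa d[unfolded x22]]) (auto simp: I_def)
    then show ?thesis using I p2 base_varsD[OF bx] x4 by (simp add: I_def)
  qed
  have bound: "int t' \<le> int t + 1 + 11 * p" if "I t' x' m'" for t' x' m'
    using that unfolding I_def by linarith
  have "WP (Until (CEq 4 0) (Get 5 5 4 ;; Put 0 4 5 ;; Op Add 4 4 3))
      (WP (Put 0 0 22 ;; Put 0 2 0) ?Q) (t + 1) (x(4 := 1)) m"
    by (rule wp_Until[where I = I and T = "int t + 1 + 11 * p"]) (fact init step exit bound)+
  then show ?thesis
    unfolding output_code_def wp_Seq wp_Const using b p2 Bd(2) by auto
qed

end

subsection \<open>The program\<close>

definition main_code :: com where
  "main_code = setup_code ;; bucket_code ;; sort_code ;; item_code ;;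
     Cond (CEq 7 2)
       (argmax_code ;; scale_code ;; gadget_code ;; target_code ;; solve_code ;; output_code)
       constant_code"

lemma (in egz) varied_correct:
  assumes b: "base_vars p x" and x16: "x 16 = p - 1" and so: "sorts (m 3)" and m4: "m 4 = r"
    and nz: "\<And>j. 1 \<le> j \<Longrightarrow> j < p \<Longrightarrow> gap (m 3) j \<noteq> 0"
    and m5: "\<And>j. m 5 j = (if 1 \<le> j \<and> j < p then m 3 j else 0)"
    and m6: "\<And>j. m 6 j = (if 1 \<le> j \<and> j < p then m 3 (j + p - 1) else 0)"
    and m7: "\<And>j. 1 \<le> j \<Longrightarrow> j < p \<Longrightarrow> m 7 j = gap (m 3) j"
    and m8: "\<And>e. m 8 e = int (length (bucket (\<lambda>j. fold_residue p (gap (m 3) j)) p e))"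
    and m9: "m 9 = (\<lambda>_. 0)"
  shows "WP (argmax_code ;; scale_code ;; gadget_code ;; target_code ;; solve_code ;; output_code)
    (\<lambda>t' x' m'. int t' \<le> int t + 600 * p \<and> good (m' 0)) t x m"
  unfolding wp_Seq
proof (rule wp_mono[OF argmax_correct[OF b]], elim conjE)
  fix t1 :: nat and x1 :: vars and m1 :: arrays
  assume 1: "int t1 \<le> int t + 20 * p" "base_vars p x1" "x1 16 = x 16" "1 \<le> x1 10" "x1 10 < p"
    "\<forall>e. 1 \<le> e \<and> e < p \<longrightarrow> m 8 e \<le> m 8 (x1 10)" "0 \<le> x1 12" "x1 12 < p" "[x1 10 * x1 12 = 1] (mod p)" "m1 = m"
  let ?g = "x1 10" and ?h = "x1 12" and ?os = "m 3"
  have sch: "sched p (int (length (bucket (item_size ?os ?h) p 1)))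
      (\<lambda>c. int (length (bucket (item_size ?os ?h) p c))) 1 0 1 0 (4 * p)"
    using 1(6) by (intro initial_sched[OF 1(9) so 1(4,5) nz]) (auto simp: m8)
  have sumk: "(\<Sum>c\<in>{1..p}. int (length (bucket (item_size ?os ?h) p c))) \<le> p - 1"
  proof -
    \<comment> \<open>Adding size 0 to the range makes the general bounds on
      \<open>item_size\<close> sufficient for counting all items.\<close>
    have "(\<Sum>c\<in>{1..p}. int (length (bucket (item_size ?os ?h) p c))) \<le>
        (\<Sum>c\<in>{0..p}. int (length (bucket (item_size ?os ?h) p c)))"
      by (intro sum_mono2) auto
    also have "\<dots> = p - 1"
    proof (rule sum_length_bucket)
      fix j show "item_size ?os ?h j \<in> {0..p}" using item_size_bounds[of ?os ?h j] p2 by auto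
    qed (use p2 in auto)
    finally show ?thesis .
  qed
  show "WP scale_code (WP gadget_code (WP target_code (WP solve_code (WP output_code
      (\<lambda>t' x' m'. int t' \<le> int t + 600 * p \<and> good (m' 0)))))) t1 x1 m1"
    unfolding 1(10)
  proof (rule wp_mono[OF scale_correct[where g = ?g]], goal_cases)
    case (10 t2 x2 m2)
    then have 2: "int t2 \<le> int t1 + 50 * p" "base_vars p x2" "x2 16 = x1 16" "x2 12 = x1 12" "paired ?os (m2 5) (m2 6)"
      "\<forall>j. 1 \<le> j \<and> j < p \<longrightarrow> [change (m2 5) (m2 6) j = ?g * item_size ?os ?h j] (mod p)"
      "\<forall>c. chain (m2 10) (m2 9 c) (bucket (item_size ?os ?h) p c)"
      "\<forall>k. k \<notin> {5, 6, 9, 10} \<longrightarrow> m2 k = m k"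
      by blast+
    have m2: "m2 3 = ?os" "m2 4 = r" using 2(8) m4 by auto
    have "WP gadget_code (\<lambda>t' x' m'. int t' \<le> int t2 + 400 * p \<and> base_vars p x' \<and> x' 12 = x2 12 \<and>
      paired ?os (m' 5) (m' 6) \<and> gadgets ?g (m' 5) (m' 6) (m' 11) (m' 12) (m' 13) (x' 20) \<and>
      0 \<le> x' 20 \<and> x' 20 < p \<and> p - 1 \<le> sum (m' 13) {1..x' 20} \<and> m' 3 = ?os \<and> m' 4 = r) t2 x2 m2"
      by (rule gadget_correct[OF 2(2) _ m2 2(5)]; (unfold 2(4))?)
        (use 1(3) 2(3,6,7) x16 sch sumk in auto)
    then show ?case
    proof (rule wp_mono, elim conjE)
      fix t3 :: nat and x3 :: vars and m3 :: arrays
      assume 3: "int t3 \<le> int t2 + 400 * p" "base_vars p x3" "x3 12 = x2 12" "paired ?os (m3 5) (m3 6)"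
        "gadgets ?g (m3 5) (m3 6) (m3 11) (m3 12) (m3 13) (x3 20)" "0 \<le> x3 20" "x3 20 < p"
        "p - 1 \<le> sum (m3 13) {1..x3 20}" "m3 3 = ?os" "m3 4 = r"
      have h: "0 \<le> x3 12" "x3 12 < p" "[?g * x3 12 = 1] (mod p)" using 1(7-9) 2(4) 3(3) by auto
      show "WP target_code (WP solve_code (WP output_code
        (\<lambda>t' x' m'. int t' \<le> int t + 600 * p \<and> good (m' 0)))) t3 x3 m3"
      proof (rule wp_mono[OF target_correct[where g = ?g]], goal_cases)
        case (8 t4 x4 m4)
        then have 4: "int t4 \<le> int t3 + 25 * p" "base_vars p x4" "m4 = m3" "x4 20 = x3 20"
          "x4 22 = ?os (2 * p - 1)" "0 \<le> x4 5" "x4 5 < p" "[residue_sum (m3 5) (x4 22) + ?g * x4 5 = 0] (mod p)"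
          unfolding 3(9) by blast+
        have x5: "x4 5 \<le> sum (m3 13) {1..x4 20}" using 4(4,7) \<open>p - 1 \<le> sum (m3 13) {1..x3 20}\<close> by simp
        show ?case unfolding 4(3)
        proof (rule wp_mono[OF solve_correct[where g = ?g and os = ?os]], goal_cases)
          case (11 t5 x5 m5)
          then have 5: "int t5 \<le> int t4 + 60 * p" "base_vars p x5" "x5 22 = x4 22" "paired ?os (m5 5) (m5 6)"
            "p dvd residue_sum (m5 5) (x5 22)" by simp_all
          have x22: "x5 22 = ?os (2 * p - 1)" using 5(3) \<open>x4 22 = ?os (2 * p - 1)\<close> by simp
          show ?case
            by (rule wp_mono[OF output_correct[OF 5(2) so 5(4) x22 5(5)]])
              (use 1(1) 2(1) \<open>int t3 \<le> int t2 + 400 * p\<close> \<open>int t4 \<le> int t3 + 25 * p\<close> 5(1) p2 in auto)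
        qed (use 3(4-7) 4(2,4,6-8) so x5 in simp_all)
      qed (use so 3(2,4,9,10) h in simp_all)
    qed
  qed (fact 1(2) so 1(7-9) m5 m6 m7 m9)+
qed

lemma (in egz) main_correct:
  assumes "m 0 = a" "\<And>k. 1 \<le> k \<Longrightarrow> m k = (\<lambda>_. 0)"
  shows "WP main_code (\<lambda>t' x' m'. int t' \<le> int t + 750 * p \<and> good (m' 0)) t x m"
  unfolding main_code_def wp_Seq[of _ _ setup_code] wp_Seq[of _ _ bucket_code] wp_Seq[of _ _ sort_code]
    wp_Seq[of _ _ item_code]
proof (rule wp_mono[OF setup_correct[of m, OF assms(1)]], elim conjE)
  let ?Q = "\<lambda>t' x' m'. int t' \<le> int t + 750 * p \<and> good (m' 0)"
  let ?C = "Cond (CEq 7 2) (argmax_code ;; scale_code ;; gadget_code ;; target_code ;; solve_code ;; output_code) constant_code"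
  fix t0 x0 m0 assume 0: "t0 = t + 9" "base_vars p x0" "m0 = m"
  show "WP bucket_code (WP sort_code (WP item_code (WP ?C ?Q))) t0 x0 m0"
    unfolding 0(3)
  proof (rule wp_mono[OF bucket_correct], goal_cases)
    case (4 t1 x1 m1)
    then have 1: "int t1 \<le> int t0 + 50 * p" "base_vars p x1"
      "\<And>c. 0 \<le> c \<Longrightarrow> c < p \<Longrightarrow> chain (m1 2) (m1 1 c) (bucket r (2 * p) c)" "m1 4 = r"
      "\<And>k. 5 \<le> k \<Longrightarrow> m1 k = (\<lambda>_. 0)" by auto
    show ?case
    proof (rule wp_mono[OF sort_correct], goal_cases)
      case (3 t2 x2 m2)
      then have 2: "int t2 \<le> int t1 + 40 * p" "base_vars p x2" "sorts (m2 3)" "\<And>k. k \<noteq> 3 \<Longrightarrow> m2 k = m1 k" by auto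
      have m2: "m2 4 = r" "\<And>k. k \<in> {5..8} \<Longrightarrow> m2 k = (\<lambda>_. 0)" "m2 9 = (\<lambda>_. 0)" using 2(4) 1(4,5) by auto
      show ?case
      proof (rule wp_mono[OF item_correct], goal_cases)
        case (5 t3 x3 m3)
        then have 3: "int t3 \<le> int t2 + 50 * p" "base_vars p x3" "x3 16 = p - 1"
          "x3 7 = 0 \<and> (\<forall>j. 1 \<le> j \<and> j < p \<longrightarrow> gap (m2 3) j \<noteq> 0) \<or> 1 \<le> x3 7 \<and> x3 7 < p \<and> gap (m2 3) (x3 7) = 0"
          "\<forall>j. m3 5 j = (if 1 \<le> j \<and> j < p then m2 3 j else 0)"
          "\<forall>j. m3 6 j = (if 1 \<le> j \<and> j < p then m2 3 (j + p - 1) else 0)"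
          "\<forall>j. 1 \<le> j \<and> j < p \<longrightarrow> m3 7 j = gap (m2 3) j"
          "\<forall>e. m3 8 e = int (length (bucket (\<lambda>j. fold_residue p (gap (m2 3) j)) p e))"
          "\<forall>k. k \<notin> {5..8} \<longrightarrow> m3 k = m2 k"
          by blast+
        have m3: "m3 3 = m2 3" "m3 4 = r" "m3 9 = (\<lambda>_. 0)" using 3(9) m2 by auto
        have so: "sorts (m3 3)" using \<open>sorts (m2 3)\<close> m3 by simp
        have tm: "int t3 \<le> int t + 9 + 140 * p"
          using 0(1) 1(1) \<open>int t2 \<le> int t1 + 40 * p\<close> 3(1) by linarith
        show ?case
        proof (cases "x3 7 = 0")
          case True
          have "WP (argmax_code ;; scale_code ;; gadget_code ;; target_code ;; solve_code ;; output_code)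
            (\<lambda>t' x' m'. int t' \<le> int (t3 + 1) + 600 * p \<and> good (m' 0)) (t3 + 1) x3 m3"
            by (rule varied_correct[OF 3(2,3) so m3(2)]) (use True 3(4-8) m3 in auto)
          then have "WP (argmax_code ;; scale_code ;; gadget_code ;; target_code ;; solve_code ;; output_code) ?Q (t3 + 1) x3 m3"
            by (rule wp_mono) (use tm p2 in auto)
          then show ?thesis
            unfolding wp_Cond using True base_varsD[OF 3(2)] by simp
        next
          case False
          have "WP constant_code (\<lambda>t' x' m'. int t' \<le> int (t3 + 2) + 20 * p \<and> good (m' 0)) (t3 + 2) x3 m3"
            by (rule constant_correct) (use False 3(2,4) so m3 in auto)
          then have "WP constant_code ?Q (t3 + 2) x3 m3"
            by (rule wp_mono) (use tm p2 in auto)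
          then show ?thesis
            unfolding wp_Cond using False base_varsD[OF 3(2)] by simp
        qed
      qed (fact 2(2,3) m2(1,2))+
    qed (fact 1(2,3))+
  qed (fact 0(2) assms)+
qed

text \<open>The four leading instructions set register 1 to the input length plus one, which is the
  array length \<open>2 * p\<close>.\<close>

definition egz_program :: program where
  "egz_program = [LoadConst 0 0, Load 1 0, LoadConst 0 1, BinOp Add 1 1 0] @ compile 4 main_code"

text \<open>The constant 9 splits as 7 + 2: from \<open>2 ^ w \<ge> p ^ 9\<close> and
  \<open>p ^ 7 \<ge> 2 ^ 7\<close> follows \<open>2 ^ w \<ge> 128 * p * p\<close>, a factor 2 above
  what the strict bound on \<open>2 ^ (w - 1)\<close> needs.\<close>

lemma word_size_bound:
  fixes p w :: nat
  assumes "2 \<le> p" "real w \<ge> 9 * log 2 (real p)"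
  shows "32 * int p * int p < 2 ^ (w - 1)"
proof -
  have "real p ^ 9 = (2 powr log 2 (real p)) powr 9"
    using assms(1) by simp
  also have "\<dots> = 2 powr (9 * log 2 (real p))"
    unfolding powr_powr by (simp only: mult.commute)
  also have "\<dots> \<le> 2 powr real w" using assms(2) by (intro powr_mono) auto
  also have "\<dots> = 2 ^ w" by (simp add: powr_realpow)
  finally have "real (p ^ 9) \<le> real (2 ^ w)" by simp
  then have 1: "p ^ 9 \<le> 2 ^ w" by (simp only: of_nat_le_iff)
  have "(2::nat) ^ 7 \<le> p ^ 7" using assms(1) by (intro power_mono) auto
  then have "2 ^ 7 * (p * p) \<le> p ^ 7 * (p * p)" by (rule mult_right_mono) simp
  also have "\<dots> = p ^ 9" by (simp add: eval_nat_numeral)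
  finally have 2: "128 * (p * p) \<le> 2 ^ w" using 1 by simp
  have pp: "0 < p * p" using assms(1) by simp
  have "w \<noteq> 0"
  proof
    assume "w = 0"
    with 2 have "128 * (p * p) \<le> 1" by (simp only: power_0)
    with pp show False by linarith
  qed
  then have "(2::nat) ^ w = 2 * 2 ^ (w - 1)" by (cases w) auto
  then have "32 * p * p < 2 ^ (w - 1)" using 2 pp by linarith
  then have "int (32 * p * p) < int (2 ^ (w - 1))" by (simp only: of_nat_less_iff)
  then show ?thesis by simp
qed

lemma egz_program_correct:
  fixes p w :: nat and a :: "nat \<Rightarrow> int"
  assumes p: "prime p" and w: "real w \<ge> 9 * log 2 (real p)"
  shows "\<exists>ks. returns_within w egz_program (map a [1..<2 * p]) (800 * p) (map int ks) \<and>
    distinct ks \<and> set ks \<subseteq> {1..2 * p - 1} \<and> card (set ks) = p \<and> int p dvd (\<Sum>i\<in>set ks. a i)"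
proof -
  define q where "q = int p"
  define A where "A = (\<lambda>j. if j = 0 then 2 * q - 1 else if 1 \<le> j \<and> j < 2 * q then a (nat j) else 0)"
  define m where "m = (\<lambda>k::nat. if k = 0 then A else (\<lambda>_. 0))"
  let ?xs = "map a [1..<2 * p]"
  have p2: "2 \<le> p" using p prime_ge_2_nat by blast
  have wb: "32 * q * q < 2 ^ (w - 1)" using word_size_bound[OF p2 w] by (simp add: q_def)
  have "2 * q \<le> q * q" using p2 by (intro mult_right_mono) (auto simp: q_def)
  then have bd: "64 * q \<le> 32 * q * q" by simp
  have "prime q" using p by (simp add: q_def)
  then interpret egz q A "32 * q * q"
    by unfold_locales (use bd in \<open>auto simp: A_def\<close>)
  have "m 0 = A" "\<And>k. 1 \<le> k \<Longrightarrow> m k = (\<lambda>_. 0)" by (auto simp: m_def)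
  from main_correct[of m 0 "\<lambda>_. 0", OF this] obtain t x' m' where
    ex: "exec (2 * q) (32 * q * q) main_code 0 (\<lambda>_. 0) m t x' m'" and t: "int t \<le> 750 * q" and good: "good (m' 0)"
    unfolding wp_def by auto
  define S0 where "S0 = init_state ?xs"
  define S where "S = S0\<lparr>pc := 4, regs := (\<lambda>_. 0)(1 := 2 * q, 0 := 1)\<rparr>"
  have len: "length ?xs = 2 * p - 1" "int (length ?xs) = 2 * q - 1" using p2 by (auto simp: q_def)
  have q2: "2 \<le> q" using p2 by (simp add: q_def)
  have tw: "to_word w 0 = 0" "to_word w 1 = 1" "to_word w (2 * q) = 2 * q"
    by (rule to_word_eq; use wb bd q2 in linarith)+
  have m0: "mem S0 0 = 2 * q - 1" unfolding S0_def init_state_def using len by simp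
  have S0: "pc S0 = 0" "regs S0 = (\<lambda>_. 0)" by (auto simp: S0_def init_state_def)
  have "(step w egz_program ^^ 4) S0 = S"
    using S0 m0 by (simp add: eval_nat_numeral step_def halted_def egz_program_def set_reg_def S_def tw fun_upd_twist)
  moreover have "represents (2 * q) S (\<lambda>_. 0) m"
    unfolding represents_def
  proof (intro conjI allI impI)
    show "regs S 1 = 2 * q" "regs S (r + 2) = 0" for r by (auto simp: S_def)
    fix k :: nat and i :: int assume i: "0 \<le> i \<and> i < 2 * q"
    have mem: "mem S j = (if j = 0 then 2 * q - 1 else if 1 \<le> j \<and> j \<le> 2 * q - 1 then ?xs ! nat (j - 1) else 0)" for j
      unfolding S_def S0_def init_state_def using len by simp
    show "mem S (int k * (2 * q) + i) = m k i"
    proof (cases "k = 0")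
      case True
      have "?xs ! nat (i - 1) = a (nat i)" if "1 \<le> i"
      proof -
        have "nat (i - 1) < 2 * p - 1" using i that by (auto simp: q_def)
        moreover have "1 + nat (i - 1) = nat i" using that by simp
        ultimately show ?thesis by simp
      qed
      then show ?thesis using True i unfolding mem m_def A_def by auto
    next
      case False
      \<comment> \<open>The arrays from 1 on lie beyond the input, where memory is initially
        0.\<close>
      then have "1 * (2 * q) \<le> int k * (2 * q)" using q2 by (intro mult_right_mono) auto
      then have "2 * q \<le> int k * (2 * q) + i" using i by linarith
      then show ?thesis using False q2 unfolding mem m_def by auto
    qed
  qed
  moreover have "\<exists>n S'. t = 0 + n \<and> (step w egz_program ^^ n) S = S' \<and> represents (2 * q) S' x' m' \<and>
      pc S' = 4 + code_size main_code" if "represents (2 * q) S (\<lambda>_. 0) m"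
  proof (rule compile_correct[OF ex that])
    have "code_at egz_program 0 egz_program" by (simp add: code_at_def)
    then show "code_at egz_program 4 (compile 4 main_code)"
      by (subst (asm) (2) egz_program_def) (simp add: eval_nat_numeral)
    show "pc S = 4" by (simp add: S_def)
    show "16 * (2 * q) < 2 ^ (w - 1)" "16 < (2::int) ^ (w - 1)" "32 * q * q < 2 ^ (w - 1)"
      using wb bd q2 by linarith+
  qed
  ultimately obtain S' where S': "(step w egz_program ^^ t) ((step w egz_program ^^ 4) S0) = S'" "represents (2 * q) S' x' m'"
    "pc S' = 4 + code_size main_code" by auto
  have run: "(step w egz_program ^^ (4 + t)) S0 = S'"
    using funpow_add_apply[OF refl S'(1)] .
  have halt: "halted egz_program S'" using S'(3) by (simp add: halted_def egz_program_def)
  have mem: "mem S' j = m' 0 j" if "0 \<le> j" "j < 2 * q" for j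
    using S'(2) that unfolding represents_def by (metis add_0 mult_zero_left of_nat_0)
  have g: "m' 0 0 = q" "inj_on (m' 0) {1..q}" "m' 0 ` {1..q} \<subseteq> {1..2 * q - 1}" "q dvd (\<Sum>j\<in>{1..q}. A (m' 0 j))"
    using good by (auto simp: good_def)
  have out: "output_list S' = map (m' 0) [1..q]"
    unfolding output_list_def using mem[of 0] g(1) mem q2 by simp
  define ks where "ks = map (\<lambda>j. nat (m' 0 j)) [1..q]"
  have vb: "1 \<le> m' 0 j \<and> m' 0 j < 2 * q" if "j \<in> {1..q}" for j using g(3) that by force
  have ks: "map int ks = map (m' 0) [1..q]" using vb by (force simp: ks_def)
  have inj: "inj_on (\<lambda>j. nat (m' 0 j)) {1..q}"
  proof (rule inj_onI)
    fix i j assume ij: "i \<in> {1..q}" "j \<in> {1..q}" "nat (m' 0 i) = nat (m' 0 j)"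
    then have "m' 0 i = m' 0 j" using vb[OF ij(1)] vb[OF ij(2)] by auto
    then show "i = j" using g(2) ij by (auto dest: inj_onD)
  qed
  have set: "set ks = (\<lambda>j. nat (m' 0 j)) ` {1..q}" by (simp add: ks_def)
  \<comment> \<open>The four set-up steps and the \<open>750 * p\<close> steps of the main code fit
    into \<open>800 * p\<close>.\<close>
  have "returns_within w egz_program ?xs (800 * p) (map int ks)"
    unfolding returns_within_def Let_def
    using run halt out ks t q2 by (intro exI[of _ "4 + t"]) (auto simp: S0_def q_def)
  moreover have "distinct ks" using inj by (simp add: ks_def distinct_map)
  moreover have "set ks \<subseteq> {1..2 * p - 1}"
  proof
    fix y assume "y \<in> set ks"
    then obtain j where "j \<in> {1..q}" "y = nat (m' 0 j)" unfolding set by blast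
    then show "y \<in> {1..2 * p - 1}" using vb[of j] by (auto simp: q_def)
  qed
  moreover have "card (set ks) = p" unfolding set card_image[OF inj] by (simp add: q_def)
  moreover have "int p dvd (\<Sum>i\<in>set ks. a i)"
  proof -
    have "(\<Sum>i\<in>set ks. a i) = (\<Sum>j\<in>{1..q}. a (nat (m' 0 j)))"
      unfolding set by (simp add: sum.reindex[OF inj])
    also have "\<dots> = (\<Sum>j\<in>{1..q}. A (m' 0 j))"
      by (rule sum.cong) (use vb in \<open>force simp: A_def\<close>)+
    finally show ?thesis using g(4) by (simp add: q_def)
  qed
  ultimately show ?thesis by blast
qed

theorem theorem5:
  shows "\<exists>(P :: program) (c :: real) (T :: nat \<Rightarrow> nat).
    (\<lambda>p. real (T p)) \<in> O(\<lambda>p. real p) \<and>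
    (\<forall>(p :: nat) (w :: nat) (a :: nat \<Rightarrow> int).
      prime p \<and> real w \<ge> c * log 2 (real p) \<and> (\<forall>i\<in>{1..2 * p - 1}. is_word w (a i)) \<longrightarrow>
      (\<exists>(I :: nat set) (ks :: nat list).
        returns_within w P (map a [1..<2 * p]) (T p) (map int ks) \<and>
        distinct ks \<and> set ks = I \<and>
        I \<subseteq> {1..2 * p - 1} \<and> card I = p \<and> int p dvd (\<Sum>i\<in>I. a i)))"
proof (rule exI[of _ egz_program], rule exI[of _ 9], rule exI[of _ "\<lambda>p. 800 * p"], intro conjI allI impI)
  show "(\<lambda>p. real (800 * p)) \<in> O(\<lambda>p. real p)"
    by (intro bigoI[of _ 800]) simp
next
  fix p w :: nat and a :: "nat \<Rightarrow> int"
  assume "prime p \<and> real w \<ge> 9 * log 2 (real p) \<and> (\<forall>i\<in>{1..2 * p - 1}. is_word w (a i))"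
  then show "\<exists>(I :: nat set) (ks :: nat list).
        returns_within w egz_program (map a [1..<2 * p]) (800 * p) (map int ks) \<and>
        distinct ks \<and> set ks = I \<and>
        I \<subseteq> {1..2 * p - 1} \<and> card I = p \<and> int p dvd (\<Sum>i\<in>I. a i)"
    using egz_program_correct[of p w a] by blast
qed

end
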